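(* There is a one-to-one correspondence between the set of eigenvalues $\{\lambda_j^\varepsilon\}_{j=1}^\infty$ of the perturbed problem (P$_\varepsilon$) and the spectrum of the operator $\mathcal{A}$ (eigenvalues repeated according to multiplicity), namely, $\varepsilon^{-1}\lambda_j^\varepsilon\to\mu_j$ as $\varepsilon\to0$ for each $j\in\mathbb{N}$. Furthermore, the corresponding eigenfunctions $u_{\varepsilon,j}$, normalized as in the context, converge in $H^1(a,b)$ as $\varepsilon\to0$ towards an eigenfunction $u$ of $\mathcal{A}$ with eigenvalue $\mu_j$.
   Context: Let $a<0<b$, $I_a=(a,0)$, $I_b=(0,b)$. Let $k,r$ be smooth positive functions on $[a,0]$ and $\kappa,\rho$ smooth positive functions on $[0,b]$. Let $R=r$ on $I_a$ and $R=\rho$ on $I_b$. Perturbed problem (P$_\varepsilon$), $\varepsilon>0$: $(k u_\varepsilon')'+\varepsilon^{-1}\lambda^\varepsilon r u_\varepsilon=0$ in $I_a$; $\ \varepsilon(\kappa u_\varepsilon')'+\lambda^\varepsilon\rho u_\varepsilon=0$ in $I_b$; $\ u_\varepsilon(-0)=u_\varepsilon(+0)$, $\ (ku_\varepsilon')(-0)=\varepsilon(\kappa u_\varepsilon')(+0)$; $\ u_\varepsilon(a)=0$, $u_\varepsilon(b)=0$. Its spectrum is real, discrete and simple, $0<\lambda_1^\varepsilon<\lambda_2^\varepsilon<\dots\to\infty$. The corresponding real-valued eigenfunctions $u_{\varepsilon,j}$ are normalized by $\int_a^b R\,u_{\varepsilon,j}^2\,dx=1$ and $u_{\varepsilon,j}'(b)>0$.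 The operator $\mathcal{A}$ acts in $\mathcal{L}=L_2(r,I_a)\oplus L_2(\rho,I_b)$ (weighted $L_2$-spaces with weights $r$, $\rho$) by $\mathcal{A}(u_1,u_2)=\bigl(-\frac1r(ku_1')',\,-\frac1\rho(\kappa u_2')'\bigr)$ on the domain $\{(u_1,u_2)\in H^2(I_a)\oplus H^2(I_b): u_1(a)=0,\ u_1'(0)=0,\ u_2(b)=0,\ u_1(0)=u_2(0)\}$. A pair $(u_1,u_2)\in\mathcal{L}$ is identified with the function on $(a,b)$ equal to $u_1$ on $I_a$ and $u_2$ on $I_b$. The spectrum of $\mathcal{A}$ is real and discrete; its eigenvalues are enumerated in increasing order, $\mu_1\le\mu_2\le\cdots\le\mu_j\le\cdots$, each repeated according to its algebraic multiplicity. *)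

theory Defs
  imports "HOL-Analysis.Analysis" "HOL-Library.Function_Algebras"
begin

section \<open>Function spaces on compact intervals\<close>

text \<open>All orders of derivatives exist up to the end points (one-sided there).\<close>

definition smooth_on_interval :: "real \<Rightarrow> real \<Rightarrow> (real \<Rightarrow> real) \<Rightarrow> bool" where
  "smooth_on_interval c d f \<longleftrightarrow>
     (\<exists>F :: nat \<Rightarrow> real \<Rightarrow> real. (\<forall>x\<in>{c..d}. F 0 x = f x) \<and>
        (\<forall>n. \<forall>x\<in>{c..d}. (F n has_real_derivative F (Suc n) x) (at x within {c..d})))"

text \<open>Elements of \<open>L\<^sub>2\<close> are represented by functions, not by classes modulo null sets.\<close>

definition L2_on :: "real \<Rightarrow> real \<Rightarrow> (real \<Rightarrow> real) \<Rightarrow> (real \<Rightarrow> complex) \<Rightarrow> bool" where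
  "L2_on c d w f \<longleftrightarrow> f \<in> borel_measurable (lebesgue_on {c..d}) \<and>
     (\<lambda>x. w x * (cmod (f x))\<^sup>2) integrable_on {c..d}"

text \<open>
  In one dimension, a function is in \<open>H\<^sup>1(c,d)\<close> with weak derivative \<open>v\<close> iff its continuous
  representative is the indefinite integral of \<open>v\<close> and \<open>v\<close> is in \<open>L\<^sub>2(c,d)\<close>.  Functions are
  always represented by that continuous representative on the closed interval, so that
  \<open>u c\<close> and \<open>u d\<close> are the boundary traces.
\<close>

definition has_weak_deriv :: "real \<Rightarrow> real \<Rightarrow> (real \<Rightarrow> complex) \<Rightarrow> (real \<Rightarrow> complex) \<Rightarrow> bool" where
  "has_weak_deriv c d u v \<longleftrightarrow> L2_on c d (\<lambda>_. 1) v \<and>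
     (\<forall>x\<in>{c..d}. u x = u c + integral {c..x} v)"

definition in_H1 :: "real \<Rightarrow> real \<Rightarrow> (real \<Rightarrow> complex) \<Rightarrow> bool" where
  "in_H1 c d u \<longleftrightarrow> (\<exists>v. has_weak_deriv c d u v)"

text \<open>The weak derivative is unique almost everywhere, so the choice does not affect the norm.\<close>

definition H1_norm :: "real \<Rightarrow> real \<Rightarrow> (real \<Rightarrow> complex) \<Rightarrow> real" where
  "H1_norm c d u = sqrt (integral {c..d} (\<lambda>x. (cmod (u x))\<^sup>2) +
     integral {c..d} (\<lambda>x. (cmod ((SOME v. has_weak_deriv c d u v) x))\<^sup>2))"

section \<open>The perturbed problem\<close>

text \<open>
  Since the coefficients are smooth up to the end points, classical solutions on the open
  intervals are smooth up to the end points, and the equations are imposed on the closed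
  intervals with one-sided derivatives.  Here \<open>p 0\<close> is \<open>u'(-0)\<close> and \<open>q 0\<close> is \<open>u'(+0)\<close>;
  continuity of \<open>u\<close> at 0 is implied by differentiability from both sides.
\<close>

definition perturbed_solution ::
  "real \<Rightarrow> real \<Rightarrow> (real \<Rightarrow> real) \<Rightarrow> (real \<Rightarrow> real) \<Rightarrow> (real \<Rightarrow> real) \<Rightarrow> (real \<Rightarrow> real) \<Rightarrow>
   real \<Rightarrow> complex \<Rightarrow> (real \<Rightarrow> complex) \<Rightarrow> bool" where
  "perturbed_solution a b k r \<kappa> \<rho> \<epsilon> z u \<longleftrightarrow>
     (\<exists>p q p' q'.
        (\<forall>x\<in>{a..0}. (u has_vector_derivative p x) (at x within {a..0}) \<and>
           ((\<lambda>x. of_real (k x) * p x) has_vector_derivative p' x) (at x within {a..0}) \<and>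
           p' x + of_real (inverse \<epsilon>) * z * of_real (r x) * u x = 0) \<and>
        (\<forall>x\<in>{0..b}. (u has_vector_derivative q x) (at x within {0..b}) \<and>
           ((\<lambda>x. of_real (\<kappa> x) * q x) has_vector_derivative q' x) (at x within {0..b}) \<and>
           of_real \<epsilon> * q' x + z * of_real (\<rho> x) * u x = 0) \<and>
        of_real (k 0) * p 0 = of_real \<epsilon> * (of_real (\<kappa> 0) * q 0) \<and>
        u a = 0 \<and> u b = 0)"

definition perturbed_eigenvalues ::
  "real \<Rightarrow> real \<Rightarrow> (real \<Rightarrow> real) \<Rightarrow> (real \<Rightarrow> real) \<Rightarrow> (real \<Rightarrow> real) \<Rightarrow> (real \<Rightarrow> real) \<Rightarrow>
   real \<Rightarrow> complex set" where
  "perturbed_eigenvalues a b k r \<kappa> \<rho> \<epsilon> =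
     {z. \<exists>u. perturbed_solution a b k r \<kappa> \<rho> \<epsilon> z u \<and> (\<exists>x\<in>{a..b}. u x \<noteq> 0)}"

text \<open>Eigenvalues are enumerated from index 0; all of them are simple.\<close>

definition enumerates_perturbed ::
  "real \<Rightarrow> real \<Rightarrow> (real \<Rightarrow> real) \<Rightarrow> (real \<Rightarrow> real) \<Rightarrow> (real \<Rightarrow> real) \<Rightarrow> (real \<Rightarrow> real) \<Rightarrow>
   real \<Rightarrow> (nat \<Rightarrow> real) \<Rightarrow> bool" where
  "enumerates_perturbed a b k r \<kappa> \<rho> \<epsilon> lam \<longleftrightarrow>
     strict_mono lam \<and> range (\<lambda>j. complex_of_real (lam j)) = perturbed_eigenvalues a b k r \<kappa> \<rho> \<epsilon>"

definition normalized_eigenfunction ::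
  "real \<Rightarrow> real \<Rightarrow> (real \<Rightarrow> real) \<Rightarrow> (real \<Rightarrow> real) \<Rightarrow> (real \<Rightarrow> real) \<Rightarrow> (real \<Rightarrow> real) \<Rightarrow>
   real \<Rightarrow> real \<Rightarrow> (real \<Rightarrow> real) \<Rightarrow> bool" where
  "normalized_eigenfunction a b k r \<kappa> \<rho> \<epsilon> l u \<longleftrightarrow>
     perturbed_solution a b k r \<kappa> \<rho> \<epsilon> (of_real l) (\<lambda>x. of_real (u x)) \<and>
     ((\<lambda>x. (if x < 0 then r x else \<rho> x) * (u x)\<^sup>2) has_integral 1) {a..b} \<and>
     (\<exists>d>0. (u has_real_derivative d) (at b within {a..b}))"

section \<open>The limit operator\<close>

type_synonym fpair = "(real \<Rightarrow> complex) \<times> (real \<Rightarrow> complex)"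

definition glue :: "fpair \<Rightarrow> real \<Rightarrow> complex" where
  "glue u x = (if x < 0 then fst u x else snd u x)"

definition pair_scale :: "complex \<Rightarrow> fpair \<Rightarrow> fpair" where
  "pair_scale c u = (\<lambda>x. c * fst u x, \<lambda>x. c * snd u x)"

global_interpretation fpair: vector_space pair_scale
  by unfold_locales
    (auto simp: pair_scale_def plus_fun_def prod_eq_iff algebra_simps fun_eq_iff)

definition in_L :: "real \<Rightarrow> real \<Rightarrow> (real \<Rightarrow> real) \<Rightarrow> (real \<Rightarrow> real) \<Rightarrow> fpair \<Rightarrow> bool" where
  "in_L a b r \<rho> f \<longleftrightarrow> L2_on a 0 r (fst f) \<and> L2_on 0 b \<rho> (snd f)"

definition L_norm :: "real \<Rightarrow> real \<Rightarrow> (real \<Rightarrow> real) \<Rightarrow> (real \<Rightarrow> real) \<Rightarrow> fpair \<Rightarrow> real" where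
  "L_norm a b r \<rho> f = sqrt (integral {a..0} (\<lambda>x. r x * (cmod (fst f x))\<^sup>2) +
     integral {0..b} (\<lambda>x. \<rho> x * (cmod (snd f x))\<^sup>2))"

text \<open>
  The graph of the operator: \<open>A_graph a b k r \<kappa> \<rho> u f\<close> says that \<open>u\<close> is (the continuous
  representative of) an element of the domain and \<open>f\<close> equals \<open>A u\<close> almost everywhere.
  The \<open>v\<^sub>i\<close> are the continuous representatives of the derivatives of the \<open>H\<^sup>2\<close> functions \<open>u\<^sub>i\<close>.
\<close>

definition A_graph ::
  "real \<Rightarrow> real \<Rightarrow> (real \<Rightarrow> real) \<Rightarrow> (real \<Rightarrow> real) \<Rightarrow> (real \<Rightarrow> real) \<Rightarrow> (real \<Rightarrow> real) \<Rightarrow>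
   fpair \<Rightarrow> fpair \<Rightarrow> bool" where
  "A_graph a b k r \<kappa> \<rho> u f \<longleftrightarrow> in_L a b r \<rho> f \<and>
     (\<exists>v1 v2.
        has_weak_deriv a 0 (fst u) v1 \<and> in_H1 a 0 v1 \<and>
        has_weak_deriv 0 b (snd u) v2 \<and> in_H1 0 b v2 \<and>
        fst u a = 0 \<and> v1 0 = 0 \<and> snd u b = 0 \<and> fst u 0 = snd u 0 \<and>
        has_weak_deriv a 0 (\<lambda>x. of_real (k x) * v1 x) (\<lambda>x. - of_real (r x) * fst f x) \<and>
        has_weak_deriv 0 b (\<lambda>x. of_real (\<kappa> x) * v2 x) (\<lambda>x. - of_real (\<rho> x) * snd f x))"

definition A_eigenfunction ::
  "real \<Rightarrow> real \<Rightarrow> (real \<Rightarrow> real) \<Rightarrow> (real \<Rightarrow> real) \<Rightarrow> (real \<Rightarrow> real) \<Rightarrow> (real \<Rightarrow> real) \<Rightarrow>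
   complex \<Rightarrow> fpair \<Rightarrow> bool" where
  "A_eigenfunction a b k r \<kappa> \<rho> z u \<longleftrightarrow>
     A_graph a b k r \<kappa> \<rho> u (pair_scale z u) \<and> L_norm a b r \<rho> u \<noteq> 0"

text \<open>
  \<open>z\<close> is in the resolvent set iff \<open>A - z\<close> maps its domain onto the whole space and has a
  bounded inverse (the estimate contains injectivity).
\<close>

definition A_resolvent_set ::
  "real \<Rightarrow> real \<Rightarrow> (real \<Rightarrow> real) \<Rightarrow> (real \<Rightarrow> real) \<Rightarrow> (real \<Rightarrow> real) \<Rightarrow> (real \<Rightarrow> real) \<Rightarrow>
   complex set" where
  "A_resolvent_set a b k r \<kappa> \<rho> =
     {z. (\<forall>f. in_L a b r \<rho> f \<longrightarrow> (\<exists>u. A_graph a b k r \<kappa> \<rho> u (pair_scale z u + f))) \<and>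
         (\<exists>C. \<forall>u g. A_graph a b k r \<kappa> \<rho> u g \<longrightarrow>
            L_norm a b r \<rho> u \<le> C * L_norm a b r \<rho> (g - pair_scale z u))}"

definition A_spectrum ::
  "real \<Rightarrow> real \<Rightarrow> (real \<Rightarrow> real) \<Rightarrow> (real \<Rightarrow> real) \<Rightarrow> (real \<Rightarrow> real) \<Rightarrow> (real \<Rightarrow> real) \<Rightarrow>
   complex set" where
  "A_spectrum a b k r \<kappa> \<rho> = - A_resolvent_set a b k r \<kappa> \<rho>"

text \<open>
  The kernels of the powers of \<open>A - z\<close>.  Every class in such a kernel is represented by exactly
  one pair of functions, namely the continuous representatives extended by zero outside the
  closed intervals; hence linear dimension of the set of representatives is that of the kernel.
\<close>

fun A_kernel ::
  "real \<Rightarrow> real \<Rightarrow> (real \<Rightarrow> real) \<Rightarrow> (real \<Rightarrow> real) \<Rightarrow> (real \<Rightarrow> real) \<Rightarrow> (real \<Rightarrow> real) \<Rightarrow>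
   complex \<Rightarrow> nat \<Rightarrow> fpair set" where
  "A_kernel a b k r \<kappa> \<rho> z 0 = {0}"
| "A_kernel a b k r \<kappa> \<rho> z (Suc n) =
     {u. (\<forall>x. x \<notin> {a..0} \<longrightarrow> fst u x = 0) \<and> (\<forall>x. x \<notin> {0..b} \<longrightarrow> snd u x = 0) \<and>
         (\<exists>f\<in>A_kernel a b k r \<kappa> \<rho> z n. A_graph a b k r \<kappa> \<rho> u (pair_scale z u + f))}"

definition A_algebraic_multiplicity ::
  "real \<Rightarrow> real \<Rightarrow> (real \<Rightarrow> real) \<Rightarrow> (real \<Rightarrow> real) \<Rightarrow> (real \<Rightarrow> real) \<Rightarrow> (real \<Rightarrow> real) \<Rightarrow>
   complex \<Rightarrow> nat" where
  "A_algebraic_multiplicity a b k r \<kappa> \<rho> z = fpair.dim (\<Union>n. A_kernel a b k r \<kappa> \<rho> z n)"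

definition enumerates_A_spectrum ::
  "real \<Rightarrow> real \<Rightarrow> (real \<Rightarrow> real) \<Rightarrow> (real \<Rightarrow> real) \<Rightarrow> (real \<Rightarrow> real) \<Rightarrow> (real \<Rightarrow> real) \<Rightarrow>
   (nat \<Rightarrow> real) \<Rightarrow> bool" where
  "enumerates_A_spectrum a b k r \<kappa> \<rho> mu \<longleftrightarrow>
     mono mu \<and> range (\<lambda>j. complex_of_real (mu j)) = A_spectrum a b k r \<kappa> \<rho> \<and>
     (\<forall>j. finite {i. mu i = mu j} \<and>
        card {i. mu i = mu j} = A_algebraic_multiplicity a b k r \<kappa> \<rho> (of_real (mu j)))"

end

theory Submission
  imports Defs
begin

text \<open>
  Write \<open>\<lambda> = \<epsilon> m\<close>.  Then the two equations of the perturbed problem become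
  \<open>(k u')' + m r u = 0\<close> on the left and \<open>(\<kappa> u')' + m \<rho> u = 0\<close> on the right, and \<open>\<epsilon>\<close> survives
  only in the transmission condition for the fluxes.  Let \<open>\<phi>(x, m)\<close> solve the left equation
  with \<open>\<phi> = 0\<close>, \<open>k \<phi>' = 1\<close> at \<open>a\<close>, let \<open>\<psi>(x, m)\<close> solve the right one with \<open>\<psi> = 0\<close>,
  \<open>\<kappa> \<psi>' = 1\<close> at \<open>b\<close>, and let \<open>A, B\<close> and \<open>C, D\<close> be the values at 0 of \<open>\<phi>, k \<phi>'\<close> and of
  \<open>\<psi>, \<kappa> \<psi>'\<close>.  Every solution that vanishes at \<open>a\<close> and \<open>b\<close> is a multiple \<open>c \<phi>\<close> on the left and
  \<open>d \<psi>\<close> on the right, and the conditions at 0 are \<open>c A = d C\<close>, \<open>c B = \<epsilon> d D\<close>.  Hence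
  \<open>\<lambda>\<close> is an eigenvalue iff \<open>m\<close> is a root of the characteristic function
  \<open>B C - \<epsilon> A D\<close> (\<open>perturbed_eigenvalue_iff\<close>).

  For \<open>\<epsilon> = 0\<close> the characteristic function is \<open>B C\<close>, and its real roots are the real eigenvalues of
  the limit operator.  When only one factor vanishes at \<open>m\<close>, the algebraic multiplicity is 1; when both
  vanish there is still only one eigenfunction, supported on the right, but it carries a Jordan
  chain of length 2 whose second vector has \<open>\<phi>\<close> as its left part.  All this follows from Lagrange's
  identity, and so the algebraic multiplicity is the number of vanishing factors
  (\<open>algebraic_multiplicity\<close>).

  The same identity shows that, as \<open>m\<close> grows, the vectors \<open>(A, B)\<close> and \<open>(C, D)\<close> rotate strictly
  and in opposite directions.  So near a root of \<open>B C\<close> the quotients \<open>B / A\<close> and \<open>C / D\<close>, where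
  defined, decrease strictly.  At a simple root the equation \<open>B C = \<epsilon> A D\<close> says that a decreasing
  function which vanishes there equals \<open>\<epsilon>\<close> times an increasing one; at a double root it says that
  the product of two decreasing functions which vanish there equals \<open>\<epsilon>\<close>.  For small \<open>\<epsilon> > 0\<close> it has
  exactly one, respectively two, solutions nearby (\<open>local_count\<close>).
  Away from its roots, \<open>|B C|\<close> is bounded below on a bounded interval, and all roots are positive.  Thus,
  below any level that is not a root of \<open>B C\<close>, both problems have equally many eigenvalues once
  \<open>\<epsilon>\<close> is small (\<open>global_count\<close>), which is convergence of the ordered eigenvalues.

  As \<open>m\<close> converges, \<open>\<phi>\<close> and \<open>k \<phi>'\<close> converge uniformly by Gronwall's inequality, and so do \<open>\<psi>\<close>
  and \<open>\<kappa> \<psi>'\<close>.  It remains that the coefficients \<open>c\<close> and \<open>d\<close> converge.  Their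
  quotient is \<open>C / A\<close> or \<open>\<epsilon> D / B\<close>, one of which has a limit because \<open>(A, B) \<noteq> 0\<close>; the
  normalization and \<open>d > 0\<close> do the rest (\<open>coefficients_converge\<close>).
\<close>

section \<open>Linear differential equations on a compact interval\<close>

text \<open>
  A quadratic form of Gronwall's inequality: since \<open>2 \<delta> |w| \<le> |w|\<^sup>2 + \<delta>\<^sup>2\<close>, the function
  \<open>|w|\<^sup>2 + \<delta>\<^sup>2\<close> grows at most at the rate \<open>2 L + 1\<close>.  Squaring makes it differentiable also where
  \<open>w\<close> vanishes.
\<close>

lemma gronwall_left:
  fixes w w' :: "real \<Rightarrow> 'a::real_inner"
  assumes w: "\<And>t. t \<in> {c..d} \<Longrightarrow> (w has_vector_derivative w' t) (at t within {c..d})"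
    and bound: "\<And>t. t \<in> {c..d} \<Longrightarrow> norm (w' t) \<le> L * norm (w t) + \<delta>"
    and "w c = 0" "0 \<le> L" "0 \<le> \<delta>" and t: "t \<in> {c..d}"
  shows "norm (w t) \<le> \<delta> * exp ((2 * L + 1) * (d - c))"
proof -
  define E where "E = (\<lambda>s. exp (- ((2 * L + 1) * s)) * (w s \<bullet> w s + \<delta>\<^sup>2))"
  define E' where "E' = (\<lambda>s. exp (- ((2 * L + 1) * s)) *
    (2 * (w s \<bullet> w' s) - (2 * L + 1) * (w s \<bullet> w s + \<delta>\<^sup>2)))"
  have deriv: "(E has_real_derivative E' s) (at s within {c..d})" if "s \<in> {c..d}" for s
  proof -
    have "((\<lambda>s. w s \<bullet> w s) has_real_derivative 2 * (w s \<bullet> w' s)) (at s within {c..d})"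
      using has_derivative_inner[OF w[OF that, unfolded has_vector_derivative_def]
          w[OF that, unfolded has_vector_derivative_def]]
      unfolding has_field_derivative_def
      by (rule has_derivative_eq_rhs) (auto simp: fun_eq_iff inner_commute)
    then show ?thesis
      unfolding E_def E'_def
      by (auto intro!: derivative_eq_intros simp: algebra_simps)
  qed
  have neg: "E' s \<le> 0" if "s \<in> {c..d}" for s
  proof -
    have "w s \<bullet> w' s \<le> norm (w s) * norm (w' s)"
      by (rule norm_cauchy_schwarz)
    also have "\<dots> \<le> norm (w s) * (L * norm (w s) + \<delta>)"
      by (intro mult_left_mono bound that) auto
    finally have "2 * (w s \<bullet> w' s) \<le> 2 * L * (norm (w s))\<^sup>2 + 2 * \<delta> * norm (w s)"
      by (simp add: algebra_simps power2_eq_square)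
    moreover have "2 * \<delta> * norm (w s) \<le> (norm (w s))\<^sup>2 + \<delta>\<^sup>2"
      using sum_squares_bound[of \<delta> "norm (w s)"] by simp
    moreover have "0 \<le> L * \<delta>\<^sup>2"
      using \<open>0 \<le> L\<close> by simp
    ultimately have "2 * (w s \<bullet> w' s) - (2 * L + 1) * (w s \<bullet> w s + \<delta>\<^sup>2) \<le> 0"
      by (simp add: power2_norm_eq_inner algebra_simps)
    then show ?thesis
      unfolding E'_def by (simp add: mult_nonneg_nonpos)
  qed
  have "E t \<le> E c"
  proof -
    have "\<exists>x\<in>{c..t}. E t - E c = (\<lambda>h. E' x * h) (t - c)"
    proof (rule mvt_very_simple)
      show "(E has_derivative (\<lambda>h. E' x * h)) (at x within {c..t})" if "c \<le> x" "x \<le> t" for x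
        using has_field_derivative_subset[OF deriv[of x], of "{c..t}"] that t
        by (auto simp: has_field_derivative_def)
    qed (use t in auto)
    then obtain x where "x \<in> {c..t}" "E t - E c = (t - c) * E' x"
      by (auto simp: mult.commute)
    moreover have "(t - c) * E' x \<le> 0"
      using neg[of x] t \<open>x \<in> {c..t}\<close> by (intro mult_nonneg_nonpos) auto
    ultimately show ?thesis
      by simp
  qed
  then have "w t \<bullet> w t + \<delta>\<^sup>2 \<le> exp ((2 * L + 1) * (t - c)) * \<delta>\<^sup>2"
  proof -
    have "w t \<bullet> w t + \<delta>\<^sup>2 = exp ((2 * L + 1) * t) * E t"
      by (simp add: E_def exp_minus flip: mult.assoc)
    also have "\<dots> \<le> exp ((2 * L + 1) * t) * E c"
      using \<open>E t \<le> E c\<close> by simp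
    also have "\<dots> = exp ((2 * L + 1) * (t - c)) * \<delta>\<^sup>2"
      using \<open>w c = 0\<close> by (simp add: E_def right_diff_distrib flip: mult.assoc exp_add)
    finally show ?thesis .
  qed
  also have "\<dots> \<le> exp ((2 * L + 1) * (d - c)) * \<delta>\<^sup>2"
    using t \<open>0 \<le> L\<close> by (intro mult_right_mono) auto
  also have "\<dots> \<le> (exp ((2 * L + 1) * (d - c)))\<^sup>2 * \<delta>\<^sup>2"
    using t \<open>0 \<le> L\<close> by (intro mult_right_mono) (auto simp: power2_eq_square)
  finally have "w t \<bullet> w t + \<delta>\<^sup>2 \<le> (\<delta> * exp ((2 * L + 1) * (d - c)))\<^sup>2"
    by (simp add: power_mult_distrib mult.commute)
  then have "(norm (w t))\<^sup>2 \<le> (\<delta> * exp ((2 * L + 1) * (d - c)))\<^sup>2"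
    unfolding power2_norm_eq_inner using zero_le_power2[of \<delta>] by linarith
  then show ?thesis
    by (rule power2_le_imp_le) (use \<open>0 \<le> \<delta>\<close> in auto)
qed

text \<open>
  Reflecting the interval turns an initial value problem at the right end into one at the left end.
\<close>

lemma has_vector_derivative_reflect:
  fixes w :: "real \<Rightarrow> 'a::real_normed_vector"
  assumes "(w has_vector_derivative w') (at (- t) within {- d..- c})"
  shows "((\<lambda>s. w (- s)) has_vector_derivative - w') (at t within {c..d})"
proof -
  have "(uminus has_vector_derivative - 1) (at t within {c..d})"
    by (auto intro!: derivative_eq_intros simp: has_vector_derivative_def)
  moreover have "uminus ` {c..d} = {- d..- c}"
    by auto
  ultimately show ?thesis
    using vector_diff_chain_within[of uminus "- 1" t "{c..d}" w w'] assms
    by (simp add: o_def)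
qed

lemma gronwall:
  fixes w w' :: "real \<Rightarrow> 'a::real_inner"
  assumes w: "\<And>t. t \<in> {c..d} \<Longrightarrow> (w has_vector_derivative w' t) (at t within {c..d})"
    and bound: "\<And>t. t \<in> {c..d} \<Longrightarrow> norm (w' t) \<le> L * norm (w t) + \<delta>"
    and e: "e = c \<or> e = d" and "w e = 0" "0 \<le> L" "0 \<le> \<delta>" and t: "t \<in> {c..d}"
  shows "norm (w t) \<le> \<delta> * exp ((2 * L + 1) * (d - c))"
  using e
proof
  assume "e = c"
  then show ?thesis
    using gronwall_left[of c d w w' L \<delta> t] assms by blast
next
  assume "e = d"
  have "norm (w (- (- t))) \<le> \<delta> * exp ((2 * L + 1) * (- c - - d))"
  proof (rule gronwall_left[where w = "\<lambda>s. w (- s)" and w' = "\<lambda>s. - w' (- s)" and L = L])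
    show "((\<lambda>s. w (- s)) has_vector_derivative - w' (- s)) (at s within {- d..- c})"
      if "s \<in> {- d..- c}" for s
      by (rule has_vector_derivative_reflect) (use that w[of "- s"] in auto)
    show "norm (- w' (- s)) \<le> L * norm (w (- s)) + \<delta>" if "s \<in> {- d..- c}" for s
      using bound[of "- s"] that by auto
  qed (use assms \<open>e = d\<close> in auto)
  then show ?thesis
    by (simp add: algebra_simps)
qed

text \<open>
  The Lipschitz condition is global, so the Picard iteration converges on the whole interval:
  consecutive iterates differ by at most \<open>B (L (t - c))\<^sup>n / n!\<close>.
\<close>

lemma picard_lindeloef_left:
  fixes f :: "real \<Rightarrow> 'a::banach \<Rightarrow> 'a"
  assumes "c \<le> d" "0 \<le> L"
    and lip: "\<And>t x y. t \<in> {c..d} \<Longrightarrow> norm (f t x - f t y) \<le> L * norm (x - y)"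
    and cont: "\<And>w. continuous_on {c..d} w \<Longrightarrow> continuous_on {c..d} (\<lambda>t. f t (w t))"
  shows "\<exists>w. w c = w0 \<and> (\<forall>t\<in>{c..d}. (w has_vector_derivative f t (w t)) (at t within {c..d}))"
proof -
  define it where "it = rec_nat (\<lambda>t. w0) (\<lambda>n v t. w0 + integral {c..t} (\<lambda>s. f s (v s)))"
  have it0: "it 0 = (\<lambda>t. w0)"
    and itS: "it (Suc n) = (\<lambda>t. w0 + integral {c..t} (\<lambda>s. f s (it n s)))" for n
    by (simp_all add: it_def)
  have it_cont: "continuous_on {c..d} (it n)" for n
  proof (induction n)
    case (Suc n)
    show ?case
      unfolding itS
      by (intro continuous_intros indefinite_integral_continuous_1 integrable_continuous_interval
          cont Suc)
  qed (simp add: it0)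
  have f_int: "(\<lambda>s. f s (v s)) integrable_on {c..t}"
    if "continuous_on {c..d} v" "t \<in> {c..d}" for v t
    by (rule integrable_continuous_interval)
      (use that in \<open>auto intro: continuous_on_subset[OF cont]\<close>)
  have "bounded ((\<lambda>t. f t w0) ` {c..d})"
    by (intro compact_imp_bounded compact_continuous_image cont) auto
  then obtain B0 where "\<forall>x\<in>{c..d}. norm (f x w0) \<le> B0"
    by (auto simp: bounded_iff)
  then have B0: "\<And>t. t \<in> {c..d} \<Longrightarrow> norm (f t w0) \<le> B0"
    by blast
  define B where "B = max B0 0 * (d - c)"
  have step: "norm (it (Suc n) t - it n t) \<le> B * ((L * (t - c)) ^ n / fact n)"
    if "t \<in> {c..d}" for n t
    using that
  proof (induction n arbitrary: t)
    case 0
    have "norm (integral {c..t} (\<lambda>s. f s w0)) \<le> max B0 0 * (t - c)"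
    proof (rule integral_bound)
      show "continuous_on {c..t} (\<lambda>s. f s w0)"
        using 0 by (auto intro: continuous_on_subset[OF cont])
      show "norm (f s w0) \<le> max B0 0" if "s \<in> {c..t}" for s
        using B0[of s] that 0 by auto
    qed (use 0 in auto)
    also have "\<dots> \<le> B"
      unfolding B_def using 0 by (intro mult_left_mono) auto
    finally show ?case
      by (simp add: it0 itS)
  next
    case (Suc n)
    have "it (Suc (Suc n)) t - it (Suc n) t =
      integral {c..t} (\<lambda>s. f s (it (Suc n) s)) - integral {c..t} (\<lambda>s. f s (it n s))"
      unfolding itS[of "Suc n"] by (subst itS[of n]) simp
    also have "\<dots> = integral {c..t} (\<lambda>s. f s (it (Suc n) s) - f s (it n s))"
      by (intro integral_diff[symmetric] f_int it_cont Suc.prems)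
    also have "norm \<dots> \<le> integral {c..t} (\<lambda>s. L * (B * ((L * (s - c)) ^ n / fact n)))"
    proof (rule integral_norm_bound_integral)
      show "norm (f s (it (Suc n) s) - f s (it n s)) \<le> L * (B * ((L * (s - c)) ^ n / fact n))"
        if "s \<in> {c..t}" for s
      proof -
        have s: "s \<in> {c..d}"
          using that Suc.prems by auto
        show ?thesis
          using order_trans[OF lip[OF s] mult_left_mono[OF Suc.IH[OF s] \<open>0 \<le> L\<close>]] .
      qed
      show "(\<lambda>s. f s (it (Suc n) s) - f s (it n s)) integrable_on {c..t}"
        by (intro integrable_diff f_int it_cont Suc.prems)
    qed (intro integrable_continuous_interval continuous_intros; simp)
    also have "\<dots> = B * ((L * (t - c)) ^ Suc n / fact (Suc n))"
    proof (rule integral_unique)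
      have "((\<lambda>s. L * (B * ((L * (s - c)) ^ n / fact n))) has_integral
        B * ((L * (t - c)) ^ Suc n / fact (Suc n)) - B * ((L * (c - c)) ^ Suc n / fact (Suc n))) {c..t}"
      proof (rule fundamental_theorem_of_calculus)
        show "((\<lambda>s. B * ((L * (s - c)) ^ Suc n / fact (Suc n))) has_vector_derivative
          L * (B * ((L * (s - c)) ^ n / fact n))) (at s within {c..t})" for s
          unfolding has_real_derivative_iff_has_vector_derivative[symmetric]
          by (rule derivative_eq_intros refl | simp)+
      qed (use Suc.prems in auto)
      then show "((\<lambda>s. L * (B * ((L * (s - c)) ^ n / fact n))) has_integral
        B * ((L * (t - c)) ^ Suc n / fact (Suc n))) {c..t}"
        by simp
    qed
    finally show ?case .
  qed
  define w where "w = (\<lambda>t. w0 + (\<Sum>n. it (Suc n) t - it n t))"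
  have lim: "uniform_limit {c..d} it w sequentially"
  proof -
    have "uniform_limit {c..d} (\<lambda>n t. \<Sum>i<n. it (Suc i) t - it i t)
      (\<lambda>t. \<Sum>n. it (Suc n) t - it n t) sequentially"
    proof (rule Weierstrass_m_test)
      show "norm (it (Suc n) t - it n t) \<le> B * ((L * (d - c)) ^ n / fact n)" if "t \<in> {c..d}" for n t
      proof (rule order_trans[OF step[OF that]])
        show "B * ((L * (t - c)) ^ n / fact n) \<le> B * ((L * (d - c)) ^ n / fact n)"
          using that \<open>0 \<le> L\<close>
          by (intro mult_left_mono divide_right_mono power_mono) (auto simp: B_def)
      qed
      show "summable (\<lambda>n. B * ((L * (d - c)) ^ n / fact n))"
        using summable_exp[of "L * (d - c)"]
        by (intro summable_mult) (simp add: divide_inverse mult.commute)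
    qed
    moreover have "(\<Sum>i<n. it (Suc i) t - it i t) = it n t - w0" for n t
      using sum_lessThan_telescope[of "\<lambda>n. it n t" n] by (simp add: it0)
    ultimately have "uniform_limit {c..d} (\<lambda>n t. it n t - w0)
        (\<lambda>t. \<Sum>n. it (Suc n) t - it n t) sequentially"
      by simp
    from uniform_limit_add[OF uniform_limit_const[where c = "\<lambda>_. w0"] this]
    show ?thesis
      by (simp add: w_def)
  qed
  have w_cont: "continuous_on {c..d} w"
    by (rule uniform_limit_theorem[OF always_eventually lim]) (auto simp: it_cont)
  have w_eq: "w t = w0 + integral {c..t} (\<lambda>s. f s (w s))" if t: "t \<in> {c..d}" for t
  proof -
    have "uniform_limit {c..t} (\<lambda>n s. f s (it n s)) (\<lambda>s. f s (w s)) sequentially"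
    proof (rule uniform_limitI)
      fix \<eta> :: real assume "0 < \<eta>"
      then have "0 < \<eta> / (L + 1)"
        using \<open>0 \<le> L\<close> by simp
      from uniform_limitD[OF lim this]
      show "\<forall>\<^sub>F n in sequentially. \<forall>s\<in>{c..t}. dist (f s (it n s)) (f s (w s)) < \<eta>"
      proof (rule eventually_mono, intro ballI)
        fix n s assume n: "\<forall>x\<in>{c..d}. dist (it n x) (w x) < \<eta> / (L + 1)" and "s \<in> {c..t}"
        then have s: "s \<in> {c..d}"
          using t by auto
        have "norm (f s (it n s) - f s (w s)) \<le> L * norm (it n s - w s)"
          by (rule lip[OF s])
        also have "\<dots> \<le> L * (\<eta> / (L + 1))"
          using n s \<open>0 \<le> L\<close> by (intro mult_left_mono) (auto simp: dist_norm less_imp_le)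
        also have "\<dots> < \<eta>"
          using \<open>0 < \<eta>\<close> \<open>0 \<le> L\<close> by (simp add: field_simps)
        finally show "dist (f s (it n s)) (f s (w s)) < \<eta>"
          by (simp add: dist_norm)
      qed
    qed
    moreover have "continuous_on {c..t} (\<lambda>s. f s (it n s))" for n
      by (rule continuous_on_subset[OF cont[OF it_cont]]) (use t in auto)
    ultimately obtain I J where I: "\<And>n. ((\<lambda>s. f s (it n s)) has_integral I n) {c..t}"
      and J: "((\<lambda>s. f s (w s)) has_integral J) {c..t}" and "I \<longlonglongrightarrow> J"
      by (rule uniform_limit_integral[OF _ _ trivial_limit_sequentially]) blast
    have "(\<lambda>n. it (Suc n) t) \<longlonglongrightarrow> w0 + J"
      unfolding itS using integral_unique[OF I] \<open>I \<longlonglongrightarrow> J\<close> by (auto intro!: tendsto_intros)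
    moreover have "(\<lambda>n. it (Suc n) t) \<longlonglongrightarrow> w t"
      using tendsto_uniform_limitI[OF lim t] by (rule LIMSEQ_Suc)
    ultimately show ?thesis
      using LIMSEQ_unique integral_unique[OF J] by metis
  qed
  have "(w has_vector_derivative f t (w t)) (at t within {c..d})" if t: "t \<in> {c..d}" for t
  proof -
    have "((\<lambda>t. w0 + integral {c..t} (\<lambda>s. f s (w s))) has_vector_derivative 0 + f t (w t))
      (at t within {c..d})"
      by (intro has_vector_derivative_add has_vector_derivative_const
          integral_has_vector_derivative cont w_cont t)
    then have "((\<lambda>t. w0 + integral {c..t} (\<lambda>s. f s (w s))) has_vector_derivative f t (w t))
      (at t within {c..d})"
      by simp
    then show ?thesis
      by (rule has_vector_derivative_transform[rotated 2]) (use t w_eq in auto)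
  qed
  moreover have "w c = w0"
    using w_eq[of c] \<open>c \<le> d\<close> by simp
  ultimately show ?thesis
    by blast
qed

lemma picard_lindeloef:
  fixes f :: "real \<Rightarrow> 'a::banach \<Rightarrow> 'a"
  assumes "c \<le> d" "0 \<le> L"
    and lip: "\<And>t x y. t \<in> {c..d} \<Longrightarrow> norm (f t x - f t y) \<le> L * norm (x - y)"
    and cont: "\<And>w. continuous_on {c..d} w \<Longrightarrow> continuous_on {c..d} (\<lambda>t. f t (w t))"
    and e: "e = c \<or> e = d"
  shows "\<exists>w. w e = w0 \<and> (\<forall>t\<in>{c..d}. (w has_vector_derivative f t (w t)) (at t within {c..d}))"
  using e
proof
  assume "e = c"
  then show ?thesis
    using picard_lindeloef_left[of c d L f w0] assms by blast
next
  assume "e = d"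
  have "\<exists>w. w (- d) = w0 \<and> (\<forall>t\<in>{- d..- c}.
    (w has_vector_derivative - f (- t) (w t)) (at t within {- d..- c}))"
  proof (rule picard_lindeloef_left)
    show "norm (- f (- t) x - - f (- t) y) \<le> L * norm (x - y)" if "t \<in> {- d..- c}" for t x y
      using lip[of "- t" y x] that by (auto simp: norm_minus_commute)
    show "continuous_on {- d..- c} (\<lambda>t. - f (- t) (w t))" if "continuous_on {- d..- c} w" for w
    proof -
      have "continuous_on {c..d} (\<lambda>t. w (- t))"
        by (rule continuous_on_compose2[OF that]) (auto intro!: continuous_intros)
      from cont[OF this] have "continuous_on {- d..- c} (\<lambda>t. f (- t) (w (- (- t))))"
        by (rule continuous_on_compose2) (auto intro!: continuous_intros)
      then show ?thesis
        by (auto intro!: continuous_intros)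
    qed
  qed (use assms in auto)
  then obtain w where "w (- d) = w0" and w: "\<And>t. t \<in> {- d..- c} \<Longrightarrow>
      (w has_vector_derivative - f (- t) (w t)) (at t within {- d..- c})"
    by auto
  moreover have "((\<lambda>t. w (- t)) has_vector_derivative f t (w (- t))) (at t within {c..d})"
    if "t \<in> {c..d}" for t
    using has_vector_derivative_reflect[OF w[of "- t"]] that by simp
  ultimately show ?thesis
    using \<open>e = d\<close> by (intro exI[of _ "\<lambda>t. w (- t)"]) auto
qed

section \<open>One string with one end fixed\<close>

lemma uniform_limit_scaled:
  fixes f :: "'a \<Rightarrow> 'b \<Rightarrow> real"
  assumes "uniform_limit S f f0 F" "(c \<longlongrightarrow> c0) F" "bounded (f0 ` S)"
  shows "uniform_limit S (\<lambda>t x. c t * f t x) (\<lambda>x. c0 * f0 x) F"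
proof (rule uniform_lim_mult)
  show "uniform_limit S (\<lambda>t x. c t) (\<lambda>x. c0) F"
    using tendstoD[OF assms(2)] unfolding uniform_limit_iff by (auto elim!: eventually_mono)
  show "bounded ((\<lambda>x. c0) ` S)"
    by (rule bounded_subset[of "{c0}"]) auto
qed (use assms in auto)

text \<open>
  The inhomogeneous equation \<open>(k y')' + r (m y + g) = 0\<close> as a first-order system for \<open>y\<close> and the flux
  \<open>p = k y'\<close>.  In this form the coefficient \<open>k\<close> is never differentiated, and the quantities that
  occur in the transmission conditions are the unknowns.
\<close>

definition string_solution ::
  "real \<Rightarrow> real \<Rightarrow> (real \<Rightarrow> real) \<Rightarrow> (real \<Rightarrow> real) \<Rightarrow> real \<Rightarrow> (real \<Rightarrow> 'a::real_normed_vector) \<Rightarrow>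
    (real \<Rightarrow> 'a) \<Rightarrow> (real \<Rightarrow> 'a) \<Rightarrow> bool" where
  "string_solution c d k r m g y p \<longleftrightarrow> (\<forall>x\<in>{c..d}.
     (y has_vector_derivative inverse (k x) *\<^sub>R p x) (at x within {c..d}) \<and>
     (p has_vector_derivative - (r x *\<^sub>R (m *\<^sub>R y x + g x))) (at x within {c..d}))"

lemma smooth_on_interval_C1:
  assumes "smooth_on_interval c d f"
  obtains f' where "continuous_on {c..d} f'"
    "\<And>x. x \<in> {c..d} \<Longrightarrow> (f has_real_derivative f' x) (at x within {c..d})"
proof -
  obtain F where F0: "\<And>x. x \<in> {c..d} \<Longrightarrow> F 0 x = f x"
    and F: "\<And>n x. x \<in> {c..d} \<Longrightarrow> (F n has_real_derivative F (Suc n) x) (at x within {c..d})"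
    using assms unfolding smooth_on_interval_def by blast
  show ?thesis
  proof
    show "continuous_on {c..d} (F 1)"
      by (rule DERIV_continuous_on, rule F)
    show "(f has_real_derivative F 1 x) (at x within {c..d})" if "x \<in> {c..d}" for x
    proof (rule has_field_derivative_transform_within[where f = "F 0" and d = 1])
      show "(F 0 has_real_derivative F 1 x) (at x within {c..d})"
        using F[OF that, of 0] by simp
    qed (use that F0 in auto)
  qed
qed

text \<open>
  A string on \<open>[c, d]\<close> that is fixed at the end point \<open>e\<close>.  Both halves of the problem are of this
  kind, with \<open>e\<close> the left end for one and the right end for the other.
\<close>

locale string =
  fixes c d :: real and k r :: "real \<Rightarrow> real" and e :: real
  assumes c_less_d: "c < d"
    and k_smooth: "smooth_on_interval c d k" and k_pos: "\<And>x. x \<in> {c..d} \<Longrightarrow> 0 < k x"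
    and r_smooth: "smooth_on_interval c d r" and r_pos: "\<And>x. x \<in> {c..d} \<Longrightarrow> 0 < r x"
    and e_end: "e = c \<or> e = d"
begin

abbreviation "sol m g y p \<equiv> string_solution c d k r m g y p"

lemma e_mem: "e \<in> {c..d}"
  using e_end c_less_d by auto

lemma k_cont: "continuous_on {c..d} k"
  by (rule smooth_on_interval_C1[OF k_smooth]) (rule DERIV_continuous_on)

lemma r_cont: "continuous_on {c..d} r"
  by (rule smooth_on_interval_C1[OF r_smooth]) (rule DERIV_continuous_on)

lemma inverse_k_cont: "continuous_on {c..d} (\<lambda>x. inverse (k x))"
  using k_pos by (intro continuous_on_inverse k_cont) (auto simp: less_le)

lemma coefficient_bounds:
  obtains K R where "0 < K" "0 < R"
    "\<And>x. x \<in> {c..d} \<Longrightarrow> \<bar>inverse (k x)\<bar> \<le> K" "\<And>x. x \<in> {c..d} \<Longrightarrow> \<bar>r x\<bar> \<le> R"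
proof -
  have "bounded ((\<lambda>x. inverse (k x)) ` {c..d})" "bounded (r ` {c..d})"
    by (intro compact_imp_bounded compact_continuous_image inverse_k_cont r_cont compact_Icc)+
  then obtain K R where "0 < K" "\<forall>y\<in>(\<lambda>x. inverse (k x)) ` {c..d}. norm y \<le> K"
    "0 < R" "\<forall>y\<in>r ` {c..d}. norm y \<le> R"
    unfolding bounded_pos by blast
  then show ?thesis
    using that[of K R] by simp
qed

lemma solution_cont:
  assumes "sol m g y p"
  shows "continuous_on {c..d} y" "continuous_on {c..d} p"
  using assms unfolding string_solution_def
  by (auto intro!: continuous_on_vector_derivative)

lemma solution_cong:
  assumes "sol m g y p" and "\<And>x. x \<in> {c..d} \<Longrightarrow> y x = y1 x" "\<And>x. x \<in> {c..d} \<Longrightarrow> p x = p1 x"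
    "\<And>x. x \<in> {c..d} \<Longrightarrow> g x = g1 x"
  shows "sol m g1 y1 p1"
  unfolding string_solution_def
proof (intro ballI conjI)
  fix x assume x: "x \<in> {c..d}"
  show "(y1 has_vector_derivative inverse (k x) *\<^sub>R p1 x) (at x within {c..d})"
    by (rule has_vector_derivative_transform[of x _ y1 y])
      (use assms x in \<open>auto simp: string_solution_def\<close>)
  have "(p has_vector_derivative - (r x *\<^sub>R (m *\<^sub>R y x + g x))) (at x within {c..d})"
    using assms(1) x by (auto simp: string_solution_def)
  then show "(p1 has_vector_derivative - (r x *\<^sub>R (m *\<^sub>R y1 x + g1 x))) (at x within {c..d})"
    using has_vector_derivative_transform[of x "{c..d}" p1 p] assms x by auto
qed

lemma solution_diff:
  assumes "sol m g y p" "sol m g1 y1 p1"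
  shows "sol m (\<lambda>x. g x - g1 x) (\<lambda>x. y x - y1 x) (\<lambda>x. p x - p1 x)"
  using assms unfolding string_solution_def
  by (auto intro!: derivative_eq_intros simp: algebra_simps)

lemma solution_map:
  assumes "sol m g y p" and h: "bounded_linear h"
  shows "sol m (\<lambda>x. h (g x)) (\<lambda>x. h (y x)) (\<lambda>x. h (p x))"
proof -
  interpret bounded_linear h by (rule h)
  show ?thesis
    unfolding string_solution_def
  proof (intro ballI conjI)
    fix x assume "x \<in> {c..d}"
    then have y: "(y has_vector_derivative inverse (k x) *\<^sub>R p x) (at x within {c..d})"
      and p: "(p has_vector_derivative - (r x *\<^sub>R (m *\<^sub>R y x + g x))) (at x within {c..d})"
      using assms(1) by (auto simp: string_solution_def)
    show "((\<lambda>x. h (y x)) has_vector_derivative inverse (k x) *\<^sub>R h (p x)) (at x within {c..d})"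
      using has_vector_derivative[OF y] by (simp add: scaleR)
    show "((\<lambda>x. h (p x)) has_vector_derivative - (r x *\<^sub>R (m *\<^sub>R h (y x) + h (g x))))
        (at x within {c..d})"
      using has_vector_derivative[OF p] by (simp add: scaleR add neg)
  qed
qed

lemma classical_imp_sol:
  fixes y v w g :: "real \<Rightarrow> complex"
  assumes y: "\<And>x. x \<in> {c..d} \<Longrightarrow> (y has_vector_derivative v x) (at x within {c..d})"
    and kv: "\<And>x. x \<in> {c..d} \<Longrightarrow> ((\<lambda>x. of_real (k x) * v x) has_vector_derivative w x) (at x within {c..d})"
    and eq: "\<And>x. x \<in> {c..d} \<Longrightarrow> w x = - of_real (r x) * (of_real m * y x + g x)"
  shows "sol m g y (\<lambda>x. of_real (k x) * v x)"
  unfolding string_solution_def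
proof (intro ballI conjI)
  fix x assume x: "x \<in> {c..d}"
  have "inverse (k x) *\<^sub>R (of_real (k x) * v x) = v x"
    using k_pos[OF x] by (simp add: scaleR_conv_of_real field_simps)
  then show "(y has_vector_derivative inverse (k x) *\<^sub>R (of_real (k x) * v x)) (at x within {c..d})"
    using y[OF x] by simp
  show "((\<lambda>x. of_real (k x) * v x) has_vector_derivative - (r x *\<^sub>R (m *\<^sub>R y x + g x))) (at x within {c..d})"
    using kv[OF x] eq[OF x] by (simp add: scaleR_conv_of_real)
qed

lemma sol_imp_classical:
  fixes y p g :: "real \<Rightarrow> complex"
  assumes sol: "sol m g y p" and x: "x \<in> {c..d}"
  defines "v \<equiv> \<lambda>x. inverse (k x) *\<^sub>R p x"
  shows "(y has_vector_derivative v x) (at x within {c..d})"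
    "((\<lambda>x. of_real (k x) * v x) has_vector_derivative - of_real (r x) * (of_real m * y x + g x)) (at x within {c..d})"
    "of_real (k x) * v x = p x"
proof -
  have kv: "of_real (k x) * v x = p x" if "x \<in> {c..d}" for x
    using k_pos[OF that] by (simp add: v_def scaleR_conv_of_real)
  show "(y has_vector_derivative v x) (at x within {c..d})" "of_real (k x) * v x = p x"
    using sol x kv[OF x] by (simp_all add: string_solution_def v_def)
  show "((\<lambda>x. of_real (k x) * v x) has_vector_derivative - of_real (r x) * (of_real m * y x + g x)) (at x within {c..d})"
    by (rule has_vector_derivative_transform[OF x kv])
      (use sol x in \<open>simp_all add: string_solution_def scaleR_conv_of_real\<close>)
qed

lemma solution_exists:
  fixes g :: "real \<Rightarrow> 'a::banach"
  assumes g: "continuous_on {c..d} g"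
  obtains y p where "sol m g y p" "y e = y0" "p e = p0"
proof -
  obtain K R where K: "0 < K" "\<And>x. x \<in> {c..d} \<Longrightarrow> \<bar>inverse (k x)\<bar> \<le> K"
    and R: "0 < R" "\<And>x. x \<in> {c..d} \<Longrightarrow> \<bar>r x\<bar> \<le> R"
    by (rule coefficient_bounds) blast
  define f :: "real \<Rightarrow> 'a \<times> 'a \<Rightarrow> 'a \<times> 'a" where
    "f t w = (inverse (k t) *\<^sub>R snd w, - (r t *\<^sub>R (m *\<^sub>R fst w + g t)))" for t w
  have "\<exists>w. w e = (y0, p0) \<and>
    (\<forall>t\<in>{c..d}. (w has_vector_derivative f t (w t)) (at t within {c..d}))"
  proof (rule picard_lindeloef[where L = "K + R * \<bar>m\<bar>"])
    fix t and v w :: "'a \<times> 'a" assume t: "t \<in> {c..d}"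
    have "f t v - f t w = (inverse (k t) *\<^sub>R snd (v - w), - (r t *\<^sub>R m *\<^sub>R fst (v - w)))"
      by (simp add: f_def algebra_simps)
    also have "norm \<dots> \<le> \<bar>inverse (k t)\<bar> * norm (snd (v - w)) + \<bar>r t\<bar> * (\<bar>m\<bar> * norm (fst (v - w)))"
      by (rule order_trans[OF norm_Pair_le]) (simp add: abs_mult mult.assoc)
    also have "\<dots> \<le> K * norm (v - w) + R * (\<bar>m\<bar> * norm (v - w))"
      using K R t norm_fst_le[of "fst (v - w)" "snd (v - w)"] norm_snd_le[of "snd (v - w)" "fst (v - w)"]
      by (intro add_mono mult_mono) (auto simp del: fst_diff snd_diff)
    finally show "norm (f t v - f t w) \<le> (K + R * \<bar>m\<bar>) * norm (v - w)"
      by (simp add: algebra_simps)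
  next
    show "continuous_on {c..d} (\<lambda>t. f t (w t))" if "continuous_on {c..d} w" for w :: "real \<Rightarrow> 'a \<times> 'a"
      unfolding f_def by (intro continuous_intros that g r_cont inverse_k_cont)
  qed (use K R c_less_d e_end in auto)
  then obtain w where "w e = (y0, p0)"
    and w: "\<And>t. t \<in> {c..d} \<Longrightarrow> (w has_vector_derivative f t (w t)) (at t within {c..d})"
    by blast
  moreover have "sol m g (\<lambda>t. fst (w t)) (\<lambda>t. snd (w t))"
    unfolding string_solution_def
    using bounded_linear.has_vector_derivative[OF bounded_linear_fst w]
      bounded_linear.has_vector_derivative[OF bounded_linear_snd w]
    by (auto simp: f_def)
  ultimately show ?thesis
    using that by force
qed

text \<open>
  Two uses: \<open>\<delta> = 0\<close> gives uniqueness, and the uniformity in \<open>m\<close> gives continuous dependence of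
  solutions on the parameter.
\<close>

lemma solution_bound:
  assumes "0 \<le> M"
  obtains C where "0 < C"
    "\<And>m g \<delta> x (y :: real \<Rightarrow> 'a::real_inner) p. \<bar>m\<bar> \<le> M \<Longrightarrow> sol m g y p \<Longrightarrow> y e = 0 \<Longrightarrow> p e = 0 \<Longrightarrow>
       (\<And>x. x \<in> {c..d} \<Longrightarrow> norm (g x) \<le> \<delta>) \<Longrightarrow> x \<in> {c..d} \<Longrightarrow>
       norm (y x) \<le> C * \<delta> \<and> norm (p x) \<le> C * \<delta>"
proof -
  obtain K R where K: "0 < K" "\<And>x. x \<in> {c..d} \<Longrightarrow> \<bar>inverse (k x)\<bar> \<le> K"
    and R: "0 < R" "\<And>x. x \<in> {c..d} \<Longrightarrow> \<bar>r x\<bar> \<le> R"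
    by (rule coefficient_bounds) blast
  define L where "L = K + R * M"
  show ?thesis
  proof
    show "0 < R * exp ((2 * L + 1) * (d - c))"
      using R by simp
    fix m g \<delta> x and y p :: "real \<Rightarrow> 'a"
    assume m: "\<bar>m\<bar> \<le> M" and sol: "sol m g y p" and "y e = 0" "p e = 0"
      and g: "\<And>x. x \<in> {c..d} \<Longrightarrow> norm (g x) \<le> \<delta>" and x: "x \<in> {c..d}"
    have "0 \<le> \<delta>"
      using g[OF x] norm_ge_zero order_trans by blast
    have "norm (y x, p x) \<le> (R * \<delta>) * exp ((2 * L + 1) * (d - c))"
    proof (rule gronwall[where w = "\<lambda>t. (y t, p t)" and L = L])
      fix t assume t: "t \<in> {c..d}"
      show "((\<lambda>t. (y t, p t)) has_vector_derivative
        (inverse (k t) *\<^sub>R p t, - (r t *\<^sub>R (m *\<^sub>R y t + g t)))) (at t within {c..d})"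
        using sol t unfolding string_solution_def by (auto intro!: has_vector_derivative_Pair)
      have "norm (inverse (k t) *\<^sub>R p t, - (r t *\<^sub>R (m *\<^sub>R y t + g t))) \<le>
        \<bar>inverse (k t)\<bar> * norm (p t) + \<bar>r t\<bar> * norm (m *\<^sub>R y t + g t)"
        by (rule order_trans[OF norm_Pair_le]) simp
      also have "\<dots> \<le> K * norm (y t, p t) + R * (M * norm (y t, p t) + \<delta>)"
      proof (intro add_mono mult_mono)
        have "norm (m *\<^sub>R y t + g t) \<le> \<bar>m\<bar> * norm (y t) + norm (g t)"
          by (rule order_trans[OF norm_triangle_ineq]) simp
        also have "\<dots> \<le> M * norm (y t, p t) + \<delta>"
          using m g[OF t] norm_fst_le[of "y t" "p t"] \<open>0 \<le> M\<close> by (intro add_mono mult_mono) auto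
        finally show "norm (m *\<^sub>R y t + g t) \<le> M * norm (y t, p t) + \<delta>" .
      qed (use K R t norm_snd_le[of "p t" "y t"] in auto)
      finally show "norm (inverse (k t) *\<^sub>R p t, - (r t *\<^sub>R (m *\<^sub>R y t + g t))) \<le>
          L * norm (y t, p t) + R * \<delta>"
        by (simp add: L_def algebra_simps)
    qed (use e_end x \<open>y e = 0\<close> \<open>p e = 0\<close> \<open>0 \<le> \<delta>\<close> \<open>0 \<le> M\<close> K R in \<open>auto simp: L_def zero_prod_def\<close>)
    then show "norm (y x) \<le> R * exp ((2 * L + 1) * (d - c)) * \<delta> \<and>
        norm (p x) \<le> R * exp ((2 * L + 1) * (d - c)) * \<delta>"
      using norm_fst_le[of "y x" "p x"] norm_snd_le[of "p x" "y x"] by (simp add: mult.assoc mult.left_commute mult.commute)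
  qed
qed

lemma solution_unique:
  fixes y :: "real \<Rightarrow> 'a::real_inner"
  assumes "sol m g y p" "sol m g y1 p1" "y e = y1 e" "p e = p1 e" "x \<in> {c..d}"
  shows "y x = y1 x" "p x = p1 x"
proof -
  obtain C where "\<And>m' g \<delta> x (y :: real \<Rightarrow> 'a) p. \<bar>m'\<bar> \<le> \<bar>m\<bar> \<Longrightarrow> sol m' g y p \<Longrightarrow> y e = 0 \<Longrightarrow> p e = 0 \<Longrightarrow>
       (\<And>x. x \<in> {c..d} \<Longrightarrow> norm (g x) \<le> \<delta>) \<Longrightarrow> x \<in> {c..d} \<Longrightarrow>
       norm (y x) \<le> C * \<delta> \<and> norm (p x) \<le> C * \<delta>"
    by (rule solution_bound[of "\<bar>m\<bar>"]) auto
  from this[OF order_refl solution_diff[OF assms(1,2)], of 0 x]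
  show "y x = y1 x" "p x = p1 x"
    using assms(3-) by auto
qed

text \<open>
  The Wronskian \<open>q y - f p\<close> of a homogeneous and an inhomogeneous solution has derivative \<open>r f g\<close>.
\<close>

lemma lagrange_identity:
  fixes y p g :: "real \<Rightarrow> 'a::banach"
  assumes f: "sol m (\<lambda>_. 0) f q" and y: "sol m g y p"
  shows "((\<lambda>x. (r x * f x) *\<^sub>R g x) has_integral
    (q d *\<^sub>R y d - f d *\<^sub>R p d) - (q c *\<^sub>R y c - f c *\<^sub>R p c)) {c..d}"
proof (rule fundamental_theorem_of_calculus)
  fix x assume "x \<in> {c..d}"
  then have f': "(f has_real_derivative inverse (k x) * q x) (at x within {c..d})"
    and q': "(q has_real_derivative - (r x * (m * f x))) (at x within {c..d})"
    and y': "(y has_vector_derivative inverse (k x) *\<^sub>R p x) (at x within {c..d})"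
    and p': "(p has_vector_derivative - (r x *\<^sub>R (m *\<^sub>R y x + g x))) (at x within {c..d})"
    using f y by (auto simp: string_solution_def has_real_derivative_iff_has_vector_derivative)
  from has_vector_derivative_diff[OF has_vector_derivative_scaleR[OF q' y']
      has_vector_derivative_scaleR[OF f' p']]
  show "((\<lambda>x. q x *\<^sub>R y x - f x *\<^sub>R p x) has_vector_derivative (r x * f x) *\<^sub>R g x)
      (at x within {c..d})"
    by (rule has_vector_derivative_eq_rhs) (simp add: algebra_simps)
qed (use c_less_d in auto)

definition fundamental :: "real \<Rightarrow> (real \<Rightarrow> real) \<times> (real \<Rightarrow> real)" where
  "fundamental m = (SOME (y, p). sol m (\<lambda>_. 0) y p \<and> y e = 0 \<and> p e = 1)"

definition phi :: "real \<Rightarrow> real \<Rightarrow> real" where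
  "phi m = fst (fundamental m)"

definition flux :: "real \<Rightarrow> real \<Rightarrow> real" where
  "flux m = snd (fundamental m)"

lemma phi_solution: "sol m (\<lambda>_. 0) (phi m) (flux m)"
  and phi_e: "phi m e = 0" and flux_e: "flux m e = 1"
proof -
  obtain y p :: "real \<Rightarrow> real" where "sol m (\<lambda>_. 0) y p" "y e = 0" "p e = 1"
    by (rule solution_exists[of "\<lambda>_. 0 :: real" m 0 1]) auto
  then have "case fundamental m of (y, p) \<Rightarrow> sol m (\<lambda>_. 0) y p \<and> y e = 0 \<and> p e = 1"
    unfolding fundamental_def 
    by (intro someI[where x = "(y, p)" and P = "\<lambda>(y, p). sol m (\<lambda>_. 0) y p \<and> y e = 0 \<and> p e = 1"])
      simp
  then show "sol m (\<lambda>_. 0) (phi m) (flux m)" "phi m e = 0" "flux m e = 1"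
    by (auto simp: phi_def flux_def split: prod.splits)
qed

lemma phi_cont: "continuous_on {c..d} (phi m)" and flux_cont: "continuous_on {c..d} (flux m)"
  using solution_cont[OF phi_solution] by auto

lemma multiple_of_phi:
  fixes v :: "'a::real_inner"
  shows "sol m (\<lambda>_. 0) (\<lambda>x. phi m x *\<^sub>R v) (\<lambda>x. flux m x *\<^sub>R v)"
  using solution_map[OF phi_solution bounded_linear_scaleR_left[of v]] by simp

lemma solution_eq_multiple_of_phi:
  fixes y :: "real \<Rightarrow> 'a::real_inner"
  assumes "sol m (\<lambda>_. 0) y p" "y e = 0" "x \<in> {c..d}"
  shows "y x = phi m x *\<^sub>R p e" "p x = flux m x *\<^sub>R p e"
  by (rule solution_unique[OF assms(1) multiple_of_phi _ _ assms(3)];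
      simp add: phi_e flux_e assms(2))+

lemma phi_ne_0: "\<exists>x\<in>{c..d}. phi m x \<noteq> 0"
proof (rule ccontr)
  assume "\<not> (\<exists>x\<in>{c..d}. phi m x \<noteq> 0)"
  then have "(phi m has_vector_derivative 0) (at e within {c..d})"
    using has_vector_derivative_transform[OF e_mem, of "phi m" "\<lambda>_. 0" 0] by auto
  moreover have "(phi m has_vector_derivative inverse (k e) *\<^sub>R 1) (at e within {c..d})"
    using phi_solution[of m] e_mem flux_e[of m] unfolding string_solution_def by fastforce
  ultimately have "inverse (k e) = 0"
    using vector_derivative_unique_within_closed_interval[of c d e "phi m" 0 "inverse (k e) *\<^sub>R 1"]
      e_mem c_less_d by (simp add: box_real)
  then show False
    using k_pos[OF e_mem] by simp
qed

text \<open>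
  The difference of two fundamental solutions solves the equation for \<open>n\<close> with the small
  inhomogeneity \<open>(n - m) \<phi>(m)\<close>.
\<close>

lemma phi_uniform: "uniform_limit {c..d} phi (phi m) (nhds m)"
  and flux_uniform: "uniform_limit {c..d} flux (flux m) (nhds m)"
proof -
  obtain C where C: "0 < C" and bound: "\<And>m' g \<delta> x (y :: real \<Rightarrow> real) p. \<bar>m'\<bar> \<le> \<bar>m\<bar> + 1 \<Longrightarrow>
      sol m' g y p \<Longrightarrow> y e = 0 \<Longrightarrow> p e = 0 \<Longrightarrow> (\<And>x. x \<in> {c..d} \<Longrightarrow> norm (g x) \<le> \<delta>) \<Longrightarrow>
      x \<in> {c..d} \<Longrightarrow> norm (y x) \<le> C * \<delta> \<and> norm (p x) \<le> C * \<delta>"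
    by (rule solution_bound[of "\<bar>m\<bar> + 1", where 'a = real]) (simp, blast)
  have "bounded (phi m ` {c..d})"
    by (intro compact_imp_bounded compact_continuous_image phi_cont compact_Icc)
  then obtain B where "0 < B" and B: "\<And>x. x \<in> {c..d} \<Longrightarrow> \<bar>phi m x\<bar> \<le> B"
    unfolding bounded_pos by (auto simp: real_norm_def)
  have close: "\<bar>phi n x - phi m x\<bar> \<le> C * (\<bar>n - m\<bar> * B) \<and> \<bar>flux n x - flux m x\<bar> \<le> C * (\<bar>n - m\<bar> * B)"
    if "\<bar>n - m\<bar> \<le> 1" "x \<in> {c..d}" for n x
  proof -
    have "sol n (\<lambda>x. (m - n) * phi m x) (phi m) (flux m)"
      using phi_solution[of m] unfolding string_solution_def
      by (auto simp: algebra_simps)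
    from solution_diff[OF phi_solution[of n] this]
    have "sol n (\<lambda>x. 0 - (m - n) * phi m x) (\<lambda>x. phi n x - phi m x) (\<lambda>x. flux n x - flux m x)" .
    moreover have "norm (0 - (m - n) * phi m x) \<le> \<bar>n - m\<bar> * B" if "x \<in> {c..d}" for x
      using mult_left_mono[OF B[OF that], of "\<bar>n - m\<bar>"] by (simp add: abs_mult abs_minus_commute)
    moreover have "\<bar>n\<bar> \<le> \<bar>m\<bar> + 1"
      using that(1) by linarith
    ultimately have "norm (phi n x - phi m x) \<le> C * (\<bar>n - m\<bar> * B) \<and>
        norm (flux n x - flux m x) \<le> C * (\<bar>n - m\<bar> * B)"
      using that(2) by (intro bound) (auto simp: phi_e flux_e)
    then show ?thesis
      by (simp only: real_norm_def)
  qed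
  have near: "\<forall>\<^sub>F n in nhds m. \<forall>x\<in>{c..d}. dist (phi n x) (phi m x) < \<eta> \<and> dist (flux n x) (flux m x) < \<eta>"
    if "0 < \<eta>" for \<eta>
  proof -
    define \<delta> where "\<delta> = min 1 (\<eta> / (C * B))"
    have "0 < \<delta>"
      using that C \<open>0 < B\<close> by (simp add: \<delta>_def)
    have small: "C * (\<bar>n - m\<bar> * B) < \<eta>" if "\<bar>n - m\<bar> < \<delta>" for n
    proof -
      have "\<bar>n - m\<bar> < \<eta> / (C * B)"
        using that by (simp add: \<delta>_def)
      then show ?thesis
        using C \<open>0 < B\<close> by (simp add: field_simps)
    qed
    show ?thesis
      unfolding eventually_nhds_metric dist_real_def
    proof (intro exI[of _ \<delta>] conjI allI impI ballI \<open>0 < \<delta>\<close>)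
      fix n x assume n: "\<bar>n - m\<bar> < \<delta>" and x: "x \<in> {c..d}"
      then show "\<bar>phi n x - phi m x\<bar> < \<eta>" "\<bar>flux n x - flux m x\<bar> < \<eta>"
        using close[of n x] small[OF n] by (auto simp: \<delta>_def)
    qed
  qed
  show "uniform_limit {c..d} phi (phi m) (nhds m)"
    unfolding uniform_limit_iff
  proof (intro allI impI)
    fix \<eta> :: real assume "0 < \<eta>"
    from near[OF this] show "\<forall>\<^sub>F n in nhds m. \<forall>x\<in>{c..d}. dist (phi n x) (phi m x) < \<eta>"
      by (rule eventually_mono) simp
  qed
  show "uniform_limit {c..d} flux (flux m) (nhds m)"
    unfolding uniform_limit_iff
  proof (intro allI impI)
    fix \<eta> :: real assume "0 < \<eta>"
    from near[OF this] show "\<forall>\<^sub>F n in nhds m. \<forall>x\<in>{c..d}. dist (flux n x) (flux m x) < \<eta>"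
      by (rule eventually_mono) simp
  qed
qed

lemma phi_continuous_parameter:
  assumes "x \<in> {c..d}"
  shows "isCont (\<lambda>m. phi m x) m" "isCont (\<lambda>m. flux m x) m"
  unfolding isCont_def
  by (rule tendsto_mono[OF at_within_le_nhds tendsto_uniform_limitI[OF phi_uniform assms]],
      rule tendsto_mono[OF at_within_le_nhds tendsto_uniform_limitI[OF flux_uniform assms]])

text \<open>
  A solution for the parameter \<open>n\<close> solves the equation for \<open>m\<close> with inhomogeneity \<open>(n - m) \<phi>(n)\<close>.
\<close>

lemma lagrange_identity_parameters:
  "((\<lambda>x. r x * phi m x * phi n x) has_integral
    ((flux m d * phi n d - phi m d * flux n d) - (flux m c * phi n c - phi m c * flux n c)) / (n - m)) {c..d}"
  if "m \<noteq> n"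
proof -
  have "sol m (\<lambda>x. (n - m) * phi n x) (phi n) (flux n)"
    using phi_solution[of n] unfolding string_solution_def by (auto simp: algebra_simps)
  from has_integral_divide[OF lagrange_identity[OF phi_solution this], of "n - m"] that
  show ?thesis
    by (simp add: mult.assoc)
qed

abbreviation "square_norm m \<equiv> integral {c..d} (\<lambda>x. r x * (phi m x)\<^sup>2)"

lemma square_norm_pos:
  "(\<lambda>x. r x * (phi m x)\<^sup>2) integrable_on {c..d}" "0 < square_norm m"
proof -
  have cont: "continuous_on {c..d} (\<lambda>x. r x * (phi m x)\<^sup>2)"
    by (intro continuous_intros r_cont phi_cont)
  then show int: "(\<lambda>x. r x * (phi m x)\<^sup>2) integrable_on {c..d}"
    by (rule integrable_continuous_interval)
  have nonneg: "0 \<le> r x * (phi m x)\<^sup>2" if "x \<in> {c..d}" for x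
    using r_pos[OF that] by simp
  have "square_norm m \<noteq> 0"
  proof
    assume "square_norm m = 0"
    with integrable_integral[OF int] have "((\<lambda>x. r x * (phi m x)\<^sup>2) has_integral 0) {c..d}"
      by simp
    then have zero: "r x * (phi m x)\<^sup>2 = 0" if "x \<in> {c..d}" for x
      using has_integral_0_cbox_imp_0[of c d "\<lambda>x. r x * (phi m x)\<^sup>2" x] cont nonneg that c_less_d
      by (auto simp: box_real)
    obtain x where "x \<in> {c..d}" "phi m x \<noteq> 0"
      using phi_ne_0 by blast
    then show False
      using r_pos[of x] zero[of x] by auto
  qed
  moreover have "0 \<le> square_norm m"
    using integral_nonneg[OF int nonneg] .
  ultimately show "0 < square_norm m"
    by simp
qed

lemma gram_tendsto:
  assumes "(f \<longlongrightarrow> m) F" "(h \<longlongrightarrow> m) F" "F \<noteq> bot"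
  shows "((\<lambda>t. integral {c..d} (\<lambda>x. r x * phi (f t) x * phi (h t) x)) \<longlongrightarrow>
    square_norm m) F"
proof -
  have bounded: "bounded (phi m ` {c..d})" "bounded (r ` {c..d})" "bounded ((\<lambda>x. r x * phi m x) ` {c..d})"
    by (intro compact_imp_bounded compact_continuous_image phi_cont r_cont compact_Icc continuous_intros)+
  have lim: "uniform_limit {c..d} (\<lambda>t. phi (f t)) (phi m) F" "uniform_limit {c..d} (\<lambda>t. phi (h t)) (phi m) F"
    by (rule filterlim_compose[OF phi_uniform assms(1)], rule filterlim_compose[OF phi_uniform assms(2)])
  have "uniform_limit {c..d} (\<lambda>t x. r x * phi (f t) x * phi (h t) x) (\<lambda>x. r x * phi m x * phi m x) F"
    by (intro uniform_lim_mult lim uniform_limit_const bounded)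
  moreover have "continuous_on {c..d} (\<lambda>x. r x * phi (f t) x * phi (h t) x)" for t
    by (intro continuous_intros r_cont phi_cont)
  ultimately obtain I J where
    "\<And>t. ((\<lambda>x. r x * phi (f t) x * phi (h t) x) has_integral I t) {c..d}"
    "((\<lambda>x. r x * phi m x * phi m x) has_integral J) {c..d}" "(I \<longlongrightarrow> J) F"
    by (rule uniform_limit_integral[OF _ _ \<open>F \<noteq> bot\<close>]) blast
  moreover from this have "integral {c..d} (\<lambda>x. r x * phi (f t) x * phi (h t) x) = I t"
    "integral {c..d} (\<lambda>x. r x * phi m x * phi m x) = J" for t
    by (blast intro: integral_unique)+
  ultimately show ?thesis
    by (simp only: power2_eq_square flip: mult.assoc)
qed

text \<open>
  The integral depends continuously on both parameters and is positive on the diagonal.  With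
  \<open>lagrange_identity_parameters\<close>, this makes the pair of value and flux at the free end rotate strictly
  as the parameter grows.
\<close>

lemma gram_pos_near:
  "\<exists>\<delta>>0. \<forall>n1 n2. \<bar>n1 - m\<bar> < \<delta> \<longrightarrow> \<bar>n2 - m\<bar> < \<delta> \<longrightarrow>
    0 < integral {c..d} (\<lambda>x. r x * phi n1 x * phi n2 x)"
proof -
  have "((\<lambda>t. integral {c..d} (\<lambda>x. r x * phi (fst t) x * phi (snd t) x)) \<longlongrightarrow>
    square_norm m) (nhds m \<times>\<^sub>F nhds m)"
    by (intro gram_tendsto filterlim_fst filterlim_snd) (simp add: prod_filter_eq_bot)
  then have "\<forall>\<^sub>F t in nhds (m, m). 0 < integral {c..d} (\<lambda>x. r x * phi (fst t) x * phi (snd t) x)"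
    using square_norm_pos(2)[of m] by (auto simp: nhds_prod dest: order_tendstoD(1))
  then obtain \<delta> where "0 < \<delta>" and \<delta>: "\<And>t. dist t (m, m) < \<delta> \<Longrightarrow>
      0 < integral {c..d} (\<lambda>x. r x * phi (fst t) x * phi (snd t) x)"
    unfolding eventually_nhds_metric by blast
  show ?thesis
  proof (intro exI[of _ "\<delta> / 2"] conjI allI impI)
    fix n1 n2 assume "\<bar>n1 - m\<bar> < \<delta> / 2" "\<bar>n2 - m\<bar> < \<delta> / 2"
    then have "dist (n1, n2) (m, m) < \<delta>"
      using sqrt_sum_squares_le_sum_abs[of "n1 - m" "n2 - m"]
      by (simp add: dist_Pair_Pair dist_real_def)
    from \<delta>[OF this] show "0 < integral {c..d} (\<lambda>x. r x * phi n1 x * phi n2 x)"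
      by simp
  qed (use \<open>0 < \<delta>\<close> in simp)
qed

text \<open>
  For \<open>m \<le> 0\<close> the derivative \<open>(k \<phi>')\<^sup>2 / k - m r \<phi>\<^sup>2\<close> of \<open>\<phi> k \<phi>'\<close> is nonnegative, and positive
  at the fixed end.
\<close>

lemma energy_pos:
  assumes "m \<le> 0"
  shows "phi m c * flux m c < phi m d * flux m d"
proof -
  have int: "((\<lambda>x. inverse (k x) * (flux m x)\<^sup>2 - m * r x * (phi m x)\<^sup>2) has_integral
    phi m d * flux m d - phi m c * flux m c) {c..d}"
  proof (rule fundamental_theorem_of_calculus)
    fix x assume "x \<in> {c..d}"
    then have y': "(phi m has_real_derivative inverse (k x) * flux m x) (at x within {c..d})"
      and p': "(flux m has_real_derivative - (r x * (m * phi m x))) (at x within {c..d})"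
      using phi_solution[of m]
      by (auto simp: string_solution_def has_real_derivative_iff_has_vector_derivative)
    have "((\<lambda>x. phi m x * flux m x) has_real_derivative
        inverse (k x) * (flux m x)\<^sup>2 - m * r x * (phi m x)\<^sup>2) (at x within {c..d})"
      by (rule DERIV_cong[OF DERIV_mult[OF y' p']]) (simp add: algebra_simps power2_eq_square)
    then show "((\<lambda>x. phi m x * flux m x) has_vector_derivative
        inverse (k x) * (flux m x)\<^sup>2 - m * r x * (phi m x)\<^sup>2) (at x within {c..d})"
      by (simp add: has_real_derivative_iff_has_vector_derivative)
  qed (use c_less_d in auto)
  have nonneg: "0 \<le> inverse (k x) * (flux m x)\<^sup>2 - m * r x * (phi m x)\<^sup>2" if "x \<in> {c..d}" for x
  proof -
    have "m * (r x * (phi m x)\<^sup>2) \<le> 0" "0 \<le> inverse (k x) * (flux m x)\<^sup>2"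
      using k_pos[OF that] r_pos[OF that] assms by (auto intro: mult_nonpos_nonneg)
    then show ?thesis
      by (simp add: mult.assoc)
  qed
  have "phi m d * flux m d - phi m c * flux m c \<noteq> 0"
  proof
    assume "phi m d * flux m d - phi m c * flux m c = 0"
    moreover have "continuous_on {c..d} (\<lambda>x. inverse (k x) * (flux m x)\<^sup>2 - m * r x * (phi m x)\<^sup>2)"
      by (intro continuous_intros inverse_k_cont r_cont phi_cont flux_cont)
    ultimately have "inverse (k e) * (flux m e)\<^sup>2 - m * r e * (phi m e)\<^sup>2 = 0"
      using has_integral_0_cbox_imp_0[of c d "\<lambda>x. inverse (k x) * (flux m x)\<^sup>2 - m * r x * (phi m x)\<^sup>2" e]
        int nonneg e_mem c_less_d
      by (auto simp: box_real)
    then show False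
      using k_pos[OF e_mem] by (simp add: phi_e flux_e)
  qed
  then show ?thesis
    using has_integral_nonneg[OF int nonneg] by linarith
qed

lemma phi_deriv:
  "x \<in> {c..d} \<Longrightarrow> (phi m has_real_derivative inverse (k x) * flux m x) (at x within {c..d})"
  using phi_solution[of m] by (simp add: string_solution_def has_real_derivative_iff_has_vector_derivative)

lemma bounded_phi: "bounded (phi m ` {c..d})" and bounded_flux: "bounded (flux m ` {c..d})"
  by (intro compact_imp_bounded compact_continuous_image phi_cont flux_cont compact_Icc)+

lemma scaled_phi_uniform:
  assumes "(f \<longlongrightarrow> m) F" "(h \<longlongrightarrow> h0) F"
  shows "uniform_limit {c..d} (\<lambda>t x. h t * phi (f t) x) (\<lambda>x. h0 * phi m x) F"
    and "uniform_limit {c..d} (\<lambda>t x. inverse (k x) * (h t * flux (f t) x))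
      (\<lambda>x. inverse (k x) * (h0 * flux m x)) F"
proof -
  show "uniform_limit {c..d} (\<lambda>t x. h t * phi (f t) x) (\<lambda>x. h0 * phi m x) F"
    by (intro uniform_limit_scaled assms bounded_phi filterlim_compose[OF phi_uniform assms(1)])
  show "uniform_limit {c..d} (\<lambda>t x. inverse (k x) * (h t * flux (f t) x))
      (\<lambda>x. inverse (k x) * (h0 * flux m x)) F"
  proof (rule uniform_lim_mult[OF uniform_limit_const])
    show "uniform_limit {c..d} (\<lambda>t x. h t * flux (f t) x) (\<lambda>x. h0 * flux m x) F"
      by (intro uniform_limit_scaled assms bounded_flux filterlim_compose[OF flux_uniform assms(1)])
    show "bounded ((\<lambda>x. inverse (k x)) ` {c..d})" "bounded ((\<lambda>x. h0 * flux m x) ` {c..d})"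
      by (intro compact_imp_bounded compact_continuous_image continuous_intros inverse_k_cont flux_cont
          compact_Icc)+
  qed
qed

end

section \<open>Counting the roots of the characteristic function\<close>

text \<open>
  A plane vector that rotates clockwise has a decreasing slope.
\<close>

lemma quotient_strict_mono:
  fixes x1 x2 y1 y2 :: real
  assumes "x1 * y2 - y1 * x2 < 0" "0 < x1 * x2"
  shows "y2 / x2 < y1 / x1"
proof -
  have nz: "x1 \<noteq> 0" "x2 \<noteq> 0"
    using assms(2) by auto
  then have "y2 / x2 - y1 / x1 = (x1 * y2 - y1 * x2) / (x1 * x2)"
    by (simp add: field_simps)
  also have "\<dots> < 0"
    using assms by (rule divide_neg_pos)
  finally show ?thesis
    by simp
qed

lemma same_sign_near:
  fixes X :: "real \<Rightarrow> real"
  assumes "isCont X m0"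
  obtains \<delta> where "0 < \<delta>"
    "\<And>m1 m2. X m0 \<noteq> 0 \<Longrightarrow> \<bar>m1 - m0\<bar> < \<delta> \<Longrightarrow> \<bar>m2 - m0\<bar> < \<delta> \<Longrightarrow> 0 < X m1 * X m2"
proof (cases "X m0 = 0")
  case True
  then show ?thesis
    using that[of 1] by simp
next
  case False
  have "((\<lambda>m. X m * X m0) \<longlongrightarrow> X m0 * X m0) (nhds m0)"
    using assms by (intro tendsto_intros) (simp add: isCont_def tendsto_at_iff_tendsto_nhds)
  moreover have "0 < X m0 * X m0"
    using False by (simp add: zero_less_mult_iff) linarith
  ultimately have "\<forall>\<^sub>F m in nhds m0. 0 < X m * X m0"
    by (rule order_tendstoD(1))
  then obtain \<delta> where "0 < \<delta>" and \<delta>: "\<And>m. \<bar>m - m0\<bar> < \<delta> \<Longrightarrow> 0 < X m * X m0"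
    unfolding eventually_nhds_metric dist_real_def by blast
  have "0 < X m1 * X m2" if "\<bar>m1 - m0\<bar> < \<delta>" "\<bar>m2 - m0\<bar> < \<delta>" for m1 m2
    using \<delta>[OF that(1)] \<delta>[OF that(2)] by (auto simp: zero_less_mult_iff)
  with \<open>0 < \<delta>\<close> show ?thesis
    using that by blast
qed

text \<open>
  The function \<open>f - \<epsilon> h\<close> is strictly decreasing, and for small \<open>\<epsilon>\<close> it still changes sign.
\<close>

lemma one_root:
  fixes f h :: "real \<Rightarrow> real"
  assumes "0 < \<delta>"
    and f: "\<And>x y. \<bar>x - m0\<bar> \<le> \<delta> \<Longrightarrow> \<bar>y - m0\<bar> \<le> \<delta> \<Longrightarrow> x < y \<Longrightarrow> f y < f x"
    and h: "\<And>x y. \<bar>x - m0\<bar> \<le> \<delta> \<Longrightarrow> \<bar>y - m0\<bar> \<le> \<delta> \<Longrightarrow> x < y \<Longrightarrow> h x < h y"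
    and cont: "continuous_on {m0 - \<delta>..m0 + \<delta>} f" "continuous_on {m0 - \<delta>..m0 + \<delta>} h"
    and "f m0 = 0"
  shows "\<forall>\<^sub>F \<epsilon> in at_right 0. card {m. \<bar>m - m0\<bar> < \<delta> \<and> f m = \<epsilon> * h m} = 1"
proof -
  have ends: "0 < f (m0 - \<delta>)" "f (m0 + \<delta>) < 0"
    using f[of "m0 - \<delta>" m0] f[of m0 "m0 + \<delta>"] assms by auto
  have lim: "((\<lambda>\<epsilon>. f m - \<epsilon> * h m) \<longlongrightarrow> f m - 0 * h m) (at_right 0)" for m
    by (intro tendsto_intros)
  have "\<forall>\<^sub>F \<epsilon> in at_right 0. 0 < f (m0 - \<delta>) - \<epsilon> * h (m0 - \<delta>)"
    by (rule order_tendstoD(1)[OF lim]) (use ends in simp)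
  moreover have "\<forall>\<^sub>F \<epsilon> in at_right 0. f (m0 + \<delta>) - \<epsilon> * h (m0 + \<delta>) < 0"
    by (rule order_tendstoD(2)[OF lim]) (use ends in simp)
  moreover have "\<forall>\<^sub>F \<epsilon> in at_right 0. (0::real) < \<epsilon>"
    by (rule eventually_at_right_less)
  ultimately show ?thesis
  proof eventually_elim
    case (elim \<epsilon>)
    have "\<exists>m\<ge>m0 - \<delta>. m \<le> m0 + \<delta> \<and> f m - \<epsilon> * h m = 0"
      using elim \<open>0 < \<delta>\<close> by (intro IVT2') (auto intro!: continuous_intros cont)
    then obtain m where m: "m0 - \<delta> \<le> m" "m \<le> m0 + \<delta>" "f m - \<epsilon> * h m = 0"
      by blast
    then have "m \<noteq> m0 - \<delta>" "m \<noteq> m0 + \<delta>"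
      using elim by auto
    with m have near: "\<bar>m - m0\<bar> < \<delta>"
      by linarith
    have decr: "f y - \<epsilon> * h y < f x - \<epsilon> * h x" if "\<bar>x - m0\<bar> < \<delta>" "\<bar>y - m0\<bar> < \<delta>" "x < y" for x y
      using f[of x y] mult_strict_left_mono[OF h[of x y] elim(3)] that by auto
    have uniq: "n = m" if "\<bar>n - m0\<bar> < \<delta>" "f n = \<epsilon> * h n" for n
      using decr[of n m] decr[of m n] that near m(3) by (cases n m rule: linorder_cases) auto
    have "{m. \<bar>m - m0\<bar> < \<delta> \<and> f m = \<epsilon> * h m} = {m}"
    proof (intro equalityI subsetI)
      fix x assume "x \<in> {m. \<bar>m - m0\<bar> < \<delta> \<and> f m = \<epsilon> * h m}"
      then show "x \<in> {m}"
        using uniq[of x] by simp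
    qed (use near m(3) in simp)
    then show ?case
      by simp
  qed
qed

text \<open>
  Both factors are positive and increase to the right of their common root, and so does the product.
\<close>

lemma one_root_product:
  fixes f g :: "real \<Rightarrow> real"
  assumes "0 < \<delta>"
    and f: "\<And>x y. m0 \<le> x \<Longrightarrow> y \<le> m0 + \<delta> \<Longrightarrow> x < y \<Longrightarrow> f x < f y"
    and g: "\<And>x y. m0 \<le> x \<Longrightarrow> y \<le> m0 + \<delta> \<Longrightarrow> x < y \<Longrightarrow> g x < g y"
    and cont: "continuous_on {m0..m0 + \<delta>} f" "continuous_on {m0..m0 + \<delta>} g"
    and "f m0 = 0" "g m0 = 0"
  shows "\<forall>\<^sub>F \<epsilon> in at_right 0. \<exists>n. {m. m0 < m \<and> m < m0 + \<delta> \<and> f m * g m = \<epsilon>} = {n}"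
proof -
  have pos: "0 < f m" "0 < g m" if "m0 < m" "m \<le> m0 + \<delta>" for m
    using f[of m0 m] g[of m0 m] that assms by auto
  have "\<forall>\<^sub>F \<epsilon> in at_right 0. \<epsilon> < f (m0 + \<delta>) * g (m0 + \<delta>)"
    using pos[of "m0 + \<delta>"] \<open>0 < \<delta>\<close>
    by (intro order_tendstoD(2)[OF tendsto_ident_at]) auto
  moreover have "\<forall>\<^sub>F \<epsilon> in at_right 0. (0::real) < \<epsilon>"
    by (rule eventually_at_right_less)
  ultimately show ?thesis
  proof eventually_elim
    case (elim \<epsilon>)
    have "\<exists>m\<ge>m0. m \<le> m0 + \<delta> \<and> f m * g m = \<epsilon>"
      using elim assms by (intro IVT') (auto intro!: continuous_intros cont)
    then obtain m where m: "m0 \<le> m" "m \<le> m0 + \<delta>" "f m * g m = \<epsilon>"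
      by blast
    then have "m \<noteq> m0" "m \<noteq> m0 + \<delta>"
      using elim assms by auto
    with m have near: "m0 < m" "m < m0 + \<delta>"
      by linarith+
    have incr: "f x * g x < f y * g y" if "m0 < x" "y < m0 + \<delta>" "x < y" for x y
      using f[of x y] g[of x y] pos[of x] that by (intro mult_strict_mono) auto
    have uniq: "n = m" if "m0 < n" "n < m0 + \<delta>" "f n * g n = \<epsilon>" for n
      using incr[of n m] incr[of m n] that near m(3) by (cases n m rule: linorder_cases) auto
    have "{m. m0 < m \<and> m < m0 + \<delta> \<and> f m * g m = \<epsilon>} = {m}"
    proof (intro equalityI subsetI)
      fix x assume "x \<in> {m. m0 < m \<and> m < m0 + \<delta> \<and> f m * g m = \<epsilon>}"
      then show "x \<in> {m}"
        using uniq[of x] by simp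
    qed (use near m(3) in simp)
    then show ?case
      by blast
  qed
qed

text \<open>
  The product has a double zero at \<open>m0\<close> and increases strictly to both sides of it, so that a small
  positive level is attained once on each side.
\<close>

lemma two_roots:
  fixes f g :: "real \<Rightarrow> real"
  assumes "0 < \<delta>"
    and f: "\<And>x y. \<bar>x - m0\<bar> \<le> \<delta> \<Longrightarrow> \<bar>y - m0\<bar> \<le> \<delta> \<Longrightarrow> x < y \<Longrightarrow> f y < f x"
    and g: "\<And>x y. \<bar>x - m0\<bar> \<le> \<delta> \<Longrightarrow> \<bar>y - m0\<bar> \<le> \<delta> \<Longrightarrow> x < y \<Longrightarrow> g y < g x"
    and cont: "continuous_on {m0 - \<delta>..m0 + \<delta>} f" "continuous_on {m0 - \<delta>..m0 + \<delta>} g"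
    and "f m0 = 0" "g m0 = 0"
  shows "\<forall>\<^sub>F \<epsilon> in at_right 0. card {m. \<bar>m - m0\<bar> < \<delta> \<and> f m * g m = \<epsilon>} = 2"
proof -
  have "\<forall>\<^sub>F \<epsilon> in at_right 0. \<exists>n. {m. m0 < m \<and> m < m0 + \<delta> \<and> (- f m) * (- g m) = \<epsilon>} = {n}"
    using assms
    by (intro one_root_product continuous_intros) (auto intro: continuous_on_subset)
  moreover have "\<forall>\<^sub>F \<epsilon> in at_right 0. \<exists>n. {m. - m0 < m \<and> m < - m0 + \<delta> \<and> f (- m) * g (- m) = \<epsilon>} = {n}"
  proof (intro one_root_product)
    have "uminus ` {- m0..- m0 + \<delta>} \<subseteq> {m0 - \<delta>..m0 + \<delta>}"
      using \<open>0 < \<delta>\<close> by auto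
    then show "continuous_on {- m0..- m0 + \<delta>} (\<lambda>x. f (- x))" "continuous_on {- m0..- m0 + \<delta>} (\<lambda>x. g (- x))"
      by (auto intro!: continuous_on_compose2[OF cont(1)] continuous_on_compose2[OF cont(2)] continuous_intros)
  qed (use assms in auto)
  moreover have "\<forall>\<^sub>F \<epsilon> in at_right 0. (0::real) < \<epsilon>"
    by (rule eventually_at_right_less)
  ultimately show ?thesis
  proof eventually_elim
    case (elim \<epsilon>)
    then obtain n1 n2 where n1: "{m. m0 < m \<and> m < m0 + \<delta> \<and> (- f m) * (- g m) = \<epsilon>} = {n1}"
      and n2: "{m. - m0 < m \<and> m < - m0 + \<delta> \<and> f (- m) * g (- m) = \<epsilon>} = {n2}"
      by blast
    have "\<bar>m - m0\<bar> < \<delta> \<and> f m * g m = \<epsilon> \<longleftrightarrow> m = n1 \<or> m = - n2" for m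
    proof -
      have "m \<in> {m. m0 < m \<and> m < m0 + \<delta> \<and> (- f m) * (- g m) = \<epsilon>} \<longleftrightarrow> m = n1"
        unfolding n1 by simp
      moreover have "- m \<in> {m. - m0 < m \<and> m < - m0 + \<delta> \<and> f (- m) * g (- m) = \<epsilon>} \<longleftrightarrow> - m = n2"
        unfolding n2 by simp
      moreover have "m \<noteq> m0 \<or> f m * g m \<noteq> \<epsilon>"
        using assms elim by auto
      ultimately show ?thesis
        by (cases m m0 rule: linorder_cases) (auto simp: abs_less_iff)
    qed
    then have "{m. \<bar>m - m0\<bar> < \<delta> \<and> f m * g m = \<epsilon>} = {n1, - n2}"
      by (simp add: set_eq_iff)
    moreover have "n1 \<noteq> - n2"
    proof -
      have "n1 \<in> {m. m0 < m \<and> m < m0 + \<delta> \<and> (- f m) * (- g m) = \<epsilon>}"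
        "n2 \<in> {m. - m0 < m \<and> m < - m0 + \<delta> \<and> f (- m) * g (- m) = \<epsilon>}"
        unfolding n1 n2 by simp_all
      then have "m0 < n1" "- m0 < n2"
        by simp_all
      then show ?thesis
        by linarith
    qed
    ultimately show ?case
      by simp
  qed
qed

text \<open>
  All that the asymptotics of the eigenvalues needs to know about the two strings: the vectors
  \<open>(A, B)\<close> and \<open>(C, D)\<close> of values and fluxes at the junction depend continuously on the parameter
  and rotate strictly, clockwise and anticlockwise respectively; for nonpositive parameters they
  point into different quadrants.
\<close>

locale rotating_pairs =
  fixes A B C D :: "real \<Rightarrow> real"
  assumes cont: "\<And>m. isCont A m" "\<And>m. isCont B m" "\<And>m. isCont C m" "\<And>m. isCont D m"
    and rot_AB: "\<And>m0. \<exists>\<delta>>0. \<forall>m1 m2. \<bar>m1 - m0\<bar> < \<delta> \<longrightarrow> \<bar>m2 - m0\<bar> < \<delta> \<longrightarrow> m1 < m2 \<longrightarrow>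
      A m1 * B m2 - B m1 * A m2 < 0"
    and rot_CD: "\<And>m0. \<exists>\<delta>>0. \<forall>m1 m2. \<bar>m1 - m0\<bar> < \<delta> \<longrightarrow> \<bar>m2 - m0\<bar> < \<delta> \<longrightarrow> m1 < m2 \<longrightarrow>
      D m1 * C m2 - C m1 * D m2 < 0"
    and AB_pos: "\<And>m. m \<le> 0 \<Longrightarrow> 0 < A m * B m"
    and CD_neg: "\<And>m. m \<le> 0 \<Longrightarrow> C m * D m < 0"
begin

lemma AB_nz: "A m \<noteq> 0 \<or> B m \<noteq> 0"
proof -
  obtain \<delta> where "0 < \<delta>" "\<And>m1 m2. \<bar>m1 - m\<bar> < \<delta> \<Longrightarrow> \<bar>m2 - m\<bar> < \<delta> \<Longrightarrow> m1 < m2 \<Longrightarrow>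
      A m1 * B m2 - B m1 * A m2 < 0"
    using rot_AB[of m] by blast
  from this(2)[of m "m + \<delta> / 2"] this(1) show ?thesis
    by auto
qed

lemma CD_nz: "C m \<noteq> 0 \<or> D m \<noteq> 0"
proof -
  obtain \<delta> where "0 < \<delta>" "\<And>m1 m2. \<bar>m1 - m\<bar> < \<delta> \<Longrightarrow> \<bar>m2 - m\<bar> < \<delta> \<Longrightarrow> m1 < m2 \<Longrightarrow>
      D m1 * C m2 - C m1 * D m2 < 0"
    using rot_CD[of m] by blast
  from this(2)[of m "m + \<delta> / 2"] this(1) show ?thesis
    by auto
qed

text \<open>
  The determinant of the linear system \<open>c A = d C\<close>, \<open>c B = \<epsilon> d D\<close> for the coefficients \<open>c\<close> and \<open>d\<close>.
\<close>

definition char_fun :: "real \<Rightarrow> real \<Rightarrow> real" where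
  "char_fun \<epsilon> m = B m * C m - \<epsilon> * (A m * D m)"

definition root_mult :: "real \<Rightarrow> nat" where
  "root_mult m = of_bool (B m = 0) + of_bool (C m = 0)"

lemma char_fun_0: "char_fun 0 m = 0 \<longleftrightarrow> B m = 0 \<or> C m = 0"
  by (simp add: char_fun_def)

text \<open>
  At a root, \<open>(A B) (C D) = \<epsilon> (A D)\<^sup>2 \<ge> 0\<close>, whereas for \<open>m \<le> 0\<close> the two factors have opposite signs.
\<close>

lemma char_fun_root_pos:
  assumes "char_fun \<epsilon> m = 0" "0 \<le> \<epsilon>"
  shows "0 < m"
proof (rule ccontr)
  assume "\<not> 0 < m"
  then have "m \<le> 0"
    by simp
  from AB_pos[OF this] CD_neg[OF this] have "(A m * B m) * (C m * D m) < 0"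
    by (rule mult_pos_neg)
  moreover have "(A m * B m) * (C m * D m) = \<epsilon> * (A m * D m)\<^sup>2"
    using assms(1) unfolding char_fun_def
    by (metis eq_iff_diff_eq_0 mult.assoc mult.commute power2_eq_square)
  ultimately show False
    using assms(2) by (metis mult_nonneg_nonneg not_less zero_le_power2)
qed

lemma no_roots_on_compact:
  assumes "compact K" and nz: "\<And>m. m \<in> K \<Longrightarrow> char_fun 0 m \<noteq> 0"
  shows "\<forall>\<^sub>F \<epsilon> in at_right 0. \<forall>m\<in>K. char_fun \<epsilon> m \<noteq> 0"
proof (cases "K = {}")
  case False
  have cBC: "continuous_on K (\<lambda>m. \<bar>B m * C m\<bar>)" and cAD: "continuous_on K (\<lambda>m. \<bar>A m * D m\<bar>)"
    by (intro continuous_intros continuous_at_imp_continuous_on ballI cont)+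
  obtain n where n: "n \<in> K" "\<And>m. m \<in> K \<Longrightarrow> \<bar>B n * C n\<bar> \<le> \<bar>B m * C m\<bar>"
    using continuous_attains_inf[OF \<open>compact K\<close> False cBC] by blast
  obtain s where s: "\<And>m. m \<in> K \<Longrightarrow> \<bar>A m * D m\<bar> \<le> \<bar>A s * D s\<bar>"
    using continuous_attains_sup[OF \<open>compact K\<close> False cAD] by blast
  have "((\<lambda>\<epsilon>. \<epsilon> * \<bar>A s * D s\<bar>) \<longlongrightarrow> 0 * \<bar>A s * D s\<bar>) (at_right 0)"
    by (intro tendsto_intros)
  moreover have "0 < \<bar>B n * C n\<bar>"
    using nz[OF n(1)] by (simp add: char_fun_0)
  ultimately have "\<forall>\<^sub>F \<epsilon> in at_right 0. \<epsilon> * \<bar>A s * D s\<bar> < \<bar>B n * C n\<bar>"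
    by (intro order_tendstoD(2)) auto
  moreover have "\<forall>\<^sub>F \<epsilon> in at_right 0. (0::real) < \<epsilon>"
    by (rule eventually_at_right_less)
  ultimately show ?thesis
  proof eventually_elim
    case (elim \<epsilon>)
    show ?case
    proof
      fix m assume m: "m \<in> K"
      have "\<bar>\<epsilon> * (A m * D m)\<bar> = \<epsilon> * \<bar>A m * D m\<bar>"
        using elim by (simp add: abs_mult)
      also have "\<dots> \<le> \<epsilon> * \<bar>A s * D s\<bar>"
        using elim s[OF m] by (intro mult_left_mono) auto
      also have "\<dots> < \<bar>B m * C m\<bar>"
        using elim n(2)[OF m] by linarith
      finally show "char_fun \<epsilon> m \<noteq> 0"
        by (auto simp: char_fun_def)
    qed
  qed
qed simp

text \<open>
  The neighbourhood isolates \<open>m0\<close> from the other roots for \<open>\<epsilon> = 0\<close>, and it contains as many roots for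
  small \<open>\<epsilon>\<close> as the multiplicity of \<open>m0\<close> says.
\<close>

definition counting_radius :: "real \<Rightarrow> real \<Rightarrow> bool" where
  "counting_radius m0 \<delta> \<longleftrightarrow>
    (\<forall>m. m \<noteq> m0 \<and> \<bar>m - m0\<bar> \<le> \<delta> \<longrightarrow> char_fun 0 m \<noteq> 0) \<and>
    (\<forall>\<^sub>F \<epsilon> in at_right 0. finite {m. \<bar>m - m0\<bar> < \<delta> \<and> char_fun \<epsilon> m = 0} \<and>
       card {m. \<bar>m - m0\<bar> < \<delta> \<and> char_fun \<epsilon> m = 0} = root_mult m0)"

text \<open>
  Dividing \<open>B C = \<epsilon> A D\<close> by factors that do not vanish near \<open>m0\<close> gives an equation between monotone
  functions: \<open>B / A = \<epsilon> D / C\<close> or \<open>C / D = \<epsilon> A / B\<close> at a simple root,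
  \<open>(B / A) (C / D) = \<epsilon>\<close> at a double one.
\<close>

lemma local_count: "\<exists>\<delta>0>0. \<forall>\<delta>. 0 < \<delta> \<and> \<delta> < \<delta>0 \<longrightarrow> counting_radius m0 \<delta>"
proof -
  obtain \<delta>1 where "0 < \<delta>1" and rot1: "\<And>m1 m2. \<bar>m1 - m0\<bar> < \<delta>1 \<Longrightarrow> \<bar>m2 - m0\<bar> < \<delta>1 \<Longrightarrow> m1 < m2 \<Longrightarrow>
      A m1 * B m2 - B m1 * A m2 < 0"
    using rot_AB[of m0] by blast
  obtain \<delta>2 where "0 < \<delta>2" and rot2: "\<And>m1 m2. \<bar>m1 - m0\<bar> < \<delta>2 \<Longrightarrow> \<bar>m2 - m0\<bar> < \<delta>2 \<Longrightarrow> m1 < m2 \<Longrightarrow>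
      D m1 * C m2 - C m1 * D m2 < 0"
    using rot_CD[of m0] by blast
  obtain \<delta>A where "0 < \<delta>A" and signA: "\<And>m1 m2. A m0 \<noteq> 0 \<Longrightarrow> \<bar>m1 - m0\<bar> < \<delta>A \<Longrightarrow>
      \<bar>m2 - m0\<bar> < \<delta>A \<Longrightarrow> 0 < A m1 * A m2"
    using same_sign_near[OF cont(1)] by blast
  obtain \<delta>B where "0 < \<delta>B" and signB: "\<And>m1 m2. B m0 \<noteq> 0 \<Longrightarrow> \<bar>m1 - m0\<bar> < \<delta>B \<Longrightarrow>
      \<bar>m2 - m0\<bar> < \<delta>B \<Longrightarrow> 0 < B m1 * B m2"
    using same_sign_near[OF cont(2)] by blast
  obtain \<delta>C where "0 < \<delta>C" and signC: "\<And>m1 m2. C m0 \<noteq> 0 \<Longrightarrow> \<bar>m1 - m0\<bar> < \<delta>C \<Longrightarrow>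
      \<bar>m2 - m0\<bar> < \<delta>C \<Longrightarrow> 0 < C m1 * C m2"
    using same_sign_near[OF cont(3)] by blast
  obtain \<delta>D where "0 < \<delta>D" and signD: "\<And>m1 m2. D m0 \<noteq> 0 \<Longrightarrow> \<bar>m1 - m0\<bar> < \<delta>D \<Longrightarrow>
      \<bar>m2 - m0\<bar> < \<delta>D \<Longrightarrow> 0 < D m1 * D m2"
    using same_sign_near[OF cont(4)] by blast
  define \<delta>0 where "\<delta>0 = Min {\<delta>1, \<delta>2, \<delta>A, \<delta>B, \<delta>C, \<delta>D}"
  have "0 < \<delta>0"
    using \<open>0 < \<delta>1\<close> \<open>0 < \<delta>2\<close> \<open>0 < \<delta>A\<close> \<open>0 < \<delta>B\<close> \<open>0 < \<delta>C\<close> \<open>0 < \<delta>D\<close> by (simp add: \<delta>0_def)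
  have \<delta>0: "\<delta>0 \<le> \<delta>1" "\<delta>0 \<le> \<delta>2" "\<delta>0 \<le> \<delta>A" "\<delta>0 \<le> \<delta>B" "\<delta>0 \<le> \<delta>C" "\<delta>0 \<le> \<delta>D"
    by (simp_all add: \<delta>0_def)
  show ?thesis
    unfolding counting_radius_def
  proof (intro exI[of _ \<delta>0] conjI allI impI \<open>0 < \<delta>0\<close>; elim conjE)
    fix \<delta> assume \<delta>: "0 < \<delta>" "\<delta> < \<delta>0"
    have near: "\<bar>m - m0\<bar> < \<delta>0" if "\<bar>m - m0\<bar> \<le> \<delta>" for m
      using that \<delta> by linarith
    have rotAB: "A m1 * B m2 - B m1 * A m2 < 0" and rotCD: "D m1 * C m2 - C m1 * D m2 < 0"
      if "\<bar>m1 - m0\<bar> \<le> \<delta>" "\<bar>m2 - m0\<bar> \<le> \<delta>" "m1 < m2" for m1 m2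
      using rot1[of m1 m2] rot2[of m1 m2] near[OF that(1)] near[OF that(2)] that(3) \<delta>0 by auto
    have sign: "0 < X m1 * X m2"
      if "X \<in> {A, B, C, D}" "X m0 \<noteq> 0" "\<bar>m1 - m0\<bar> \<le> \<delta>" "\<bar>m2 - m0\<bar> \<le> \<delta>" for X :: "real \<Rightarrow> real" and m1 m2
    proof -
      have "\<bar>m1 - m0\<bar> < \<delta>0" "\<bar>m2 - m0\<bar> < \<delta>0"
        using near that(3,4) by blast+
      then show ?thesis
        using that(1,2) \<delta>0 signA[of m1 m2] signB[of m1 m2] signC[of m1 m2] signD[of m1 m2] by auto
    qed
    have nz: "X m \<noteq> 0" if "X \<in> {A, B, C, D}" "X m0 \<noteq> 0" "\<bar>m - m0\<bar> \<le> \<delta>" for X :: "real \<Rightarrow> real" and m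
      using sign[OF that that(3)] by auto
    have c: "continuous_on {m0 - \<delta>..m0 + \<delta>} X" if "X \<in> {A, B, C, D}" for X
      using that cont by (auto intro: continuous_at_imp_continuous_on)
    have quot: "continuous_on {m0 - \<delta>..m0 + \<delta>} (\<lambda>m. X m / Y m)"
      if "X \<in> {A, B, C, D}" "Y \<in> {A, B, C, D}" "Y m0 \<noteq> 0" for X Y :: "real \<Rightarrow> real"
      using nz[OF that(2,3)] by (intro continuous_on_divide c that) (auto simp: abs_le_iff)
    have BA: "B y / A y < B x / A x" if "A m0 \<noteq> 0" "\<bar>x - m0\<bar> \<le> \<delta>" "\<bar>y - m0\<bar> \<le> \<delta>" "x < y" for x y
      using rotAB[OF that(2-4)] sign[of A x y] that by (intro quotient_strict_mono) auto
    have AB: "A x / B x < A y / B y" if "B m0 \<noteq> 0" "\<bar>x - m0\<bar> \<le> \<delta>" "\<bar>y - m0\<bar> \<le> \<delta>" "x < y" for x y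
      using rotAB[OF that(2-4)] sign[of B y x] that by (intro quotient_strict_mono) (auto simp: mult.commute)
    have CD: "C y / D y < C x / D x" if "D m0 \<noteq> 0" "\<bar>x - m0\<bar> \<le> \<delta>" "\<bar>y - m0\<bar> \<le> \<delta>" "x < y" for x y
      using rotCD[OF that(2-4)] sign[of D x y] that by (intro quotient_strict_mono) auto
    have DC: "D x / C x < D y / C y" if "C m0 \<noteq> 0" "\<bar>x - m0\<bar> \<le> \<delta>" "\<bar>y - m0\<bar> \<le> \<delta>" "x < y" for x y
      using rotCD[OF that(2-4)] sign[of C y x] that by (intro quotient_strict_mono) (auto simp: mult.commute)
    show "char_fun 0 m \<noteq> 0" if "m \<noteq> m0" "\<bar>m - m0\<bar> \<le> \<delta>" for m
    proof -
      have "B m \<noteq> 0"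
      proof (cases "B m0 = 0")
        case True
        then have "A m0 \<noteq> 0"
          using AB_nz by blast
        then show ?thesis
          using BA[of m m0] BA[of m0 m] True that \<delta> by (cases m m0 rule: linorder_cases) auto
      qed (use nz that in auto)
      moreover have "C m \<noteq> 0"
      proof (cases "C m0 = 0")
        case True
        then have "D m0 \<noteq> 0"
          using CD_nz by blast
        then show ?thesis
          using CD[of m m0] CD[of m0 m] True that \<delta> by (cases m m0 rule: linorder_cases) auto
      qed (use nz that in auto)
      ultimately show ?thesis
        by (simp add: char_fun_0)
    qed
    consider (none) "B m0 \<noteq> 0" "C m0 \<noteq> 0" | (left) "B m0 = 0" "C m0 \<noteq> 0"
      | (right) "B m0 \<noteq> 0" "C m0 = 0" | (both) "B m0 = 0" "C m0 = 0"
      by blast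
    then show "\<forall>\<^sub>F \<epsilon> in at_right 0. finite {m. \<bar>m - m0\<bar> < \<delta> \<and> char_fun \<epsilon> m = 0} \<and>
       card {m. \<bar>m - m0\<bar> < \<delta> \<and> char_fun \<epsilon> m = 0} = root_mult m0"
    proof cases
      case none
      have "\<forall>\<^sub>F \<epsilon> in at_right 0. \<forall>m\<in>{m0 - \<delta>..m0 + \<delta>}. char_fun \<epsilon> m \<noteq> 0"
        using none nz by (intro no_roots_on_compact) (auto simp: char_fun_0 abs_le_iff)
      then show ?thesis
      proof eventually_elim
        case (elim \<epsilon>)
        then have empty: "{m. \<bar>m - m0\<bar> < \<delta> \<and> char_fun \<epsilon> m = 0} = {}"
          by (auto simp: abs_less_iff)
        show ?case
          unfolding empty using none by (simp add: root_mult_def)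
      qed
    next
      case left
      then have "A m0 \<noteq> 0"
        using AB_nz by blast
      have "\<forall>\<^sub>F \<epsilon> in at_right 0. card {m. \<bar>m - m0\<bar> < \<delta> \<and> B m / A m = \<epsilon> * (D m / C m)} = 1"
        using left \<open>A m0 \<noteq> 0\<close> \<delta> BA DC by (intro one_root quot) auto
      moreover have "B m / A m = \<epsilon> * (D m / C m) \<longleftrightarrow> char_fun \<epsilon> m = 0" if "\<bar>m - m0\<bar> < \<delta>" for m \<epsilon>
        using nz[of A m] nz[of C m] left \<open>A m0 \<noteq> 0\<close> that by (simp add: char_fun_def field_simps)
      ultimately show ?thesis
        using left by (simp add: root_mult_def cong: conj_cong) (auto elim!: eventually_mono intro: card_ge_0_finite)
    next
      case right
      then have "D m0 \<noteq> 0"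
        using CD_nz by blast
      have "\<forall>\<^sub>F \<epsilon> in at_right 0. card {m. \<bar>m - m0\<bar> < \<delta> \<and> C m / D m = \<epsilon> * (A m / B m)} = 1"
        using right \<open>D m0 \<noteq> 0\<close> \<delta> AB CD by (intro one_root quot) auto
      moreover have "C m / D m = \<epsilon> * (A m / B m) \<longleftrightarrow> char_fun \<epsilon> m = 0" if "\<bar>m - m0\<bar> < \<delta>" for m \<epsilon>
        using nz[of D m] nz[of B m] right \<open>D m0 \<noteq> 0\<close> that by (simp add: char_fun_def field_simps)
      ultimately show ?thesis
        using right by (simp add: root_mult_def cong: conj_cong) (auto elim!: eventually_mono intro: card_ge_0_finite)
    next
      case both
      then have nz0: "A m0 \<noteq> 0" "D m0 \<noteq> 0"
        using CD_nz AB_nz by blast+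
      have "\<forall>\<^sub>F \<epsilon> in at_right 0. card {m. \<bar>m - m0\<bar> < \<delta> \<and> (B m / A m) * (C m / D m) = \<epsilon>} = 2"
        using both nz0 \<delta> BA CD by (intro two_roots quot) auto
      moreover have "(B m / A m) * (C m / D m) = \<epsilon> \<longleftrightarrow> char_fun \<epsilon> m = 0" if "\<bar>m - m0\<bar> < \<delta>" for m \<epsilon>
        using nz[of A m] nz[of D m] nz0 that by (simp add: char_fun_def field_simps)
      ultimately show ?thesis
        using both by (simp add: root_mult_def cong: conj_cong) (auto elim!: eventually_mono intro: card_ge_0_finite)
    qed
  qed
qed

lemma roots_isolated: "\<not> m0 islimpt {m. char_fun 0 m = 0}"
proof -
  obtain \<delta>0 where "0 < \<delta>0" and "\<And>\<delta> m. 0 < \<delta> \<Longrightarrow> \<delta> < \<delta>0 \<Longrightarrow> m \<noteq> m0 \<Longrightarrow> \<bar>m - m0\<bar> \<le> \<delta> \<Longrightarrow>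
      char_fun 0 m \<noteq> 0"
    using local_count[of m0] unfolding counting_radius_def by blast
  from this(2)[of "\<delta>0 / 2"] show ?thesis
    using \<open>0 < \<delta>0\<close> unfolding islimpt_approachable dist_real_def
    by (auto intro!: exI[of _ "\<delta>0 / 2"])
qed

lemma finite_roots_below: "finite {m. m < M \<and> char_fun 0 m = 0}"
proof (rule finite_subset)
  show "{m. m < M \<and> char_fun 0 m = 0} \<subseteq> {0..M} \<inter> {m. char_fun 0 m = 0}"
    using char_fun_root_pos[of 0] by fastforce
  show "finite ({0..M} \<inter> {m. char_fun 0 m = 0})"
    by (rule finite_not_islimpt_in_compact) (auto simp: roots_isolated)
qed

text \<open>
  Intervals around the finitely many roots for \<open>\<epsilon> = 0\<close> contribute their multiplicities; on the compact
  rest of \<open>[0, M]\<close> there are no roots for small \<open>\<epsilon>\<close>.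
\<close>

lemma global_count:
  assumes M: "char_fun 0 M \<noteq> 0"
  shows "\<forall>\<^sub>F \<epsilon> in at_right 0. finite {m. m < M \<and> char_fun \<epsilon> m = 0} \<and>
    card {m. m < M \<and> char_fun \<epsilon> m = 0} = (\<Sum>m | m < M \<and> char_fun 0 m = 0. root_mult m)"
proof -
  define Z where "Z = {m. m < M \<and> char_fun 0 m = 0}"
  have "finite Z"
    unfolding Z_def by (rule finite_roots_below)
  obtain \<delta>0 where \<delta>0: "\<And>z. 0 < \<delta>0 z"
    and radius: "\<And>z \<delta>. 0 < \<delta> \<Longrightarrow> \<delta> < \<delta>0 z \<Longrightarrow> counting_radius z \<delta>"
    using local_count by metis
  have isolated: "char_fun 0 m \<noteq> 0" if "0 < \<delta>" "\<delta> < \<delta>0 z" "m \<noteq> z" "\<bar>m - z\<bar> \<le> \<delta>" for z \<delta> m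
    using radius[OF that(1,2)] that(3,4) unfolding counting_radius_def by blast
  have count: "\<forall>\<^sub>F \<epsilon> in at_right 0. finite {m. \<bar>m - z\<bar> < \<delta> \<and> char_fun \<epsilon> m = 0} \<and>
      card {m. \<bar>m - z\<bar> < \<delta> \<and> char_fun \<epsilon> m = 0} = root_mult z" if "0 < \<delta>" "\<delta> < \<delta>0 z" for z \<delta>
    using radius[OF that] unfolding counting_radius_def by blast
  have "\<forall>\<^sub>F \<delta> in at_right 0. \<forall>z\<in>Z. \<delta> < min (\<delta>0 z / 2) (M - z)"
    using \<delta>0 by (intro eventually_ball_finite \<open>finite Z\<close> ballI order_tendstoD(2)[OF tendsto_ident_at])
      (auto simp: Z_def)
  moreover have "\<forall>\<^sub>F \<delta> in at_right 0. (0::real) < \<delta>"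
    by (rule eventually_at_right_less)
  ultimately have "\<forall>\<^sub>F \<delta> in at_right 0. (0::real) < \<delta> \<and> (\<forall>z\<in>Z. \<delta> < min (\<delta>0 z / 2) (M - z))"
    by eventually_elim blast
  then obtain \<delta> where "0 < \<delta>" and \<delta>: "\<And>z. z \<in> Z \<Longrightarrow> \<delta> < min (\<delta>0 z / 2) (M - z)"
    using eventually_happens'[OF trivial_limit_at_right_real] by blast
  have \<delta>_less: "\<delta> < \<delta>0 z" if "z \<in> Z" for z
    using \<delta>[OF that] \<delta>0[of z] by simp
  \<comment> \<open>the compact set \<open>K\<close> contains no root for \<open>\<epsilon> = 0\<close>\<close>
  define K where "K = {0..M} - (\<Union>z\<in>Z. ball z \<delta>)"
  have "compact K"
    unfolding K_def by (intro compact_diff compact_Icc open_UN ballI open_ball)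
  moreover have "char_fun 0 m \<noteq> 0" if "m \<in> K" for m
  proof
    assume "char_fun 0 m = 0"
    moreover have "m \<noteq> M"
      using M calculation by blast
    ultimately have "m \<in> Z"
      using that by (auto simp: Z_def K_def)
    then show False
      using that \<open>0 < \<delta>\<close> by (auto simp: K_def)
  qed
  ultimately have "\<forall>\<^sub>F \<epsilon> in at_right 0. \<forall>m\<in>K. char_fun \<epsilon> m \<noteq> 0"
    by (rule no_roots_on_compact)
  moreover have "\<forall>\<^sub>F \<epsilon> in at_right 0. \<forall>z\<in>Z. finite {m. \<bar>m - z\<bar> < \<delta> \<and> char_fun \<epsilon> m = 0} \<and>
        card {m. \<bar>m - z\<bar> < \<delta> \<and> char_fun \<epsilon> m = 0} = root_mult z"
    by (intro eventually_ball_finite \<open>finite Z\<close> ballI count \<open>0 < \<delta>\<close> \<delta>_less)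
  moreover have "\<forall>\<^sub>F \<epsilon> in at_right 0. (0::real) < \<epsilon>"
    by (rule eventually_at_right_less)
  ultimately show ?thesis
    unfolding Z_def[symmetric]
  proof eventually_elim
    case (elim \<epsilon>)
    define R where "R z = {m. \<bar>m - z\<bar> < \<delta> \<and> char_fun \<epsilon> m = 0}" for z
    have eq: "{m. m < M \<and> char_fun \<epsilon> m = 0} = (\<Union>z\<in>Z. R z)"
    proof (intro equalityI subsetI)
      fix m assume m: "m \<in> {m. m < M \<and> char_fun \<epsilon> m = 0}"
      then have "m \<in> {0..M}" "m \<notin> K"
        using char_fun_root_pos[of \<epsilon> m] elim by auto
      then obtain z where "z \<in> Z" "dist z m < \<delta>"
        by (auto simp: K_def)
      then show "m \<in> (\<Union>z\<in>Z. R z)"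
        using m by (auto simp: R_def dist_real_def abs_minus_commute)
    next
      fix m assume "m \<in> (\<Union>z\<in>Z. R z)"
      then obtain z where "z \<in> Z" "\<bar>m - z\<bar> < \<delta>" "char_fun \<epsilon> m = 0"
        by (auto simp: R_def)
      then show "m \<in> {m. m < M \<and> char_fun \<epsilon> m = 0}"
        using \<delta>[of z] by auto
    qed
    have disjoint: "R z \<inter> R z' = {}" if "z \<in> Z" "z' \<in> Z" "z \<noteq> z'" for z z'
    proof (rule ccontr)
      assume "R z \<inter> R z' \<noteq> {}"
      then obtain m where "\<bar>m - z\<bar> < \<delta>" "\<bar>m - z'\<bar> < \<delta>"
        by (auto simp: R_def)
      then have "\<bar>z' - z\<bar> \<le> 2 * \<delta>"
        by linarith
      then have "char_fun 0 z' \<noteq> 0"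
        using isolated[of "2 * \<delta>" z z'] \<open>0 < \<delta>\<close> \<delta>[OF that(1)] that(3) by auto
      then show False
        using that(2) by (simp add: Z_def)
    qed
    have R: "finite (R z)" "card (R z) = root_mult z" if "z \<in> Z" for z
      using elim(2) that unfolding R_def by blast+
    have "card (\<Union>z\<in>Z. R z) = (\<Sum>z\<in>Z. card (R z))"
      by (rule card_UN_disjoint) (use \<open>finite Z\<close> R(1) disjoint in blast)+
    also have "\<dots> = (\<Sum>z\<in>Z. root_mult z)"
      by (rule sum.cong) (use R(2) in auto)
    finally show ?case
      unfolding eq using \<open>finite Z\<close> R(1) by blast
  qed
qed

text \<open>
  Both sequences are increasing, so equal numbers of terms below \<open>M\<close> mean that the \<open>j\<close>-th terms lie on
  the same side of \<open>M\<close>.  Levels \<open>M\<close> that are no roots exist arbitrarily close to \<open>mu j\<close>.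
\<close>

lemma enumerated_roots_converge:
  fixes l :: "real \<Rightarrow> nat \<Rightarrow> real" and mu :: "nat \<Rightarrow> real"
  assumes l: "\<And>\<epsilon>. 0 < \<epsilon> \<Longrightarrow> strict_mono (l \<epsilon>)" "\<And>\<epsilon>. 0 < \<epsilon> \<Longrightarrow> range (l \<epsilon>) = {m. char_fun \<epsilon> m = 0}"
    and mu: "mono mu" "range mu = {m. char_fun 0 m = 0}"
      "\<And>j. finite {i. mu i = mu j}" "\<And>j. card {i. mu i = mu j} = root_mult (mu j)"
  shows "((\<lambda>\<epsilon>. l \<epsilon> j) \<longlongrightarrow> mu j) (at_right 0)"
proof -
  have mu_root: "char_fun 0 (mu i) = 0" for i
    using rangeI[of mu i] unfolding mu(2) by simp
  have l_root: "char_fun \<epsilon> (l \<epsilon> i) = 0" if "0 < \<epsilon>" for \<epsilon> i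
    using rangeI[of "l \<epsilon>" i] unfolding l(2)[OF that] by simp
  have count_mu: "finite {i. mu i < M}"
    "card {i. mu i < M} = (\<Sum>m | m < M \<and> char_fun 0 m = 0. root_mult m)" for M
  proof -
    define Z where "Z = {m. m < M \<and> char_fun 0 m = 0}"
    have eq: "{i. mu i < M} = (\<Union>z\<in>Z. {i. mu i = z})"
      using mu_root by (auto simp: Z_def)
    have Z: "finite {i. mu i = z}" "card {i. mu i = z} = root_mult z" if z: "z \<in> Z" for z
    proof -
      have "z \<in> range mu"
        using z unfolding mu(2) Z_def by blast
      then obtain j where "z = mu j"
        by blast
      then show "finite {i. mu i = z}" "card {i. mu i = z} = root_mult z"
        using mu(3,4) by auto
    qed
    have "finite Z"
      unfolding Z_def by (rule finite_roots_below)
    then show "finite {i. mu i < M}"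
      unfolding eq using Z by blast
    have "card (\<Union>z\<in>Z. {i. mu i = z}) = (\<Sum>z\<in>Z. card {i. mu i = z})"
      using \<open>finite Z\<close> Z by (intro card_UN_disjoint) auto
    then show "card {i. mu i < M} = (\<Sum>m | m < M \<and> char_fun 0 m = 0. root_mult m)"
      unfolding eq Z_def[symmetric] using Z by simp
  qed
  have same_count: "\<forall>\<^sub>F \<epsilon> in at_right 0. 0 < \<epsilon> \<and> finite {i. l \<epsilon> i < M} \<and> card {i. l \<epsilon> i < M} = card {i. mu i < M}"
    if "char_fun 0 M \<noteq> 0" for M
    using global_count[OF that] eventually_at_right_less[of 0]
  proof eventually_elim
    case (elim \<epsilon>)
    have image: "l \<epsilon> ` {i. l \<epsilon> i < M} = {m. m < M \<and> char_fun \<epsilon> m = 0}"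
    proof (intro equalityI subsetI)
      fix m assume m: "m \<in> {m. m < M \<and> char_fun \<epsilon> m = 0}"
      then have "m \<in> range (l \<epsilon>)"
        unfolding l(2)[OF elim(2)] by blast
      then show "m \<in> l \<epsilon> ` {i. l \<epsilon> i < M}"
        using m by blast
    qed (use l_root elim(2) in blast)
    have inj: "inj_on (l \<epsilon>) {i. l \<epsilon> i < M}"
      using l(1)[OF elim(2)] by (meson inj_onI strict_mono_eq)
    have "finite {i. l \<epsilon> i < M}"
      by (rule finite_imageD[OF _ inj]) (simp only: image elim(1))
    moreover have "card {i. l \<epsilon> i < M} = card {i. mu i < M}"
      using card_image[OF inj] elim(1) unfolding image count_mu(2) by simp
    ultimately show ?case
      using elim(2) by blast
  qed
  have dense: "\<exists>M. x < M \<and> M < y \<and> char_fun 0 M \<noteq> 0" if "x < y" for x y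
  proof (rule ccontr)
    assume "\<nexists>M. x < M \<and> M < y \<and> char_fun 0 M \<noteq> 0"
    then have "{x<..<y} \<subseteq> {m. m < y \<and> char_fun 0 m = 0}"
      by auto
    then have "finite {x<..<y}"
      using finite_roots_below finite_subset by blast
    then show False
      using that infinite_Ioo by blast
  qed
  show ?thesis
  proof (rule order_tendstoI)
    fix y assume "y < mu j"
    then obtain M where M: "y < M" "M < mu j" "char_fun 0 M \<noteq> 0"
      using dense by blast
    show "\<forall>\<^sub>F \<epsilon> in at_right 0. y < l \<epsilon> j"
      using same_count[OF M(3)]
    proof eventually_elim
      case (elim \<epsilon>)
      show ?case
      proof (rule ccontr)
        assume "\<not> y < l \<epsilon> j"
        have "l \<epsilon> i \<le> l \<epsilon> j" if "i \<le> j" for i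
          using l(1)[of \<epsilon>] elim that by (simp add: strict_mono_less_eq)
        then have "{..j} \<subseteq> {i. l \<epsilon> i < M}"
          using M(1) \<open>\<not> y < l \<epsilon> j\<close> by force
        then have "card {..j} \<le> card {i. l \<epsilon> i < M}"
          using elim by (intro card_mono) auto
        moreover have "i < j" if "mu i < M" for i
          using that M(2) monoD[OF mu(1), of j i] by (cases "i < j") auto
        then have "{i. mu i < M} \<subseteq> {..<j}"
          by auto
        then have "card {i. mu i < M} \<le> card {..<j}"
          by (intro card_mono) auto
        ultimately show False
          using elim by simp
      qed
    qed
  next
    fix y assume "mu j < y"
    then obtain M where M: "mu j < M" "M < y" "char_fun 0 M \<noteq> 0"
      using dense by blast
    show "\<forall>\<^sub>F \<epsilon> in at_right 0. l \<epsilon> j < y"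
      using same_count[OF M(3)]
    proof eventually_elim
      case (elim \<epsilon>)
      show ?case
      proof (rule ccontr)
        assume "\<not> l \<epsilon> j < y"
        then have "i < j" if "l \<epsilon> i < M" for i
          using that M(2) elim strict_mono_less[OF l(1)[of \<epsilon>], of i j] by auto
        then have "{i. l \<epsilon> i < M} \<subseteq> {..<j}"
          by auto
        then have "card {i. l \<epsilon> i < M} \<le> card {..<j}"
          by (intro card_mono) auto
        moreover have "{..j} \<subseteq> {i. mu i < M}"
          using M(1) monoD[OF mu(1)] by (auto intro: le_less_trans)
        then have "card {..j} \<le> card {i. mu i < M}"
          by (intro card_mono count_mu(1))
        ultimately show False
          using elim by simp
      qed
    qed
  qed
qed

end

section \<open>Weak derivatives in one dimension\<close>

lemma L2_on_imp_integrable: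
  assumes "L2_on c d (\<lambda>_. 1) v"
  shows "v integrable_on {c..d}"
proof -
  have "v absolutely_integrable_on {c..d}"
  proof (rule measurable_bounded_by_integrable_imp_absolutely_integrable)
    show "v \<in> borel_measurable (lebesgue_on {c..d})"
      using assms by (simp add: L2_on_def)
    show "(\<lambda>x. 1 + (cmod (v x))\<^sup>2) integrable_on {c..d}"
      using assms by (intro integrable_add integrable_const_ivl) (simp add: L2_on_def)
    show "cmod (v x) \<le> 1 + (cmod (v x))\<^sup>2" for x
    proof -
      have "2 * cmod (v x) \<le> 1 + (cmod (v x))\<^sup>2"
        using zero_le_power2[of "cmod (v x) - 1"] by (simp add: power2_diff)
      then show ?thesis
        using norm_ge_zero[of "v x"] by linarith
    qed
  qed auto
  then show ?thesis
    by (rule set_lebesgue_integral_eq_integral(1))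
qed

lemma has_weak_derivD:
  assumes "has_weak_deriv c d u v"
  shows "L2_on c d (\<lambda>_. 1) v" and "x \<in> {c..d} \<Longrightarrow> u x = u c + integral {c..x} v"
  using assms unfolding has_weak_deriv_def by blast+

text \<open>
  The difference \<open>g\<close> of two weak derivatives integrates to 0 over every subinterval, and almost every
  point is a limit of averages of \<open>g\<close>.
\<close>

lemma weak_deriv_ae_unique:
  assumes v: "has_weak_deriv c d u v" and w: "has_weak_deriv c d u w"
  obtains N where "negligible N" "\<And>x. x \<in> {c..d} \<Longrightarrow> x \<notin> N \<Longrightarrow> v x = w x"
proof -
  define g where "g x = v x - w x" for x
  \<comment> \<open>extended by zero, so that averages over intervals that leave \<open>[c, d]\<close> make sense\<close>
  define f where "f x = (if x \<in> {c..d} then g x else 0)" for x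
  have vw_int: "v integrable_on {c..d}" "w integrable_on {c..d}"
    using L2_on_imp_integrable[OF has_weak_derivD(1)] v w by blast+
  then have g_int: "g integrable_on {p..q}" if "{p..q} \<subseteq> {c..d}" for p q
    unfolding g_def using that by (intro integrable_diff) (auto intro: integrable_subinterval_real)
  have zero_from_c: "integral {c..x} g = 0" if "x \<in> {c..d}" for x
  proof -
    have "integral {c..x} v = integral {c..x} w"
    proof -
      have "u x = u c + integral {c..x} v" "u x = u c + integral {c..x} w"
        using has_weak_derivD(2)[OF v that] has_weak_derivD(2)[OF w that] .
      then show ?thesis
        by simp
    qed
    moreover have "integral {c..x} g = integral {c..x} v - integral {c..x} w"
      unfolding g_def using that
      by (intro integral_diff integrable_subinterval_real[OF vw_int(1)]
          integrable_subinterval_real[OF vw_int(2)]) auto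
    ultimately show ?thesis
      by simp
  qed
  have zero: "integral {p..q} g = 0" if "c \<le> p" "p \<le> q" "q \<le> d" for p q
    using Henstock_Kurzweil_Integration.integral_combine[of c p q g] zero_from_c[of p] zero_from_c[of q]
      g_int[of c q] that by auto
  have f_box: "f integrable_on cbox p q \<and> integral (cbox p q) f = 0" for p q :: real
  proof -
    have "{c..d} \<inter> cbox p q = {max c p..min d q}"
      by auto
    moreover have "g integrable_on {max c p..min d q}"
      by (rule g_int) auto
    moreover have "integral {max c p..min d q} g = 0"
      using zero[of "max c p" "min d q"] by (cases "max c p \<le> min d q") auto
    ultimately show ?thesis
      unfolding f_def Henstock_Kurzweil_Integration.integral_restrict_Int integrable_restrict_Int
      by simp
  qed
  obtain N where "negligible N" and N: "\<And>x e. x \<notin> N \<Longrightarrow> 0 < e \<Longrightarrow>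
      \<exists>d>0. \<forall>h. 0 < h \<and> h < d \<longrightarrow>
        norm (integral (cbox x (x + h *\<^sub>R One)) f /\<^sub>R h ^ DIM(real) - f x) < e"
    using integrable_ccontinuous_explicit[of f] f_box by blast
  have "f x = 0" if x: "x \<notin> N" for x
  proof (rule ccontr)
    assume "f x \<noteq> 0"
    then obtain d :: real where "0 < d" and d: "\<forall>h. 0 < h \<and> h < d \<longrightarrow>
        norm (integral (cbox x (x + h *\<^sub>R One)) f /\<^sub>R h ^ DIM(real) - f x) < norm (f x)"
      using N[OF x, of "norm (f x)"] by (meson zero_less_norm_iff)
    have "norm (integral (cbox x (x + (d / 2) *\<^sub>R One)) f /\<^sub>R (d / 2) ^ DIM(real) - f x) < norm (f x)"
      using d[rule_format, of "d / 2"] \<open>0 < d\<close> by simp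
    moreover have "integral (cbox x (x + (d / 2) *\<^sub>R One)) f = 0"
      using f_box by blast
    ultimately show False
      by simp
  qed
  then have "v x = w x" if "x \<in> {c..d}" "x \<notin> N" for x
  proof -
    have "f x = 0"
      using \<open>\<And>x. x \<notin> N \<Longrightarrow> f x = 0\<close> that(2) .
    then show ?thesis
      using that(1) by (simp add: f_def g_def)
  qed
  with \<open>negligible N\<close> show ?thesis
    using that by blast
qed

lemma H1_norm_eq:
  assumes v: "has_weak_deriv c d u v"
  shows "H1_norm c d u = sqrt (integral {c..d} (\<lambda>x. (cmod (u x))\<^sup>2) +
     integral {c..d} (\<lambda>x. (cmod (v x))\<^sup>2))"
proof -
  obtain N where "negligible N"
    "\<And>x. x \<in> {c..d} \<Longrightarrow> x \<notin> N \<Longrightarrow> (SOME v. has_weak_deriv c d u v) x = v x"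
    using weak_deriv_ae_unique[OF someI[of "has_weak_deriv c d u", OF v] v] by blast
  then have "integral {c..d} (\<lambda>x. (cmod (v x))\<^sup>2) =
      integral {c..d} (\<lambda>x. (cmod ((SOME v. has_weak_deriv c d u v) x))\<^sup>2)"
    by (intro integral_spike[of N]) auto
  then show ?thesis
    by (simp add: H1_norm_def)
qed

lemma integral_nonneg_or_undefined:
  fixes f :: "real \<Rightarrow> real"
  assumes "\<And>x. x \<in> S \<Longrightarrow> 0 \<le> f x"
  shows "0 \<le> integral S f"
proof (cases "f integrable_on S")
  case True
  then show ?thesis
    using assms by (rule Henstock_Kurzweil_Integration.integral_nonneg)
qed (simp add: not_integrable_integral)

lemma H1_norm_nonneg: "0 \<le> H1_norm c d u"
  unfolding H1_norm_def
  by (intro real_sqrt_ge_zero add_nonneg_nonneg integral_nonneg_or_undefined) simp_all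

text \<open>
  A pointwise bound on \<open>u\<close> and on one weak derivative suffices, whichever weak derivative the norm
  chooses.
\<close>

lemma H1_norm_le:
  assumes v: "has_weak_deriv c d u v" and "c \<le> d"
    and bound: "\<And>x. x \<in> {c..d} \<Longrightarrow> cmod (u x) \<le> \<eta>" "\<And>x. x \<in> {c..d} \<Longrightarrow> cmod (v x) \<le> \<eta>"
  shows "H1_norm c d u \<le> sqrt (2 * (d - c)) * \<eta>"
proof -
  have "0 \<le> \<eta>"
    using bound(1)[of c] \<open>c \<le> d\<close> by (meson atLeastAtMost_iff norm_ge_zero order.trans order_refl)
  have le: "integral {c..d} (\<lambda>x. (cmod (f x))\<^sup>2) \<le> (d - c) * \<eta>\<^sup>2"
    if "\<And>x. x \<in> {c..d} \<Longrightarrow> cmod (f x) \<le> \<eta>" for f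
  proof (cases "(\<lambda>x. (cmod (f x))\<^sup>2) integrable_on {c..d}")
    case True
    have "integral {c..d} (\<lambda>x. (cmod (f x))\<^sup>2) \<le> integral {c..d} (\<lambda>x. \<eta>\<^sup>2)"
      using True that by (intro integral_le) (auto intro: power_mono)
    then show ?thesis
      using \<open>c \<le> d\<close> by simp
  next
    case False
    then show ?thesis
      using \<open>c \<le> d\<close> by (simp add: not_integrable_integral)
  qed
  have "H1_norm c d u \<le> sqrt ((d - c) * \<eta>\<^sup>2 + (d - c) * \<eta>\<^sup>2)"
    unfolding H1_norm_eq[OF v] by (intro real_sqrt_le_mono add_mono le bound)
  also have "\<dots> = sqrt (2 * (d - c) * \<eta>\<^sup>2)"
    by (simp add: algebra_simps)
  also have "\<dots> = sqrt (2 * (d - c)) * \<eta>"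
    using \<open>0 \<le> \<eta>\<close> by (simp add: real_sqrt_mult)
  finally show ?thesis .
qed

lemma L2_on_continuous:
  assumes "continuous_on {c..d} w" "continuous_on {c..d} f"
  shows "L2_on c d w f"
  unfolding L2_on_def
proof
  show "f \<in> borel_measurable (lebesgue_on {c..d})"
    by (rule continuous_imp_measurable_on_sets_lebesgue) (use assms in auto)
  show "(\<lambda>x. w x * (cmod (f x))\<^sup>2) integrable_on {c..d}"
    by (intro integrable_continuous_interval continuous_intros assms)
qed

lemma has_weak_deriv_C1:
  assumes f: "\<And>x. x \<in> {c..d} \<Longrightarrow> (f has_vector_derivative v x) (at x within {c..d})"
    and v: "continuous_on {c..d} v"
  shows "has_weak_deriv c d f v"
  unfolding has_weak_deriv_def
proof (intro conjI ballI)
  show "L2_on c d (\<lambda>_. 1) v"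
    by (intro L2_on_continuous v continuous_intros)
  fix x assume x: "x \<in> {c..d}"
  have "(v has_integral f x - f c) {c..x}"
  proof (rule fundamental_theorem_of_calculus)
    show "(f has_vector_derivative v y) (at y within {c..x})" if "y \<in> {c..x}" for y
      using f[of y] x that by (auto intro: has_vector_derivative_within_subset)
  qed (use x in auto)
  then show "f x = f c + integral {c..x} v"
    by (simp add: integral_unique)
qed

lemma has_weak_deriv_continuous:
  assumes "has_weak_deriv c d f v"
  shows "continuous_on {c..d} f"
proof -
  have "continuous_on {c..d} (\<lambda>x. f c + integral {c..x} v)"
    by (intro continuous_intros indefinite_integral_continuous_1 L2_on_imp_integrable
        has_weak_derivD(1)[OF assms])
  then show ?thesis
    by (rule continuous_on_eq) (rule has_weak_derivD(2)[OF assms, symmetric])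
qed

lemma has_weak_deriv_imp_C1:
  assumes f: "has_weak_deriv c d f v" and v: "continuous_on {c..d} v" and x: "x \<in> {c..d}"
  shows "(f has_vector_derivative v x) (at x within {c..d})"
proof (rule has_vector_derivative_transform[OF x])
  show "f y = f c + integral {c..y} v" if "y \<in> {c..d}" for y
    by (rule has_weak_derivD(2)[OF f that])
  show "((\<lambda>y. f c + integral {c..y} v) has_vector_derivative v x) (at x within {c..d})"
    using integral_has_vector_derivative[OF v x]
    by (auto intro!: derivative_eq_intros)
qed

text \<open>
  The two formulas agree at 0 because \<open>f\<close> has a single value there.  The choice of the derivative at
  the point 0 itself is immaterial.
\<close>

lemma has_weak_deriv_glue:
  assumes "a \<le> 0" "0 \<le> b" and f1: "has_weak_deriv a 0 f v1" and f2: "has_weak_deriv 0 b f v2"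
  shows "has_weak_deriv a b f (\<lambda>x. if x < 0 then v1 x else v2 x)"
proof -
  define v where "v = (\<lambda>x. if x < 0 then v1 x else v2 x)"
  have v1: "v1 \<in> borel_measurable (lebesgue_on {a..0})" and v2: "v2 \<in> borel_measurable (lebesgue_on {0..b})"
    and sq1: "(\<lambda>x. (cmod (v1 x))\<^sup>2) integrable_on {a..0}"
    and sq2: "(\<lambda>x. (cmod (v2 x))\<^sup>2) integrable_on {0..b}"
    using has_weak_derivD(1)[OF f1] has_weak_derivD(1)[OF f2] by (simp_all add: L2_on_def)
  have "v1 \<in> borel_measurable (lebesgue_on {a..<0})"
    by (rule measurable_restrict_mono[OF v1]) auto
  then have "(\<lambda>x. (if x \<in> {a..<0} then v1 x else 0) + (if x \<in> {0..b} then v2 x else 0)) \<in> borel_measurable lebesgue"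
    using v2 by (intro borel_measurable_add borel_measurable_if_I) auto
  also have "(\<lambda>x. (if x \<in> {a..<0} then v1 x else 0) + (if x \<in> {0..b} then v2 x else 0)) =
      (\<lambda>x. if x \<in> {a..b} then v x else 0)"
    using assms(1,2) by (auto simp: v_def fun_eq_iff)
  finally have meas: "v \<in> borel_measurable (lebesgue_on {a..b})"
    by (rule borel_measurable_if_D)
  have "(\<lambda>x. (cmod (v x))\<^sup>2) integrable_on {a..0}"
    by (rule integrable_spike_finite[OF _ _ sq1, of "{0}"]) (auto simp: v_def)
  moreover have "(\<lambda>x. (cmod (v x))\<^sup>2) integrable_on {0..b}"
    by (rule integrable_eq[OF sq2]) (auto simp: v_def)
  ultimately have sq: "(\<lambda>x. (cmod (v x))\<^sup>2) integrable_on {a..b}"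
    using Henstock_Kurzweil_Integration.integrable_combine[of a 0 b] assms(1,2) by blast
  have v_int: "v integrable_on {a..b}"
    using meas sq by (intro L2_on_imp_integrable) (simp add: L2_on_def)
  have left: "integral {a..x} v = integral {a..x} v1" if "x \<le> 0" for x
    by (rule integral_spike[of "{0}"]) (use that in \<open>auto simp: v_def\<close>)
  have right: "integral {0..x} v = integral {0..x} v2" for x
    by (rule integral_cong) (auto simp: v_def)
  have "f x = f a + integral {a..x} v" if x: "x \<in> {a..b}" for x
  proof (cases "x \<le> 0")
    case True
    then show ?thesis
      using has_weak_derivD(2)[OF f1, of x] x left[of x] by simp
  next
    case False
    have "f x = f 0 + integral {0..x} v2"
      using has_weak_derivD(2)[OF f2, of x] x False by simp
    moreover have "f 0 = f a + integral {a..0} v1"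
      using has_weak_derivD(2)[OF f1, of 0] assms(1) by simp
    moreover have "integral {a..0} v + integral {0..x} v = integral {a..x} v"
      using False assms(1) x
      by (intro Henstock_Kurzweil_Integration.integral_combine integrable_subinterval_real[OF v_int]) auto
    ultimately show ?thesis
      by (simp add: left right)
  qed
  moreover have "L2_on a b (\<lambda>_. 1) v"
    using meas sq by (simp add: L2_on_def)
  ultimately show ?thesis
    unfolding has_weak_deriv_def v_def[symmetric] by blast
qed

section \<open>The perturbed problem and its characteristic function\<close>

locale string_pair =
  left: string a 0 k r a + right: string 0 b \<kappa> \<rho> b
  for a b :: real and k r \<kappa> \<rho> :: "real \<Rightarrow> real"
begin

lemma a_neg: "a < 0" and b_pos: "0 < b"
  by (rule left.c_less_d, rule right.c_less_d)

sublocale rotating_pairs "\<lambda>m. left.phi m 0" "\<lambda>m. left.flux m 0" "\<lambda>m. right.phi m 0" "\<lambda>m. right.flux m 0"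
proof
  show "isCont (\<lambda>m. left.phi m 0) m" "isCont (\<lambda>m. left.flux m 0) m"
    "isCont (\<lambda>m. right.phi m 0) m" "isCont (\<lambda>m. right.flux m 0) m" for m
    using a_neg b_pos
    by (auto intro!: left.phi_continuous_parameter right.phi_continuous_parameter)
  show "0 < left.phi m 0 * left.flux m 0" "right.phi m 0 * right.flux m 0 < 0" if "m \<le> 0" for m
    using left.energy_pos[OF that] right.energy_pos[OF that]
    by (simp_all add: left.phi_e right.phi_e)
  fix m0
  obtain \<delta> where "0 < \<delta>" and \<delta>: "\<And>n1 n2. \<bar>n1 - m0\<bar> < \<delta> \<Longrightarrow> \<bar>n2 - m0\<bar> < \<delta> \<Longrightarrow>
      0 < integral {a..0} (\<lambda>x. r x * left.phi n1 x * left.phi n2 x)"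
    using left.gram_pos_near[of m0] by blast
  have "left.phi m1 0 * left.flux m2 0 - left.flux m1 0 * left.phi m2 0 < 0"
    if "\<bar>m1 - m0\<bar> < \<delta>" "\<bar>m2 - m0\<bar> < \<delta>" "m1 < m2" for m1 m2
  proof -
    have "0 < (left.flux m1 0 * left.phi m2 0 - left.phi m1 0 * left.flux m2 0) / (m2 - m1)"
      using \<delta>[OF that(1,2)] integral_unique[OF left.lagrange_identity_parameters[of m1 m2]] that(3)
      by (simp add: left.phi_e)
    then show ?thesis
      using that(3) by (simp add: zero_less_divide_iff)
  qed
  with \<open>0 < \<delta>\<close> show "\<exists>\<delta>>0. \<forall>m1 m2. \<bar>m1 - m0\<bar> < \<delta> \<longrightarrow> \<bar>m2 - m0\<bar> < \<delta> \<longrightarrow> m1 < m2 \<longrightarrow>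
      left.phi m1 0 * left.flux m2 0 - left.flux m1 0 * left.phi m2 0 < 0"
    by blast
  obtain \<delta>' where "0 < \<delta>'" and \<delta>': "\<And>n1 n2. \<bar>n1 - m0\<bar> < \<delta>' \<Longrightarrow> \<bar>n2 - m0\<bar> < \<delta>' \<Longrightarrow>
      0 < integral {0..b} (\<lambda>x. \<rho> x * right.phi n1 x * right.phi n2 x)"
    using right.gram_pos_near[of m0] by blast
  have "right.flux m1 0 * right.phi m2 0 - right.phi m1 0 * right.flux m2 0 < 0"
    if "\<bar>m1 - m0\<bar> < \<delta>'" "\<bar>m2 - m0\<bar> < \<delta>'" "m1 < m2" for m1 m2
  proof -
    have "0 < (right.phi m1 0 * right.flux m2 0 - right.flux m1 0 * right.phi m2 0) / (m2 - m1)"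
      using \<delta>'[OF that(1,2)] integral_unique[OF right.lagrange_identity_parameters[of m1 m2]] that(3)
      by (simp add: right.phi_e)
    then show ?thesis
      using that(3) by (simp add: zero_less_divide_iff)
  qed
  with \<open>0 < \<delta>'\<close> show "\<exists>\<delta>>0. \<forall>m1 m2. \<bar>m1 - m0\<bar> < \<delta> \<longrightarrow> \<bar>m2 - m0\<bar> < \<delta> \<longrightarrow> m1 < m2 \<longrightarrow>
      right.flux m1 0 * right.phi m2 0 - right.phi m1 0 * right.flux m2 0 < 0"
    by blast
qed

text \<open>
  With \<open>\<lambda> = \<epsilon> m\<close> the powers of \<open>\<epsilon>\<close> cancel from both equations.
\<close>

lemma perturbed_solution_iff:
  fixes u :: "real \<Rightarrow> complex"
  assumes "0 < \<epsilon>"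
  shows "perturbed_solution a b k r \<kappa> \<rho> \<epsilon> (of_real (\<epsilon> * m)) u \<longleftrightarrow>
    (\<exists>P Q. left.sol m (\<lambda>_. 0) u P \<and> right.sol m (\<lambda>_. 0) u Q \<and> P 0 = of_real \<epsilon> * Q 0 \<and> u a = 0 \<and> u b = 0)"
    (is "?lhs \<longleftrightarrow> ?rhs")
proof
  assume ?lhs
  then obtain p q p' q' where
    L: "\<And>x. x \<in> {a..0} \<Longrightarrow> (u has_vector_derivative p x) (at x within {a..0})"
      "\<And>x. x \<in> {a..0} \<Longrightarrow> ((\<lambda>x. of_real (k x) * p x) has_vector_derivative p' x) (at x within {a..0})"
      "\<And>x. x \<in> {a..0} \<Longrightarrow> p' x + of_real (inverse \<epsilon>) * of_real (\<epsilon> * m) * of_real (r x) * u x = 0"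
    and R: "\<And>x. x \<in> {0..b} \<Longrightarrow> (u has_vector_derivative q x) (at x within {0..b})"
      "\<And>x. x \<in> {0..b} \<Longrightarrow> ((\<lambda>x. of_real (\<kappa> x) * q x) has_vector_derivative q' x) (at x within {0..b})"
      "\<And>x. x \<in> {0..b} \<Longrightarrow> of_real \<epsilon> * q' x + of_real (\<epsilon> * m) * of_real (\<rho> x) * u x = 0"
    and bc: "of_real (k 0) * p 0 = of_real \<epsilon> * (of_real (\<kappa> 0) * q 0)" "u a = 0" "u b = 0"
    unfolding perturbed_solution_def by blast
  have p': "p' x = - of_real (r x) * (of_real m * u x + 0)" if "x \<in> {a..0}" for x
    using L(3)[OF that] assms by (simp add: add_eq_0_iff2 mult.assoc mult.left_commute)
  have q': "q' x = - of_real (\<rho> x) * (of_real m * u x + 0)" if "x \<in> {0..b}" for x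
  proof -
    have "of_real \<epsilon> * q' x = of_real \<epsilon> * (- of_real (\<rho> x) * (of_real m * u x + 0))"
      using R(3)[OF that] by (simp add: add_eq_0_iff2 mult.assoc mult.left_commute)
    then show ?thesis
      using assms by (simp only: mult_cancel_left) simp
  qed
  have "left.sol m (\<lambda>_. 0) u (\<lambda>x. of_real (k x) * p x)"
    by (rule left.classical_imp_sol; (erule L(1) | erule L(2) | erule p'))
  moreover have "right.sol m (\<lambda>_. 0) u (\<lambda>x. of_real (\<kappa> x) * q x)"
    by (rule right.classical_imp_sol; (erule R(1) | erule R(2) | erule q'))
  ultimately show ?rhs
    using bc by blast
next
  assume ?rhs
  then obtain P Q where P: "left.sol m (\<lambda>_. 0) u P" and Q: "right.sol m (\<lambda>_. 0) u Q"
    and bc: "P 0 = of_real \<epsilon> * Q 0" "u a = 0" "u b = 0"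
    by blast
  note L = left.sol_imp_classical[OF P] and R = right.sol_imp_classical[OF Q]
  show ?lhs
    unfolding perturbed_solution_def
  proof (rule exI[of _ "\<lambda>x. inverse (k x) *\<^sub>R P x"], rule exI[of _ "\<lambda>x. inverse (\<kappa> x) *\<^sub>R Q x"],
      rule exI[of _ "\<lambda>x. - of_real (r x) * (of_real m * u x + 0)"],
      rule exI[of _ "\<lambda>x. - of_real (\<rho> x) * (of_real m * u x + 0)"], intro conjI ballI)
    show "- of_real (r x) * (of_real m * u x + 0) + of_real (inverse \<epsilon>) * of_real (\<epsilon> * m) * of_real (r x) * u x = 0"
      "of_real \<epsilon> * (- of_real (\<rho> x) * (of_real m * u x + 0)) + of_real (\<epsilon> * m) * of_real (\<rho> x) * u x = 0" for x
      using assms by simp_all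
    show "of_real (k 0) * (inverse (k 0) *\<^sub>R P 0) = of_real \<epsilon> * (of_real (\<kappa> 0) * (inverse (\<kappa> 0) *\<^sub>R Q 0))"
      using bc(1) L(3)[of 0] R(3)[of 0] a_neg b_pos by simp
  qed ((erule L R | rule bc)+)
qed

lemma perturbed_solution_form:
  fixes u :: "real \<Rightarrow> complex"
  assumes "0 < \<epsilon>" "perturbed_solution a b k r \<kappa> \<rho> \<epsilon> (of_real (\<epsilon> * m)) u"
  obtains c d where "\<And>x. x \<in> {a..0} \<Longrightarrow> u x = left.phi m x *\<^sub>R c" "\<And>x. x \<in> {0..b} \<Longrightarrow> u x = right.phi m x *\<^sub>R d"
    "left.flux m 0 *\<^sub>R c = (\<epsilon> * right.flux m 0) *\<^sub>R d" "left.phi m 0 *\<^sub>R c = right.phi m 0 *\<^sub>R d"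
proof -
  obtain P Q where P: "left.sol m (\<lambda>_. 0) u P" and Q: "right.sol m (\<lambda>_. 0) u Q"
    and bc: "P 0 = of_real \<epsilon> * Q 0" "u a = 0" "u b = 0"
    using assms perturbed_solution_iff by blast
  note L = left.solution_eq_multiple_of_phi[OF P bc(2)]
  note R = right.solution_eq_multiple_of_phi[OF Q bc(3)]
  show ?thesis
  proof (rule that[of "P a" "Q b"])
    show "left.phi m 0 *\<^sub>R P a = right.phi m 0 *\<^sub>R Q b"
      using L(1)[of 0] R(1)[of 0] a_neg b_pos by simp
    show "left.flux m 0 *\<^sub>R P a = (\<epsilon> * right.flux m 0) *\<^sub>R Q b"
      using L(2)[of 0] R(2)[of 0] bc(1) a_neg b_pos by (simp add: scaleR_conv_of_real mult.assoc)
  qed (rule L(1), assumption, rule R(1), assumption)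
qed

text \<open>
  The coefficients \<open>(c, d)\<close> solve a homogeneous \<open>2 \<times> 2\<close> system whose determinant is the characteristic
  function.
\<close>

lemma perturbed_eigenvalue_iff:
  assumes "0 < \<epsilon>"
  shows "of_real (\<epsilon> * m) \<in> perturbed_eigenvalues a b k r \<kappa> \<rho> \<epsilon> \<longleftrightarrow> char_fun \<epsilon> m = 0"
proof
  assume "of_real (\<epsilon> * m) \<in> perturbed_eigenvalues a b k r \<kappa> \<rho> \<epsilon>"
  then obtain u x where u: "perturbed_solution a b k r \<kappa> \<rho> \<epsilon> (of_real (\<epsilon> * m)) u"
    and x: "x \<in> {a..b}" "u x \<noteq> 0"
    unfolding perturbed_eigenvalues_def by blast
  obtain c d where c: "\<And>x. x \<in> {a..0} \<Longrightarrow> u x = left.phi m x *\<^sub>R c"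
    and d: "\<And>x. x \<in> {0..b} \<Longrightarrow> u x = right.phi m x *\<^sub>R d"
    and bc: "left.flux m 0 *\<^sub>R c = (\<epsilon> * right.flux m 0) *\<^sub>R d" "left.phi m 0 *\<^sub>R c = right.phi m 0 *\<^sub>R d"
    by (rule perturbed_solution_form[OF assms u]) (rule that)
  have "char_fun \<epsilon> m *\<^sub>R c = right.phi m 0 *\<^sub>R (left.flux m 0 *\<^sub>R c) - (\<epsilon> * right.flux m 0) *\<^sub>R (left.phi m 0 *\<^sub>R c)"
    by (simp add: char_fun_def algebra_simps)
  also have "\<dots> = 0"
    unfolding bc by (simp add: mult.commute)
  finally have c0: "char_fun \<epsilon> m = 0 \<or> c = 0"
    by simp
  have "char_fun \<epsilon> m *\<^sub>R d = left.flux m 0 *\<^sub>R (right.phi m 0 *\<^sub>R d) - left.phi m 0 *\<^sub>R ((\<epsilon> * right.flux m 0) *\<^sub>R d)"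
    by (simp add: char_fun_def algebra_simps)
  also have "\<dots> = 0"
    unfolding bc[symmetric] by (simp add: mult.commute)
  finally have d0: "char_fun \<epsilon> m = 0 \<or> d = 0"
    by simp
  have "c \<noteq> 0 \<or> d \<noteq> 0"
    using x c[of x] d[of x] by (cases "x \<le> 0") auto
  with c0 d0 show "char_fun \<epsilon> m = 0"
    by blast
next
  assume root: "char_fun \<epsilon> m = 0"
  obtain c d :: complex where cd: "c \<noteq> 0 \<or> d \<noteq> 0"
    and bc: "left.flux m 0 *\<^sub>R c = (\<epsilon> * right.flux m 0) *\<^sub>R d" "left.phi m 0 *\<^sub>R c = right.phi m 0 *\<^sub>R d"
  proof (cases "left.phi m 0 = 0 \<and> right.phi m 0 = 0")
    case True
    then have "left.flux m 0 \<noteq> 0"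
      using AB_nz by blast
    then show ?thesis
      using that[of "of_real (\<epsilon> * right.flux m 0)" "of_real (left.flux m 0)"] True
      by (simp add: scaleR_conv_of_real mult.commute)
  next
    case False
    \<comment> \<open>the coefficients \<open>(C, A)\<close> make \<open>u\<close> continuous at 0, and the vanishing determinant matches the fluxes\<close>
    show ?thesis
    proof (rule that[of "of_real (right.phi m 0)" "of_real (left.phi m 0)"])
      have "left.flux m 0 * right.phi m 0 = \<epsilon> * right.flux m 0 * left.phi m 0"
        using root by (simp add: char_fun_def)
      then show "left.flux m 0 *\<^sub>R complex_of_real (right.phi m 0) =
          (\<epsilon> * right.flux m 0) *\<^sub>R complex_of_real (left.phi m 0)"
        unfolding scaleR_conv_of_real of_real_mult[symmetric] by (rule arg_cong)
    qed (use False in \<open>auto simp: scaleR_conv_of_real\<close>)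
  qed
  define u where "u x = (if x \<le> 0 then left.phi m x *\<^sub>R c else right.phi m x *\<^sub>R d)" for x
  have uL: "u x = left.phi m x *\<^sub>R c" if "x \<in> {a..0}" for x
    using that by (simp add: u_def)
  have uR: "u x = right.phi m x *\<^sub>R d" if "x \<in> {0..b}" for x
    using that bc(2) by (auto simp: u_def)
  have "perturbed_solution a b k r \<kappa> \<rho> \<epsilon> (of_real (\<epsilon> * m)) u"
    unfolding perturbed_solution_iff[OF assms]
  proof (intro exI conjI)
    show "left.sol m (\<lambda>_. 0) u (\<lambda>x. left.flux m x *\<^sub>R c)"
      by (rule left.solution_cong[OF left.multiple_of_phi[of m c]]) (simp_all add: uL)
    show "right.sol m (\<lambda>_. 0) u (\<lambda>x. right.flux m x *\<^sub>R d)"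
      by (rule right.solution_cong[OF right.multiple_of_phi[of m d]]) (simp_all add: uR)
    show "left.flux m 0 *\<^sub>R c = of_real \<epsilon> * (right.flux m 0 *\<^sub>R d)"
      using bc(1) by (simp add: scaleR_conv_of_real mult.assoc)
    show "u a = 0" "u b = 0"
      using uL[of a] uR[of b] a_neg b_pos by (simp_all add: left.phi_e right.phi_e)
  qed
  moreover have "\<exists>x\<in>{a..b}. u x \<noteq> 0"
  proof (cases "c = 0")
    case False
    obtain x where "x \<in> {a..0}" "left.phi m x \<noteq> 0"
      using left.phi_ne_0 by blast
    with False uL[of x] b_pos show ?thesis
      by (intro bexI[of _ x]) auto
  next
    case True
    obtain x where "x \<in> {0..b}" "right.phi m x \<noteq> 0"
      using right.phi_ne_0 by blast
    with True cd uR[of x] a_neg show ?thesis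
      by (intro bexI[of _ x]) auto
  qed
  ultimately show "of_real (\<epsilon> * m) \<in> perturbed_eigenvalues a b k r \<kappa> \<rho> \<epsilon>"
    unfolding perturbed_eigenvalues_def by blast
qed

end

section \<open>Eigenfunctions of the limit operator\<close>

context string
begin

lemma weak_solution_imp_sol:
  assumes y: "has_weak_deriv c d y v" and v: "in_H1 c d v" and g: "continuous_on {c..d} g"
    and kv: "has_weak_deriv c d (\<lambda>x. of_real (k x) * v x) (\<lambda>x. - of_real (r x) * (of_real m * y x + g x))"
  shows "sol m g y (\<lambda>x. of_real (k x) * v x)"
proof (rule classical_imp_sol)
  have "continuous_on {c..d} v"
    using v has_weak_deriv_continuous unfolding in_H1_def by blast
  then show "(y has_vector_derivative v x) (at x within {c..d})" if "x \<in> {c..d}" for x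
    using has_weak_deriv_imp_C1[OF y] that by blast
  have "continuous_on {c..d} (\<lambda>x. - of_real (r x) * (of_real m * y x + g x))"
    by (intro continuous_intros g r_cont has_weak_deriv_continuous[OF y])
  then show "((\<lambda>x. of_real (k x) * v x) has_vector_derivative - of_real (r x) * (of_real m * y x + g x)) (at x within {c..d})"
    if "x \<in> {c..d}" for x
    using has_weak_deriv_imp_C1[OF kv] that by blast
qed simp

text \<open>
  Solutions for a continuous inhomogeneity are classical; the derivative \<open>p / k\<close> is in \<open>H\<^sup>1\<close> because
  \<open>k\<close> is continuously differentiable.
\<close>

lemma sol_imp_weak_solution:
  fixes y p g :: "real \<Rightarrow> complex"
  assumes sol: "sol m g y p" and g: "continuous_on {c..d} g"
  defines "v \<equiv> \<lambda>x. inverse (k x) *\<^sub>R p x"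
  shows "has_weak_deriv c d y v" "in_H1 c d v"
    "has_weak_deriv c d (\<lambda>x. of_real (k x) * v x) (\<lambda>x. - of_real (r x) * (of_real m * y x + g x))"
    "L2_on c d r (\<lambda>x. of_real m * y x + g x)"
proof -
  note cont = solution_cont[OF sol]
  have v_cont: "continuous_on {c..d} v"
    unfolding v_def by (intro continuous_intros inverse_k_cont cont)
  show "has_weak_deriv c d y v"
    by (rule has_weak_deriv_C1[OF _ v_cont]) (use sol in \<open>auto simp: string_solution_def v_def\<close>)
  show "L2_on c d r (\<lambda>x. of_real m * y x + g x)"
    by (intro L2_on_continuous continuous_intros r_cont cont g)
  have p': "(p has_vector_derivative - of_real (r x) * (of_real m * y x + g x)) (at x within {c..d})"
    if "x \<in> {c..d}" for x
    using sol that by (simp add: string_solution_def scaleR_conv_of_real)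
  show "has_weak_deriv c d (\<lambda>x. of_real (k x) * v x) (\<lambda>x. - of_real (r x) * (of_real m * y x + g x))"
    unfolding v_def
    by (rule has_weak_deriv_C1, erule sol_imp_classical(2)[OF sol])
      (intro continuous_intros r_cont cont g)
  obtain k' where k'_cont: "continuous_on {c..d} k'"
    and k': "\<And>x. x \<in> {c..d} \<Longrightarrow> (k has_real_derivative k' x) (at x within {c..d})"
    by (rule smooth_on_interval_C1[OF k_smooth]) blast
  have "has_weak_deriv c d v (\<lambda>x. inverse (k x) *\<^sub>R (- of_real (r x) * (of_real m * y x + g x)) +
      (- (inverse (k x) * k' x * inverse (k x))) *\<^sub>R p x)"
  proof (rule has_weak_deriv_C1)
    show "continuous_on {c..d} (\<lambda>x. inverse (k x) *\<^sub>R (- of_real (r x) * (of_real m * y x + g x)) +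
        (- (inverse (k x) * k' x * inverse (k x))) *\<^sub>R p x)"
      by (intro continuous_intros r_cont cont g inverse_k_cont k'_cont)
    fix x assume x: "x \<in> {c..d}"
    have "((\<lambda>x. inverse (k x)) has_real_derivative - (inverse (k x) * k' x * inverse (k x))) (at x within {c..d})"
      by (rule DERIV_inverse'[OF k'[OF x]]) (use k_pos[OF x] in simp)
    from has_vector_derivative_scaleR[OF this p'[OF x]]
    show "(v has_vector_derivative inverse (k x) *\<^sub>R (- of_real (r x) * (of_real m * y x + g x)) +
        (- (inverse (k x) * k' x * inverse (k x))) *\<^sub>R p x) (at x within {c..d})"
      unfolding v_def .
  qed
  then show "in_H1 c d v"
    unfolding in_H1_def by blast
qed

text \<open>
  Lagrange's identity for the inhomogeneity \<open>\<beta> \<phi>\<close>.  The right-hand side consists of boundary terms, so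
  that suitable boundary values force \<open>\<beta> = 0\<close>: a Jordan chain cannot be continued.
\<close>

lemma resonance_identity:
  fixes y p :: "real \<Rightarrow> 'a::{banach, real_inner}"
  assumes "sol m (\<lambda>x. phi m x *\<^sub>R \<beta>) y p"
  shows "square_norm m *\<^sub>R \<beta> =
    (flux m d *\<^sub>R y d - phi m d *\<^sub>R p d) - (flux m c *\<^sub>R y c - phi m c *\<^sub>R p c)"
proof (rule has_integral_unique)
  show "((\<lambda>x. (r x * phi m x) *\<^sub>R phi m x *\<^sub>R \<beta>) has_integral
      (flux m d *\<^sub>R y d - phi m d *\<^sub>R p d) - (flux m c *\<^sub>R y c - phi m c *\<^sub>R p c)) {c..d}"
    by (rule lagrange_identity[OF phi_solution assms])
  have "((\<lambda>x. (r x * (phi m x)\<^sup>2) *\<^sub>R \<beta>) has_integral square_norm m *\<^sub>R \<beta>) {c..d}"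
    by (intro has_integral_scaleR_left integrable_integral square_norm_pos)
  then show "((\<lambda>x. (r x * phi m x) *\<^sub>R phi m x *\<^sub>R \<beta>) has_integral
      square_norm m *\<^sub>R \<beta>) {c..d}"
    by (simp add: power2_eq_square mult.assoc)
qed

lemma weighted_norm_of_multiple:
  "integral {c..d} (\<lambda>x. r x * (cmod (phi m x *\<^sub>R z))\<^sup>2) =
    square_norm m * (cmod z)\<^sup>2"
  by (simp add: power_mult_distrib flip: integral_mult_left mult.assoc)

end

context string_pair
begin

text \<open>
  A continuous right-hand side makes the weak derivatives continuous, so that the weak formulation of
  the operator becomes the classical one.
\<close>

lemma A_graph_iff:
  assumes g: "continuous_on {a..0} (fst g)" "continuous_on {0..b} (snd g)"
  shows "A_graph a b k r \<kappa> \<rho> u (pair_scale (of_real m) u + g) \<longleftrightarrow>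
    (\<exists>P Q. left.sol m (fst g) (fst u) P \<and> right.sol m (snd g) (snd u) Q \<and>
       P 0 = 0 \<and> fst u a = 0 \<and> snd u b = 0 \<and> fst u 0 = snd u 0)" (is "?lhs \<longleftrightarrow> ?rhs")
proof
  have pair_eq: "fst (pair_scale (of_real m) u + g) = (\<lambda>x. of_real m * fst u x + fst g x)"
    "snd (pair_scale (of_real m) u + g) = (\<lambda>x. of_real m * snd u x + snd g x)"
    by (simp_all add: pair_scale_def fun_eq_iff)
  {
    assume ?lhs
    then obtain v1 v2 where v1: "has_weak_deriv a 0 (fst u) v1" "in_H1 a 0 v1"
        "has_weak_deriv a 0 (\<lambda>x. of_real (k x) * v1 x) (\<lambda>x. - of_real (r x) * (of_real m * fst u x + fst g x))"
      and v2: "has_weak_deriv 0 b (snd u) v2" "in_H1 0 b v2"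
        "has_weak_deriv 0 b (\<lambda>x. of_real (\<kappa> x) * v2 x) (\<lambda>x. - of_real (\<rho> x) * (of_real m * snd u x + snd g x))"
      and bc: "fst u a = 0" "v1 0 = 0" "snd u b = 0" "fst u 0 = snd u 0"
      unfolding A_graph_def pair_eq by blast
    have "left.sol m (fst g) (fst u) (\<lambda>x. of_real (k x) * v1 x)"
      by (rule left.weak_solution_imp_sol[OF v1(1,2) g(1) v1(3)])
    moreover have "right.sol m (snd g) (snd u) (\<lambda>x. of_real (\<kappa> x) * v2 x)"
      by (rule right.weak_solution_imp_sol[OF v2(1,2) g(2) v2(3)])
    moreover have "of_real (k 0) * v1 0 = 0"
      using bc(2) by simp
    ultimately show ?rhs
      using bc by blast
  }
  assume ?rhs
  then obtain P Q where P: "left.sol m (fst g) (fst u) P" and Q: "right.sol m (snd g) (snd u) Q"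
    and bc: "P 0 = 0" "fst u a = 0" "snd u b = 0" "fst u 0 = snd u 0"
    by blast
  note L = left.sol_imp_weak_solution[OF P g(1)]
  note R = right.sol_imp_weak_solution[OF Q g(2)]
  have "inverse (k 0) *\<^sub>R P 0 = 0"
    using bc(1) by simp
  then show ?lhs
    unfolding A_graph_def in_L_def pair_eq using L R bc by blast
qed

lemma L_norm_nonneg: "0 \<le> L_norm a b r \<rho> u"
  unfolding L_norm_def using left.r_pos right.r_pos
  by (intro real_sqrt_ge_zero add_nonneg_nonneg integral_nonneg_or_undefined mult_nonneg_nonneg)
    (auto simp: less_imp_le)

definition multiples :: "real \<Rightarrow> complex \<Rightarrow> complex \<Rightarrow> fpair" where
  "multiples m c d = (\<lambda>x. left.phi m x *\<^sub>R c, \<lambda>x. right.phi m x *\<^sub>R d)"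

lemma L_norm_multiples:
  "L_norm a b r \<rho> (multiples m c d) = sqrt (left.square_norm m * (cmod c)\<^sup>2 +
    right.square_norm m * (cmod d)\<^sup>2)"
  unfolding L_norm_def multiples_def fst_conv snd_conv
    left.weighted_norm_of_multiple right.weighted_norm_of_multiple by (rule refl)

lemma A_eigenfunction_multiples:
  assumes "left.flux m 0 *\<^sub>R c = 0" "left.phi m 0 *\<^sub>R c = right.phi m 0 *\<^sub>R d" "c \<noteq> 0 \<or> d \<noteq> 0"
  shows "A_eigenfunction a b k r \<kappa> \<rho> (of_real m) (multiples m c d)"
  unfolding A_eigenfunction_def
proof
  have "A_graph a b k r \<kappa> \<rho> (multiples m c d) (pair_scale (of_real m) (multiples m c d) + 0)"
  proof (subst A_graph_iff)
    show "\<exists>P Q. left.sol m (fst 0) (fst (multiples m c d)) P \<and> right.sol m (snd 0) (snd (multiples m c d)) Q \<and>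
       P 0 = 0 \<and> fst (multiples m c d) a = 0 \<and> snd (multiples m c d) b = 0 \<and>
       fst (multiples m c d) 0 = snd (multiples m c d) 0"
    proof (intro exI conjI)
      show "left.sol m (fst 0) (fst (multiples m c d)) (\<lambda>x. left.flux m x *\<^sub>R c)"
        "right.sol m (snd 0) (snd (multiples m c d)) (\<lambda>x. right.flux m x *\<^sub>R d)"
        using left.multiple_of_phi[of m c] right.multiple_of_phi[of m d]
        by (simp_all add: multiples_def zero_fun_def)
    qed (use assms(1,2) in \<open>simp_all add: multiples_def left.phi_e right.phi_e\<close>)
  qed (simp_all add: zero_fun_def)
  then show "A_graph a b k r \<kappa> \<rho> (multiples m c d) (pair_scale (of_real m) (multiples m c d))"
    by simp
  have "0 < left.square_norm m * (cmod c)\<^sup>2 +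
      right.square_norm m * (cmod d)\<^sup>2"
    using assms(3) left.square_norm_pos(2)[of m] right.square_norm_pos(2)[of m]
    by (auto intro: add_pos_nonneg add_nonneg_pos)
  then show "L_norm a b r \<rho> (multiples m c d) \<noteq> 0"
    unfolding L_norm_multiples by simp
qed

lemma char_fun_0_imp_eigenfunction:
  assumes "char_fun 0 m = 0"
  obtains v where "A_eigenfunction a b k r \<kappa> \<rho> (of_real m) v"
proof (cases "right.phi m 0 = 0")
  case True
  show ?thesis
    by (rule that[OF A_eigenfunction_multiples[of m 0 1]]) (simp_all add: True)
next
  case False
  then have "left.flux m 0 = 0"
    using assms char_fun_0 by simp
  with False show ?thesis
    by (intro that[OF A_eigenfunction_multiples[of m "of_real (right.phi m 0)" "of_real (left.phi m 0)"]])
      (simp_all add: scaleR_conv_of_real)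
qed

text \<open>
  An eigenfunction contradicts the resolvent estimate, as \<open>A v - z v = 0\<close>.
\<close>

lemma eigenvalue_in_spectrum:
  assumes "A_eigenfunction a b k r \<kappa> \<rho> z v"
  shows "z \<in> A_spectrum a b k r \<kappa> \<rho>"
proof -
  have False if "\<And>u g. A_graph a b k r \<kappa> \<rho> u g \<Longrightarrow> L_norm a b r \<rho> u \<le> C * L_norm a b r \<rho> (g - pair_scale z u)" for C
  proof -
    have "L_norm a b r \<rho> v \<le> C * L_norm a b r \<rho> 0"
      using that[of v "pair_scale z v"] assms by (simp add: A_eigenfunction_def)
    moreover have "L_norm a b r \<rho> 0 = 0"
      by (simp add: L_norm_def)
    moreover have "0 < L_norm a b r \<rho> v"
      using assms L_norm_nonneg[of v] by (simp add: A_eigenfunction_def less_le)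
    ultimately show False
      by simp
  qed
  then show ?thesis
    unfolding A_spectrum_def A_resolvent_set_def by blast
qed

end

section \<open>Algebraic multiplicity and convergence of the eigenvalues\<close>

text \<open>
  The kernels consist of functions that vanish outside the closed intervals.
\<close>

definition cut :: "real \<Rightarrow> real \<Rightarrow> (real \<Rightarrow> complex) \<Rightarrow> real \<Rightarrow> complex" where
  "cut c d f x = (if x \<in> {c..d} then f x else 0)"

context string_pair
begin

abbreviation "root_space m n \<equiv> A_kernel a b k r \<kappa> \<rho> (of_real m) n"

definition cut_multiples :: "real \<Rightarrow> complex \<Rightarrow> complex \<Rightarrow> fpair" where
  "cut_multiples m c d = (cut a 0 (\<lambda>x. left.phi m x *\<^sub>R c), cut 0 b (\<lambda>x. right.phi m x *\<^sub>R d))"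

lemma root_space_continuous:
  "f \<in> root_space m n \<Longrightarrow> continuous_on {a..0} (fst f) \<and> continuous_on {0..b} (snd f)"
proof (induction n arbitrary: f)
  case 0
  then show ?case
    by (simp add: zero_fun_def)
next
  case (Suc n)
  then obtain g where "continuous_on {a..0} (fst g) \<and> continuous_on {0..b} (snd g)"
    and "A_graph a b k r \<kappa> \<rho> f (pair_scale (of_real m) f + g)"
    by auto
  then obtain P Q where "left.sol m (fst g) (fst f) P" "right.sol m (snd g) (snd f) Q"
    using A_graph_iff by blast
  then show ?case
    using left.solution_cont(1) right.solution_cont(1) by blast
qed

text \<open>
  By induction, the root vectors are continuous, so that the classical description of the operator
  applies at every step of a chain.
\<close>

lemma root_space_Suc_iff:
  "u \<in> root_space m (Suc n) \<longleftrightarrow>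
    (\<forall>x. x \<notin> {a..0} \<longrightarrow> fst u x = 0) \<and> (\<forall>x. x \<notin> {0..b} \<longrightarrow> snd u x = 0) \<and>
    (\<exists>f\<in>root_space m n. \<exists>P Q. left.sol m (fst f) (fst u) P \<and> right.sol m (snd f) (snd u) Q \<and>
       P 0 = 0 \<and> fst u a = 0 \<and> snd u b = 0 \<and> fst u 0 = snd u 0)"
proof -
  have "A_graph a b k r \<kappa> \<rho> u (pair_scale (of_real m) u + f) \<longleftrightarrow>
    (\<exists>P Q. left.sol m (fst f) (fst u) P \<and> right.sol m (snd f) (snd u) Q \<and>
       P 0 = 0 \<and> fst u a = 0 \<and> snd u b = 0 \<and> fst u 0 = snd u 0)" if "f \<in> root_space m n" for f
    using A_graph_iff root_space_continuous[OF that] by blast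
  then show ?thesis
    by auto
qed

lemma cut_multiples_sol:
  "left.sol m (\<lambda>_. 0) (fst (cut_multiples m c d)) (\<lambda>x. left.flux m x *\<^sub>R c)"
  "right.sol m (\<lambda>_. 0) (snd (cut_multiples m c d)) (\<lambda>x. right.flux m x *\<^sub>R d)"
  by (rule left.solution_cong[OF left.multiple_of_phi[of m c]]; simp add: cut_multiples_def cut_def)
    (rule right.solution_cong[OF right.multiple_of_phi[of m d]]; simp add: cut_multiples_def cut_def)

lemma cut_multiples_values:
  "fst (cut_multiples m c d) a = 0" "snd (cut_multiples m c d) b = 0"
  "fst (cut_multiples m c d) 0 = left.phi m 0 *\<^sub>R c" "snd (cut_multiples m c d) 0 = right.phi m 0 *\<^sub>R d"
  using a_neg b_pos by (simp_all add: cut_multiples_def cut_def left.phi_e right.phi_e)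

lemma cut_multiples_outside:
  "x \<notin> {a..0} \<Longrightarrow> fst (cut_multiples m c d) x = 0" "x \<notin> {0..b} \<Longrightarrow> snd (cut_multiples m c d) x = 0"
  by (auto simp: cut_multiples_def cut_def)

lemma pair_scale_cut_multiples:
  "pair_scale z (cut_multiples m c d) = cut_multiples m (z * c) (z * d)"
  by (simp add: pair_scale_def cut_multiples_def cut_def fun_eq_iff)

lemma cut_multiples_eq_0_iff: "cut_multiples m c d = 0 \<longleftrightarrow> c = 0 \<and> d = 0"
proof
  assume zero: "cut_multiples m c d = 0"
  obtain x where x: "x \<in> {a..0}" "left.phi m x \<noteq> 0"
    using left.phi_ne_0 by blast
  have "fst (cut_multiples m c d) x = 0"
    unfolding zero by simp
  then have "c = 0"
    using x by (simp add: cut_multiples_def cut_def)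
  obtain y where y: "y \<in> {0..b}" "right.phi m y \<noteq> 0"
    using right.phi_ne_0 by blast
  have "snd (cut_multiples m c d) y = 0"
    unfolding zero by simp
  then have "d = 0"
    using y by (simp add: cut_multiples_def cut_def)
  with \<open>c = 0\<close> show "c = 0 \<and> d = 0"
    by blast
qed (simp add: cut_multiples_def cut_def zero_prod_def zero_fun_def fun_eq_iff)

lemma cut_multiples_root_space:
  assumes "left.flux m 0 *\<^sub>R c = 0" "left.phi m 0 *\<^sub>R c = right.phi m 0 *\<^sub>R d"
  shows "cut_multiples m c d \<in> root_space m (Suc 0)"
  unfolding root_space_Suc_iff
proof (intro conjI bexI exI)
  show "left.sol m (fst 0) (fst (cut_multiples m c d)) (\<lambda>x. left.flux m x *\<^sub>R c)"
    "right.sol m (snd 0) (snd (cut_multiples m c d)) (\<lambda>x. right.flux m x *\<^sub>R d)"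
    using cut_multiples_sol by (simp_all add: zero_fun_def)
qed (use assms in \<open>simp_all add: cut_multiples_values cut_multiples_outside\<close>)

lemma homogeneous_root_vector:
  assumes P: "left.sol m (\<lambda>_. 0) (fst u) P" and Q: "right.sol m (\<lambda>_. 0) (snd u) Q"
    and outside: "\<And>x. x \<notin> {a..0} \<Longrightarrow> fst u x = 0" "\<And>x. x \<notin> {0..b} \<Longrightarrow> snd u x = 0"
    and bc: "P 0 = 0" "fst u a = 0" "snd u b = 0" "fst u 0 = snd u 0"
  obtains c d where "u = cut_multiples m c d" "left.flux m 0 *\<^sub>R c = 0"
    "left.phi m 0 *\<^sub>R c = right.phi m 0 *\<^sub>R d"
proof
  note L = left.solution_eq_multiple_of_phi[OF P bc(2)]
  note R = right.solution_eq_multiple_of_phi[OF Q bc(3)]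
  have "fst u x = fst (cut_multiples m (P a) (Q b)) x" for x
    using L(1)[of x] outside(1)[of x] by (cases "x \<in> {a..0}") (simp_all add: cut_multiples_def cut_def)
  moreover have "snd u x = snd (cut_multiples m (P a) (Q b)) x" for x
    using R(1)[of x] outside(2)[of x] by (cases "x \<in> {0..b}") (simp_all add: cut_multiples_def cut_def)
  ultimately show "u = cut_multiples m (P a) (Q b)"
    by (simp add: prod_eq_iff fun_eq_iff)
  show "left.flux m 0 *\<^sub>R P a = 0"
    using L(2)[of 0] bc(1) a_neg by simp
  show "left.phi m 0 *\<^sub>R P a = right.phi m 0 *\<^sub>R Q b"
    using L(1)[of 0] R(1)[of 0] bc(4) a_neg b_pos by simp
qed

lemma left_resonance:
  fixes \<beta> :: complex
  assumes "left.sol m (\<lambda>x. left.phi m x *\<^sub>R \<beta>) y P" "y a = 0" "P 0 = 0" "left.flux m 0 = 0 \<or> y 0 = 0"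
  shows "\<beta> = 0"
proof -
  have "left.square_norm m *\<^sub>R \<beta> = 0"
    unfolding left.resonance_identity[OF assms(1)] using assms(2-) by (auto simp: left.phi_e)
  then show ?thesis
    using left.square_norm_pos(2)[of m] by simp
qed

lemma right_resonance:
  fixes \<beta> :: complex
  assumes "right.sol m (\<lambda>x. right.phi m x *\<^sub>R \<beta>) y Q" "y b = 0" "y 0 = 0" "right.phi m 0 = 0"
  shows "\<beta> = 0"
proof -
  have "right.square_norm m *\<^sub>R \<beta> = 0"
    unfolding right.resonance_identity[OF assms(1)] using assms(2-) by (auto simp: right.phi_e)
  then show ?thesis
    using right.square_norm_pos(2)[of m] by simp
qed

text \<open>
  When the previous kernel lies in the span of one pair \<open>(c0 \<phi>, d0 \<psi>)\<close>, a vector of the next kernel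
  solves the equations with an inhomogeneity from this span.  Below, Lagrange's identity shows that this
  inhomogeneity vanishes.
\<close>

lemma root_space_Suc_over_multiples:
  assumes u: "u \<in> root_space m (Suc n)"
    and f: "\<And>f. f \<in> root_space m n \<Longrightarrow> \<exists>\<alpha>. f = cut_multiples m (\<alpha> * c0) (\<alpha> * d0)"
  obtains \<alpha> P Q where
    "left.sol m (\<lambda>x. left.phi m x *\<^sub>R (\<alpha> * c0)) (fst u) P"
    "right.sol m (\<lambda>x. right.phi m x *\<^sub>R (\<alpha> * d0)) (snd u) Q"
    "\<And>x. x \<notin> {a..0} \<Longrightarrow> fst u x = 0" "\<And>x. x \<notin> {0..b} \<Longrightarrow> snd u x = 0"
    "P 0 = 0" "fst u a = 0" "snd u b = 0" "fst u 0 = snd u 0"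
proof -
  obtain g P Q where g: "g \<in> root_space m n"
    and PQ: "left.sol m (fst g) (fst u) P" "right.sol m (snd g) (snd u) Q"
    and bc: "P 0 = 0" "fst u a = 0" "snd u b = 0" "fst u 0 = snd u 0"
    and outside: "\<And>x. x \<notin> {a..0} \<Longrightarrow> fst u x = 0" "\<And>x. x \<notin> {0..b} \<Longrightarrow> snd u x = 0"
    using u unfolding root_space_Suc_iff by blast
  obtain \<alpha> where \<alpha>: "g = cut_multiples m (\<alpha> * c0) (\<alpha> * d0)"
    using f[OF g] by blast
  have "left.sol m (\<lambda>x. left.phi m x *\<^sub>R (\<alpha> * c0)) (fst u) P"
    by (rule left.solution_cong[OF PQ(1)]) (simp_all add: \<alpha> cut_multiples_def cut_def)
  moreover have "right.sol m (\<lambda>x. right.phi m x *\<^sub>R (\<alpha> * d0)) (snd u) Q"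
    by (rule right.solution_cong[OF PQ(2)]) (simp_all add: \<alpha> cut_multiples_def cut_def)
  ultimately show ?thesis
    using that outside bc by blast
qed

lemma algebraic_multiplicity_1:
  assumes e: "left.flux m 0 *\<^sub>R c0 = 0" "left.phi m 0 *\<^sub>R c0 = right.phi m 0 *\<^sub>R d0" "c0 \<noteq> 0 \<or> d0 \<noteq> 0"
    and n: "\<And>n f. f \<in> root_space m n \<Longrightarrow> \<exists>\<alpha>. f = cut_multiples m (\<alpha> * c0) (\<alpha> * d0)"
  shows "A_algebraic_multiplicity a b k r \<kappa> \<rho> (of_real m) = 1"
  unfolding A_algebraic_multiplicity_def
proof (rule fpair.dim_unique)
  show "{cut_multiples m c0 d0} \<subseteq> (\<Union>n. root_space m n)"
    using cut_multiples_root_space[OF e(1,2)] by blast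
  show "(\<Union>n. root_space m n) \<subseteq> fpair.span {cut_multiples m c0 d0}"
    unfolding fpair.span_singleton pair_scale_cut_multiples using n by blast
  show "fpair.independent {cut_multiples m c0 d0}"
    using e(3) by (simp add: cut_multiples_eq_0_iff)
qed simp

lemma multiplicity_regular:
  assumes "left.flux m 0 \<noteq> 0" "right.phi m 0 \<noteq> 0"
  shows "A_algebraic_multiplicity a b k r \<kappa> \<rho> (of_real m) = 0"
proof -
  have "f = 0" if "f \<in> root_space m n" for n f
    using that
  proof (induction n arbitrary: f)
    case (Suc n)
    have "\<exists>\<alpha>. g = cut_multiples m (\<alpha> * 0) (\<alpha> * 0)" if "g \<in> root_space m n" for g
      using Suc.IH[OF that] by (simp add: cut_multiples_eq_0_iff)
    from root_space_Suc_over_multiples[OF Suc.prems this] obtain P Q where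
      PQ: "left.sol m (\<lambda>_. 0) (fst f) P" "right.sol m (\<lambda>_. 0) (snd f) Q"
      and out: "\<And>x. x \<notin> {a..0} \<Longrightarrow> fst f x = 0" "\<And>x. x \<notin> {0..b} \<Longrightarrow> snd f x = 0"
      and bc: "P 0 = 0" "fst f a = 0" "snd f b = 0" "fst f 0 = snd f 0"
      by (auto)
    obtain c d where "f = cut_multiples m c d" "left.flux m 0 *\<^sub>R c = 0" "left.phi m 0 *\<^sub>R c = right.phi m 0 *\<^sub>R d"
      by (rule homogeneous_root_vector[OF PQ out bc])
    then show ?case
      using assms by (simp add: cut_multiples_eq_0_iff)
  qed simp
  then have "(\<Union>n. root_space m n) \<subseteq> fpair.span {}"
    by auto
  then show ?thesis
    unfolding A_algebraic_multiplicity_def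
    by (intro fpair.dim_unique[of "{}"]) (auto simp: fpair.independent_empty)
qed

text \<open>
  The left part of a root vector of height 2 would be resonant: it solves the equation with
  inhomogeneity \<open>\<alpha> \<phi>\<close> and has flux 0 at the junction, as \<open>\<phi>\<close> does.
\<close>

lemma multiplicity_left:
  assumes B: "left.flux m 0 = 0" and C: "right.phi m 0 \<noteq> 0"
  shows "A_algebraic_multiplicity a b k r \<kappa> \<rho> (of_real m) = 1"
proof -
  define \<tau> where "\<tau> = complex_of_real (left.phi m 0 / right.phi m 0)"
  have \<tau>: "left.phi m 0 *\<^sub>R c = right.phi m 0 *\<^sub>R d \<longleftrightarrow> d = c * \<tau>" for c d
    using C by (auto simp: \<tau>_def scaleR_conv_of_real field_simps)
  have "\<exists>\<alpha>. f = cut_multiples m (\<alpha> * 1) (\<alpha> * \<tau>)" if "f \<in> root_space m n" for n f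
    using that
  proof (induction n arbitrary: f)
    case 0
    then show ?case
      by (intro exI[of _ 0]) (simp add: cut_multiples_eq_0_iff[THEN iffD2])
  next
    case (Suc n)
    obtain \<alpha> P Q where
      P: "left.sol m (\<lambda>x. left.phi m x *\<^sub>R (\<alpha> * 1)) (fst f) P"
      and Q: "right.sol m (\<lambda>x. right.phi m x *\<^sub>R (\<alpha> * \<tau>)) (snd f) Q"
      and out: "\<And>x. x \<notin> {a..0} \<Longrightarrow> fst f x = 0" "\<And>x. x \<notin> {0..b} \<Longrightarrow> snd f x = 0"
      and bc: "P 0 = 0" "fst f a = 0" "snd f b = 0" "fst f 0 = snd f 0"
      by (rule root_space_Suc_over_multiples[OF Suc.prems Suc.IH]) (assumption, rule that)
    \<comment> \<open>at the junction both \<open>\<phi>\<close> and the left part of \<open>f\<close> have flux 0\<close>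
    have "\<alpha> * 1 = 0"
      by (rule left_resonance[OF P bc(2,1)]) (simp add: B)
    then have PQ: "left.sol m (\<lambda>_. 0) (fst f) P" "right.sol m (\<lambda>_. 0) (snd f) Q"
      using P Q by simp_all
    obtain c d where "f = cut_multiples m c d" "left.flux m 0 *\<^sub>R c = 0" "left.phi m 0 *\<^sub>R c = right.phi m 0 *\<^sub>R d"
      by (rule homogeneous_root_vector[OF PQ out bc])
    then show ?case
      using \<tau> by auto
  qed
  then show ?thesis
    by (rule algebraic_multiplicity_1[rotated 3]) (simp_all add: B \<tau>)
qed

text \<open>
  The eigenfunction vanishes on the left.  The left part of a root vector is then a multiple of \<open>\<phi>\<close>
  with flux 0 at the junction, hence zero; so the right part vanishes at the junction, as \<open>\<psi>\<close> does,
  and resonance excludes a nonzero inhomogeneity.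
\<close>

lemma multiplicity_right:
  assumes B: "left.flux m 0 \<noteq> 0" and C: "right.phi m 0 = 0"
  shows "A_algebraic_multiplicity a b k r \<kappa> \<rho> (of_real m) = 1"
proof -
  have "\<exists>\<alpha>. f = cut_multiples m (\<alpha> * 0) (\<alpha> * 1)" if "f \<in> root_space m n" for n f
    using that
  proof (induction n arbitrary: f)
    case 0
    then show ?case
      by (intro exI[of _ 0]) (simp add: cut_multiples_eq_0_iff[THEN iffD2])
  next
    case (Suc n)
    obtain \<alpha> P Q where
      P: "left.sol m (\<lambda>x. left.phi m x *\<^sub>R (\<alpha> * 0)) (fst f) P"
      and Q: "right.sol m (\<lambda>x. right.phi m x *\<^sub>R (\<alpha> * 1)) (snd f) Q"
      and out: "\<And>x. x \<notin> {a..0} \<Longrightarrow> fst f x = 0" "\<And>x. x \<notin> {0..b} \<Longrightarrow> snd f x = 0"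
      and bc: "P 0 = 0" "fst f a = 0" "snd f b = 0" "fst f 0 = snd f 0"
      by (rule root_space_Suc_over_multiples[OF Suc.prems Suc.IH]) (assumption, rule that)
    have P0: "left.sol m (\<lambda>_. 0) (fst f) P"
      using P by simp
    note L = left.solution_eq_multiple_of_phi[OF P0 bc(2), of 0]
    have "snd f 0 = 0"
      using L bc(1,4) B a_neg by simp
    then have "\<alpha> * 1 = 0"
      by (intro right_resonance[OF Q bc(3) _ C])
    then have Q0: "right.sol m (\<lambda>_. 0) (snd f) Q"
      using Q by simp
    obtain c d where "f = cut_multiples m c d" "left.flux m 0 *\<^sub>R c = 0" "left.phi m 0 *\<^sub>R c = right.phi m 0 *\<^sub>R d"
      by (rule homogeneous_root_vector[OF P0 Q0 out bc])
    then show ?case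
      using B by auto
  qed
  then show ?thesis
    by (rule algebraic_multiplicity_1[rotated 3]) (simp_all add: C)
qed

text \<open>
  Here a Jordan chain of length 2 exists.  The eigenfunction is \<open>e1 = (0, \<psi>)\<close>.  Resonance on the right
  prescribes the value at the junction of a solution \<open>\<zeta>\<close> with inhomogeneity \<open>\<gamma> \<psi>\<close>, and \<open>\<gamma>\<close> is chosen
  so that this value is that of \<open>\<phi>\<close>; then \<open>e2 = (\<phi>, \<zeta>)\<close> satisfies \<open>(A - m) e2 = \<gamma> e1\<close>.  The chain
  stops there, since a vector above \<open>e2\<close> would be resonant on the left.
\<close>

lemma multiplicity_both:
  assumes B: "left.flux m 0 = 0" and C: "right.phi m 0 = 0"
  shows "A_algebraic_multiplicity a b k r \<kappa> \<rho> (of_real m) = 2"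
proof -
  define I where "I = right.square_norm m"
  have "0 < I"
    unfolding I_def by (rule right.square_norm_pos)
  have D: "right.flux m 0 \<noteq> 0"
    using CD_nz C by blast
  \<comment> \<open>chosen so that Lagrange's identity gives the solution below the value of \<open>\<phi>\<close> at the junction\<close>
  define \<gamma> :: complex where "\<gamma> = of_real (- right.flux m 0 * left.phi m 0 / I)"
  obtain \<zeta> X :: "real \<Rightarrow> complex" where \<zeta>: "right.sol m (\<lambda>x. right.phi m x *\<^sub>R \<gamma>) \<zeta> X" "\<zeta> b = 0"
    by (rule right.solution_exists[of "\<lambda>x. right.phi m x *\<^sub>R \<gamma>" m 0 0])
      (intro continuous_intros right.phi_cont)
  have "right.flux m 0 *\<^sub>R (\<zeta> 0 - of_real (left.phi m 0)) = 0"
    using right.resonance_identity[OF \<zeta>(1)] \<open>0 < I\<close> \<zeta>(2) C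
    by (auto simp: I_def[symmetric] right.phi_e \<gamma>_def scaleR_conv_of_real algebra_simps)
  then have \<zeta>0: "\<zeta> 0 = of_real (left.phi m 0)"
    using D by simp
  define e2 :: fpair where "e2 = (cut a 0 (\<lambda>x. left.phi m x *\<^sub>R 1), cut 0 b \<zeta>)"
  define e1 where "e1 = cut_multiples m 0 1"
  have e2_left: "left.sol m (\<lambda>_. 0) (fst e2) (\<lambda>x. left.flux m x *\<^sub>R 1)"
    by (rule left.solution_cong[OF left.multiple_of_phi[of m 1]]) (simp_all add: e2_def cut_def)
  have e2_right: "right.sol m (\<lambda>x. right.phi m x *\<^sub>R \<gamma>) (snd e2) X"
    by (rule right.solution_cong[OF \<zeta>(1)]) (simp_all add: e2_def cut_def)
  have e2_bc: "fst e2 a = 0" "snd e2 b = 0" "fst e2 0 = of_real (left.phi m 0)" "snd e2 0 = of_real (left.phi m 0)"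
    using a_neg b_pos \<zeta>0 \<zeta>(2) by (simp_all add: e2_def cut_def left.phi_e scaleR_conv_of_real)
  have e2_out: "x \<notin> {a..0} \<Longrightarrow> fst e2 x = 0" "x \<notin> {0..b} \<Longrightarrow> snd e2 x = 0" for x
    by (auto simp: e2_def cut_def)
  have e1_root: "pair_scale \<gamma> e1 \<in> root_space m (Suc 0)" "e1 \<in> root_space m (Suc 0)"
    unfolding e1_def pair_scale_cut_multiples by (rule cut_multiples_root_space; simp add: C)+
  have e2_root: "e2 \<in> root_space m (Suc (Suc 0))"
    unfolding root_space_Suc_iff[of _ _ "Suc 0"]
  proof (intro conjI bexI[OF _ e1_root(1)] exI)
    show "left.sol m (fst (pair_scale \<gamma> e1)) (fst e2) (\<lambda>x. left.flux m x *\<^sub>R 1)"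
      by (rule left.solution_cong[OF e2_left]) (simp_all add: e1_def pair_scale_def cut_multiples_def cut_def
          scaleR_conv_of_real mult.commute)
    show "right.sol m (snd (pair_scale \<gamma> e1)) (snd e2) X"
      by (rule right.solution_cong[OF e2_right]) (simp_all add: e1_def pair_scale_def cut_multiples_def cut_def
          scaleR_conv_of_real mult.commute)
  qed (use e2_bc e2_out B in auto)
  have span: "f \<in> fpair.span {e1, e2}" if "f \<in> root_space m n" for n f
    using that
  proof (induction n arbitrary: f)
    case 0
    then show ?case
      by (simp add: fpair.span_zero)
  next
    case (Suc n)
    then obtain g P Q where g: "g \<in> root_space m n"
      and PQ: "left.sol m (fst g) (fst f) P" "right.sol m (snd g) (snd f) Q"
      and bc: "P 0 = 0" "fst f a = 0" "snd f b = 0" "fst f 0 = snd f 0"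
      and out: "\<And>x. x \<notin> {a..0} \<Longrightarrow> fst f x = 0" "\<And>x. x \<notin> {0..b} \<Longrightarrow> snd f x = 0"
      unfolding root_space_Suc_iff by blast
    obtain \<alpha> \<beta> where \<alpha>\<beta>: "g = pair_scale \<alpha> e1 + pair_scale \<beta> e2"
      using Suc.IH[OF g] unfolding fpair.span_breakdown_eq fpair.span_singleton
      by (metis (no_types, lifting) add.commute diff_add_cancel fpair.span_singleton imageE)
    have P\<beta>: "left.sol m (\<lambda>x. left.phi m x *\<^sub>R \<beta>) (fst f) P"
      by (rule left.solution_cong[OF PQ(1)])
        (simp_all add: \<alpha>\<beta> e1_def e2_def pair_scale_def cut_multiples_def cut_def scaleR_conv_of_real mult.commute)
    have "\<beta> = 0"
      by (rule left_resonance[OF P\<beta> bc(2,1)]) (simp add: B)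
    then have g_eq: "g = pair_scale \<alpha> e1"
      using \<alpha>\<beta> by simp
    have P0: "left.sol m (\<lambda>_. 0) (fst f) P"
      by (rule left.solution_cong[OF PQ(1)])
        (simp_all add: g_eq e1_def pair_scale_def cut_multiples_def cut_def)
    have Q\<alpha>: "right.sol m (\<lambda>x. right.phi m x *\<^sub>R \<alpha>) (snd f) Q"
      by (rule right.solution_cong[OF PQ(2)])
        (simp_all add: g_eq e1_def pair_scale_def cut_multiples_def cut_def scaleR_conv_of_real mult.commute)
    \<comment> \<open>the multiple of \<open>e2\<close> has the same left part as \<open>f\<close>, so that \<open>w\<close> lives on the right string only\<close>
    define w where "w = f - pair_scale (P a) e2"
    have w_fst: "fst w = (\<lambda>x. fst f x - P a * fst e2 x)" and w_snd: "snd w = (\<lambda>x. snd f x - P a * snd e2 x)"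
      by (simp_all add: w_def pair_scale_def fun_eq_iff)
    have f0: "fst f 0 = left.phi m 0 *\<^sub>R P a"
      using left.solution_eq_multiple_of_phi(1)[OF P0 bc(2), of 0] a_neg by simp
    have scaled_left: "left.sol m (\<lambda>x. P a * 0) (\<lambda>x. P a * fst e2 x) (\<lambda>x. P a * (left.flux m x *\<^sub>R 1))"
      by (rule left.solution_map[OF e2_left bounded_linear_mult_right])
    have scaled_right: "right.sol m (\<lambda>x. P a * (right.phi m x *\<^sub>R \<gamma>)) (\<lambda>x. P a * snd e2 x) (\<lambda>x. P a * X x)"
      by (rule right.solution_map[OF e2_right bounded_linear_mult_right])
    have wL: "left.sol m (\<lambda>_. 0) (fst w) (\<lambda>x. P x - P a * (left.flux m x *\<^sub>R 1))"
      using left.solution_diff[OF P0 scaled_left] by (simp add: w_fst)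
    have wR: "right.sol m (\<lambda>x. right.phi m x *\<^sub>R (\<alpha> - P a * \<gamma>)) (snd w) (\<lambda>x. Q x - P a * X x)"
      using right.solution_diff[OF Q\<alpha> scaled_right] by (simp add: w_snd algebra_simps)
    have w0: "fst w 0 = 0" "snd w 0 = 0" and w_ends: "fst w a = 0" "snd w b = 0"
      using bc e2_bc f0 by (simp_all add: w_fst w_snd scaleR_conv_of_real mult.commute)
    have "\<alpha> - P a * \<gamma> = 0"
      by (rule right_resonance[OF wR w_ends(2) w0(2) C])
    then have wR0: "right.sol m (\<lambda>_. 0) (snd w) (\<lambda>x. Q x - P a * X x)"
      using wR by simp
    have "w = cut_multiples m c d \<Longrightarrow> c = 0 \<Longrightarrow> w \<in> fpair.span {e1, e2}" for c d
      using fpair.span_scale[OF fpair.span_base[of e1 "{e1, e2}"], of d]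
      by (simp add: e1_def pair_scale_cut_multiples)
    moreover obtain c d where cd: "w = cut_multiples m c d"
    proof (rule homogeneous_root_vector[OF wL wR0])
      show "x \<notin> {a..0} \<Longrightarrow> fst w x = 0" "x \<notin> {0..b} \<Longrightarrow> snd w x = 0" for x
        using out e2_out by (simp_all add: w_fst w_snd)
    qed (use bc(1) B w0 w_ends in auto)
    moreover have "c = 0"
    proof -
      have "left.phi m 0 *\<^sub>R c = 0"
        using w0(1) cut_multiples_values(3)[of m c d] cd by simp
      then show ?thesis
        using AB_nz[of m] B by simp
    qed
    ultimately have "w \<in> fpair.span {e1, e2}"
      by blast
    moreover have "pair_scale (P a) e2 \<in> fpair.span {e1, e2}"
      by (intro fpair.span_scale fpair.span_base) simp
    ultimately have "w + pair_scale (P a) e2 \<in> fpair.span {e1, e2}"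
      by (rule fpair.span_add)
    then show ?case
      by (simp add: w_def)
  qed
  have not_multiple: "e2 \<notin> fpair.span {e1}"
  proof
    assume "e2 \<in> fpair.span {e1}"
    then obtain z where "e2 = pair_scale z e1"
      unfolding fpair.span_singleton by blast
    then have "fst e2 0 = 0"
      by (simp add: e1_def pair_scale_cut_multiples cut_multiples_values)
    then have "left.phi m 0 = 0"
      using e2_bc(3) by simp
    then show False
      using AB_nz[of m] B by blast
  qed
  then have "e2 \<noteq> e1"
    using fpair.span_base[of e1 "{e1}"] by auto
  have "fpair.independent {e2, e1}"
    by (rule fpair.independent_insertI[OF not_multiple]) (simp add: e1_def cut_multiples_eq_0_iff)
  then have indep: "fpair.independent {e1, e2}"
    by (simp add: insert_commute)
  show ?thesis
    unfolding A_algebraic_multiplicity_def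
  proof (rule fpair.dim_unique[OF _ _ indep])
    show "{e1, e2} \<subseteq> (\<Union>n. root_space m n)"
      using e1_root(2) e2_root by blast
    show "(\<Union>n. root_space m n) \<subseteq> fpair.span {e1, e2}"
      using span by blast
    show "card {e1, e2} = 2"
      using \<open>e2 \<noteq> e1\<close> by simp
  qed
qed

lemma algebraic_multiplicity: "A_algebraic_multiplicity a b k r \<kappa> \<rho> (of_real m) = root_mult m"
  unfolding root_mult_def
  using multiplicity_regular[of m] multiplicity_left[of m] multiplicity_right[of m] multiplicity_both[of m]
  by (cases "left.flux m 0 = 0"; cases "right.phi m 0 = 0") simp_all

text \<open>
  Every term of the enumeration has positive multiplicity and is therefore a root; conversely, every
  root is an eigenvalue.
\<close>

lemma spectrum_enumeration:
  assumes "enumerates_A_spectrum a b k r \<kappa> \<rho> mu"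
  shows "mono mu" "range mu = {m. char_fun 0 m = 0}"
    "finite {i. mu i = mu j}" "card {i. mu i = mu j} = root_mult (mu j)"
proof -
  have range: "range (\<lambda>j. complex_of_real (mu j)) = A_spectrum a b k r \<kappa> \<rho>"
    and mult: "\<And>j. finite {i. mu i = mu j}" "\<And>j. card {i. mu i = mu j} = root_mult (mu j)"
    and "mono mu"
    using assms unfolding enumerates_A_spectrum_def algebraic_multiplicity by blast+
  show "mono mu" "finite {i. mu i = mu j}" "card {i. mu i = mu j} = root_mult (mu j)"
    by fact+
  show "range mu = {m. char_fun 0 m = 0}"
  proof (intro equalityI subsetI)
    fix m assume "m \<in> range mu"
    then obtain j where "m = mu j"
      by blast
    moreover have "card {i. mu i = mu j} \<noteq> 0"
      using mult(1)[of j] by auto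
    ultimately have "root_mult m \<noteq> 0"
      using mult(2)[of j] by simp
    then show "m \<in> {m. char_fun 0 m = 0}"
      by (auto simp: root_mult_def char_fun_0)
  next
    fix m assume "m \<in> {m. char_fun 0 m = 0}"
    then obtain v where "A_eigenfunction a b k r \<kappa> \<rho> (of_real m) v"
      using char_fun_0_imp_eigenfunction by blast
    from eigenvalue_in_spectrum[OF this] obtain j where "complex_of_real m = of_real (mu j)"
      using range by blast
    then show "m \<in> range mu"
      by simp
  qed
qed

lemma eigenvalues_converge:
  assumes lam: "\<And>\<epsilon>. 0 < \<epsilon> \<Longrightarrow> enumerates_perturbed a b k r \<kappa> \<rho> \<epsilon> (lam \<epsilon>)"
    and mu: "enumerates_A_spectrum a b k r \<kappa> \<rho> mu"
  shows "((\<lambda>\<epsilon>. inverse \<epsilon> * lam \<epsilon> j) \<longlongrightarrow> mu j) (at_right 0)"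
proof (rule enumerated_roots_converge[of "\<lambda>\<epsilon> j. inverse \<epsilon> * lam \<epsilon> j"])
  fix \<epsilon> :: real assume "0 < \<epsilon>"
  have mono: "strict_mono (lam \<epsilon>)"
    and range: "range (\<lambda>j. complex_of_real (lam \<epsilon> j)) = perturbed_eigenvalues a b k r \<kappa> \<rho> \<epsilon>"
    using lam[OF \<open>0 < \<epsilon>\<close>] by (simp_all add: enumerates_perturbed_def)
  show "strict_mono (\<lambda>j. inverse \<epsilon> * lam \<epsilon> j)"
    using strict_monoD[OF mono] \<open>0 < \<epsilon>\<close> by (auto intro!: strict_monoI mult_strict_left_mono)
  show "range (\<lambda>j. inverse \<epsilon> * lam \<epsilon> j) = {m. char_fun \<epsilon> m = 0}"
  proof (intro equalityI subsetI)
    fix m assume "m \<in> range (\<lambda>j. inverse \<epsilon> * lam \<epsilon> j)"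
    then obtain j where "m = inverse \<epsilon> * lam \<epsilon> j"
      by blast
    then have "\<epsilon> * m = lam \<epsilon> j"
      using \<open>0 < \<epsilon>\<close> by simp
    moreover have "complex_of_real (lam \<epsilon> j) \<in> perturbed_eigenvalues a b k r \<kappa> \<rho> \<epsilon>"
      using range by blast
    ultimately have "of_real (\<epsilon> * m) \<in> perturbed_eigenvalues a b k r \<kappa> \<rho> \<epsilon>"
      by simp
    then show "m \<in> {m. char_fun \<epsilon> m = 0}"
      using perturbed_eigenvalue_iff[OF \<open>0 < \<epsilon>\<close>] by blast
  next
    fix m assume "m \<in> {m. char_fun \<epsilon> m = 0}"
    then have "of_real (\<epsilon> * m) \<in> perturbed_eigenvalues a b k r \<kappa> \<rho> \<epsilon>"
      using perturbed_eigenvalue_iff[OF \<open>0 < \<epsilon>\<close>] by blast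
    then obtain j where "complex_of_real (\<epsilon> * m) = of_real (lam \<epsilon> j)"
      using range by blast
    then have "\<epsilon> * m = lam \<epsilon> j"
      by (simp only: of_real_eq_iff)
    then have "m = inverse \<epsilon> * lam \<epsilon> j"
      using \<open>0 < \<epsilon>\<close> by (simp add: field_simps)
    then show "m \<in> range (\<lambda>j. inverse \<epsilon> * lam \<epsilon> j)"
      by blast
  qed
qed (rule spectrum_enumeration[OF mu])+

end

section \<open>Convergence of the eigenfunctions\<close>

context string_pair
begin

lemma has_weak_deriv_pieces:
  assumes left: "\<And>x. x \<in> {a..0} \<Longrightarrow> f x = of_real (y x)"
      "\<And>x. x \<in> {a..0} \<Longrightarrow> (y has_real_derivative y' x) (at x within {a..0})" "continuous_on {a..0} y'"
    and right: "\<And>x. x \<in> {0..b} \<Longrightarrow> f x = of_real (z x)"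
      "\<And>x. x \<in> {0..b} \<Longrightarrow> (z has_real_derivative z' x) (at x within {0..b})" "continuous_on {0..b} z'"
  shows "has_weak_deriv a b f (\<lambda>x. if x < 0 then of_real (y' x) else of_real (z' x))"
proof (rule has_weak_deriv_glue)
  have of_real_deriv: "((\<lambda>x. complex_of_real (h x)) has_vector_derivative of_real h') (at x within S)"
    if "(h has_real_derivative h') (at x within S)" for h h' x S
    using bounded_linear.has_vector_derivative[OF bounded_linear_of_real] that
    by (simp add: has_real_derivative_iff_has_vector_derivative)
  show "has_weak_deriv a 0 f (\<lambda>x. of_real (y' x))"
  proof (rule has_weak_deriv_C1)
    show "(f has_vector_derivative of_real (y' x)) (at x within {a..0})" if x: "x \<in> {a..0}" for x
      by (rule has_vector_derivative_transform[OF x left(1) of_real_deriv[OF left(2)[OF x]]])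
  qed (intro continuous_intros left)
  show "has_weak_deriv 0 b f (\<lambda>x. of_real (z' x))"
  proof (rule has_weak_deriv_C1)
    show "(f has_vector_derivative of_real (z' x)) (at x within {0..b})" if x: "x \<in> {0..b}" for x
      by (rule has_vector_derivative_transform[OF x right(1) of_real_deriv[OF right(2)[OF x]]])
  qed (intro continuous_intros right)
qed (use a_neg b_pos in auto)

definition normalized_coefficients :: "real \<Rightarrow> real \<Rightarrow> (real \<Rightarrow> real) \<Rightarrow> real \<Rightarrow> real \<Rightarrow> bool" where
  "normalized_coefficients \<epsilon> m u c d \<longleftrightarrow>
    (\<forall>x\<in>{a..0}. u x = c * left.phi m x) \<and> (\<forall>x\<in>{0..b}. u x = d * right.phi m x) \<and>
    c * left.flux m 0 = \<epsilon> * (d * right.flux m 0) \<and> c * left.phi m 0 = d * right.phi m 0 \<and> 0 < d \<and>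
    c\<^sup>2 * left.square_norm m + d\<^sup>2 * right.square_norm m = 1"

text \<open>
  A real function has real coefficients, obtained by taking real parts; \<open>d > 0\<close> since \<open>\<psi>'(b) > 0\<close>.
\<close>

lemma normalized_eigenfunction_coefficients:
  assumes "0 < \<epsilon>" and u: "normalized_eigenfunction a b k r \<kappa> \<rho> \<epsilon> l u"
  defines "m \<equiv> inverse \<epsilon> * l"
  shows "\<exists>c d. normalized_coefficients \<epsilon> m u c d"
proof -
  have "l = \<epsilon> * m"
    using \<open>0 < \<epsilon>\<close> by (simp add: m_def)
  then have "perturbed_solution a b k r \<kappa> \<rho> \<epsilon> (of_real (\<epsilon> * m)) (\<lambda>x. of_real (u x))"
    using u by (simp add: normalized_eigenfunction_def)
  then obtain c d where c: "\<And>x. x \<in> {a..0} \<Longrightarrow> complex_of_real (u x) = left.phi m x *\<^sub>R c"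
    and d: "\<And>x. x \<in> {0..b} \<Longrightarrow> complex_of_real (u x) = right.phi m x *\<^sub>R d"
    and bc: "left.flux m 0 *\<^sub>R c = (\<epsilon> * right.flux m 0) *\<^sub>R d" "left.phi m 0 *\<^sub>R c = right.phi m 0 *\<^sub>R d"
    by (rule perturbed_solution_form[OF \<open>0 < \<epsilon>\<close>]) (rule that)
  have uL: "u x = Re c * left.phi m x" if "x \<in> {a..0}" for x
    using arg_cong[OF c[OF that], of Re] by simp
  have uR: "u x = Re d * right.phi m x" if "x \<in> {0..b}" for x
    using arg_cong[OF d[OF that], of Re] by simp
  have "0 < Re d"
  proof -
    obtain u' where "0 < u'" and u': "(u has_real_derivative u') (at b within {a..b})"
      using u unfolding normalized_eigenfunction_def by blast
    have "(u has_real_derivative u') (at b within {0..b})"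
      by (rule has_field_derivative_subset[OF u']) (use a_neg in auto)
    then have "((\<lambda>x. Re d * right.phi m x) has_real_derivative u') (at b within {0..b})"
      by (rule has_field_derivative_transform_within[where d = 1]) (use uR b_pos in auto)
    moreover have "((\<lambda>x. Re d * right.phi m x) has_real_derivative Re d * (inverse (\<kappa> b) * right.flux m b))
        (at b within {0..b})"
      by (intro DERIV_cmult right.phi_deriv) (use b_pos in auto)
    ultimately have "u' = Re d * (inverse (\<kappa> b) * right.flux m b)"
      unfolding has_real_derivative_iff_has_vector_derivative
      using vector_derivative_unique_within_closed_interval[of 0 b b] b_pos by (auto simp: box_real)
    then have "0 < Re d * inverse (\<kappa> b)"
      using \<open>0 < u'\<close> by (simp add: right.flux_e)
    moreover have "0 < inverse (\<kappa> b)"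
      using right.k_pos[of b] b_pos by simp
    ultimately show ?thesis
      using zero_less_mult_pos2 by blast
  qed
  moreover have "(Re c)\<^sup>2 * left.square_norm m +
      (Re d)\<^sup>2 * right.square_norm m = 1"
  proof (rule has_integral_unique)
    show "((\<lambda>x. (if x < 0 then r x else \<rho> x) * (u x)\<^sup>2) has_integral 1) {a..b}"
      using u by (simp add: normalized_eigenfunction_def)
    have "((\<lambda>x. (Re c)\<^sup>2 * (r x * (left.phi m x)\<^sup>2)) has_integral
        (Re c)\<^sup>2 * left.square_norm m) {a..0}"
      by (intro has_integral_mult_right integrable_integral left.square_norm_pos)
    then have "((\<lambda>x. (if x < 0 then r x else \<rho> x) * (u x)\<^sup>2) has_integral
        (Re c)\<^sup>2 * left.square_norm m) {a..0}"
      by (rule has_integral_spike_finite[of "{0}", rotated 2]) (auto simp: uL power_mult_distrib)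
    moreover have "((\<lambda>x. (Re d)\<^sup>2 * (\<rho> x * (right.phi m x)\<^sup>2)) has_integral
        (Re d)\<^sup>2 * right.square_norm m) {0..b}"
      by (intro has_integral_mult_right integrable_integral right.square_norm_pos)
    then have "((\<lambda>x. (if x < 0 then r x else \<rho> x) * (u x)\<^sup>2) has_integral
        (Re d)\<^sup>2 * right.square_norm m) {0..b}"
      by (rule has_integral_eq[rotated]) (auto simp: uR power_mult_distrib)
    ultimately show "((\<lambda>x. (if x < 0 then r x else \<rho> x) * (u x)\<^sup>2) has_integral
        (Re c)\<^sup>2 * left.square_norm m +
        (Re d)\<^sup>2 * right.square_norm m) {a..b}"
      using a_neg b_pos by (intro has_integral_combine[of a 0 b]) auto
  qed
  moreover have "Re c * left.flux m 0 = \<epsilon> * (Re d * right.flux m 0)"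
    using arg_cong[OF bc(1), of Re] by (simp add: mult_ac)
  moreover have "Re c * left.phi m 0 = Re d * right.phi m 0"
    using arg_cong[OF bc(2), of Re] by (simp add: mult_ac)
  ultimately show ?thesis
    unfolding normalized_coefficients_def using uL uR by blast
qed

text \<open>
  Where the denominators do not vanish, the quotient \<open>t = c / d\<close> equals \<open>C / A\<close> and also \<open>\<epsilon> D / B\<close>.
  The first has a limit when \<open>A \<noteq> 0\<close> at \<open>\<mu>\<close>, the second when \<open>B \<noteq> 0\<close>.  The normalization then yields
  \<open>d = 1 / sqrt (t\<^sup>2 I + J)\<close>, where \<open>I\<close> and \<open>J\<close> are the weighted square integrals of the two fundamental
  solutions.
\<close>

lemma coefficients_converge:
  assumes L: "(L \<longlongrightarrow> \<mu>) (at_right 0)"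
    and cd: "\<And>\<epsilon>. 0 < \<epsilon> \<Longrightarrow> normalized_coefficients \<epsilon> (L \<epsilon>) (u \<epsilon>) (c \<epsilon>) (d \<epsilon>)"
  obtains c0 d0 where "(c \<longlongrightarrow> c0) (at_right 0)" "(d \<longlongrightarrow> d0) (at_right 0)"
    "c0 * left.flux \<mu> 0 = 0" "c0 * left.phi \<mu> 0 = d0 * right.phi \<mu> 0" "d0 \<noteq> 0"
proof -
  have bc: "c \<epsilon> * left.flux (L \<epsilon>) 0 = \<epsilon> * (d \<epsilon> * right.flux (L \<epsilon>) 0)"
      "c \<epsilon> * left.phi (L \<epsilon>) 0 = d \<epsilon> * right.phi (L \<epsilon>) 0"
    and d_pos: "0 < d \<epsilon>"
    and norm: "(c \<epsilon>)\<^sup>2 * left.square_norm (L \<epsilon>) +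
      (d \<epsilon>)\<^sup>2 * right.square_norm (L \<epsilon>) = 1" if "0 < \<epsilon>" for \<epsilon>
    using cd[OF that] unfolding normalized_coefficients_def by blast+
  have lim: "((\<lambda>\<epsilon>. left.phi (L \<epsilon>) 0) \<longlongrightarrow> left.phi \<mu> 0) (at_right 0)"
    "((\<lambda>\<epsilon>. left.flux (L \<epsilon>) 0) \<longlongrightarrow> left.flux \<mu> 0) (at_right 0)"
    "((\<lambda>\<epsilon>. right.phi (L \<epsilon>) 0) \<longlongrightarrow> right.phi \<mu> 0) (at_right 0)"
    "((\<lambda>\<epsilon>. right.flux (L \<epsilon>) 0) \<longlongrightarrow> right.flux \<mu> 0) (at_right 0)"
    by (rule isCont_tendsto_compose[OF cont(1) L] isCont_tendsto_compose[OF cont(2) L]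
        isCont_tendsto_compose[OF cont(3) L] isCont_tendsto_compose[OF cont(4) L])+
  define I where "I m = left.square_norm m" for m
  define J where "J m = right.square_norm m" for m
  have I: "((\<lambda>\<epsilon>. I (L \<epsilon>)) \<longlongrightarrow> I \<mu>) (at_right 0)" and J: "((\<lambda>\<epsilon>. J (L \<epsilon>)) \<longlongrightarrow> J \<mu>) (at_right 0)"
    using left.gram_tendsto[OF L L] right.gram_tendsto[OF L L]
    by (simp_all add: I_def J_def power2_eq_square mult.assoc)
  have pos: "0 < I m" "0 < J m" for m
    unfolding I_def J_def by (rule left.square_norm_pos right.square_norm_pos)+
  define t where "t \<epsilon> = c \<epsilon> / d \<epsilon>" for \<epsilon>
  have c_eq: "c \<epsilon> = t \<epsilon> * d \<epsilon>" if "0 < \<epsilon>" for \<epsilon>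
    using d_pos[OF that] by (simp add: t_def)
  have pos_eps: "\<forall>\<^sub>F \<epsilon> in at_right 0. (0::real) < \<epsilon>"
    by (rule eventually_at_right_less)
  obtain t0 where t: "(t \<longlongrightarrow> t0) (at_right 0)"
  proof (cases "left.phi \<mu> 0 = 0")
    case False
    have "\<forall>\<^sub>F \<epsilon> in at_right 0. left.phi (L \<epsilon>) 0 \<noteq> 0"
      by (rule tendsto_imp_eventually_ne[OF lim(1) False])
    then have "\<forall>\<^sub>F \<epsilon> in at_right 0. right.phi (L \<epsilon>) 0 / left.phi (L \<epsilon>) 0 = t \<epsilon>"
      using pos_eps
    proof eventually_elim
      case (elim \<epsilon>)
      then show ?case
        using bc(2)[of \<epsilon>] d_pos[of \<epsilon>] by (simp add: t_def field_simps)
    qed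
    then have "(t \<longlongrightarrow> right.phi \<mu> 0 / left.phi \<mu> 0) (at_right 0)"
      by (rule Lim_transform_eventually[OF tendsto_divide[OF lim(3,1) False]])
    then show ?thesis
      by (rule that)
  next
    case True
    then have B_ne: "left.flux \<mu> 0 \<noteq> 0"
      using AB_nz by blast
    have "\<forall>\<^sub>F \<epsilon> in at_right 0. left.flux (L \<epsilon>) 0 \<noteq> 0"
      by (rule tendsto_imp_eventually_ne[OF lim(2) B_ne])
    then have "\<forall>\<^sub>F \<epsilon> in at_right 0. \<epsilon> * right.flux (L \<epsilon>) 0 / left.flux (L \<epsilon>) 0 = t \<epsilon>"
      using pos_eps
    proof eventually_elim
      case (elim \<epsilon>)
      then show ?case
        using bc(1)[of \<epsilon>] d_pos[of \<epsilon>] by (simp add: t_def field_simps)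
    qed
    then have "(t \<longlongrightarrow> 0 * right.flux \<mu> 0 / left.flux \<mu> 0) (at_right 0)"
      by (rule Lim_transform_eventually[rotated]) (intro tendsto_intros lim B_ne)
    then show ?thesis
      by (rule that)
  qed
  define d0 where "d0 = 1 / sqrt (t0\<^sup>2 * I \<mu> + J \<mu>)"
  have "0 < t0\<^sup>2 * I \<mu> + J \<mu>"
    using pos by (intro add_nonneg_pos) (auto simp: less_imp_le)
  then have "d0 \<noteq> 0" and sqrt_ne: "sqrt (t0\<^sup>2 * I \<mu> + J \<mu>) \<noteq> 0"
    by (auto simp: d0_def)
  have "\<forall>\<^sub>F \<epsilon> in at_right 0. 1 / sqrt ((t \<epsilon>)\<^sup>2 * I (L \<epsilon>) + J (L \<epsilon>)) = d \<epsilon>"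
    using pos_eps
  proof eventually_elim
    case (elim \<epsilon>)
    have "(d \<epsilon>)\<^sup>2 * ((t \<epsilon>)\<^sup>2 * I (L \<epsilon>) + J (L \<epsilon>)) = 1"
      using norm[OF elim] c_eq[OF elim] by (simp add: I_def J_def power_mult_distrib algebra_simps)
    then have "sqrt ((d \<epsilon>)\<^sup>2 * ((t \<epsilon>)\<^sup>2 * I (L \<epsilon>) + J (L \<epsilon>))) = 1"
      by simp
    then have "d \<epsilon> * sqrt ((t \<epsilon>)\<^sup>2 * I (L \<epsilon>) + J (L \<epsilon>)) = 1"
      using d_pos[OF elim] by (simp add: real_sqrt_mult)
    then show ?case
      by (metis nonzero_eq_divide_eq mult_zero_right zero_neq_one)
  qed
  then have d: "(d \<longlongrightarrow> d0) (at_right 0)"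
    unfolding d0_def by (rule Lim_transform_eventually[rotated]) (intro tendsto_intros t I J sqrt_ne)
  have c: "(c \<longlongrightarrow> t0 * d0) (at_right 0)"
  proof (rule Lim_transform_eventually[OF tendsto_mult[OF t d]])
    show "\<forall>\<^sub>F \<epsilon> in at_right 0. t \<epsilon> * d \<epsilon> = c \<epsilon>"
      using pos_eps by eventually_elim (simp add: c_eq)
  qed
  show ?thesis
  proof (rule that[OF c d _ _ \<open>d0 \<noteq> 0\<close>])
    have "((\<lambda>\<epsilon>. \<epsilon> * (d \<epsilon> * right.flux (L \<epsilon>) 0)) \<longlongrightarrow> 0 * (d0 * right.flux \<mu> 0)) (at_right 0)"
      by (intro tendsto_intros d lim)
    moreover have "\<forall>\<^sub>F \<epsilon> in at_right 0. \<epsilon> * (d \<epsilon> * right.flux (L \<epsilon>) 0) = c \<epsilon> * left.flux (L \<epsilon>) 0"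
      using pos_eps by eventually_elim (simp add: bc(1))
    ultimately have "((\<lambda>\<epsilon>. c \<epsilon> * left.flux (L \<epsilon>) 0) \<longlongrightarrow> 0) (at_right 0)"
      by (auto dest: Lim_transform_eventually)
    then show "t0 * d0 * left.flux \<mu> 0 = 0"
      using tendsto_unique[OF trivial_limit_at_right_real tendsto_mult[OF c lim(2)]] by blast
    have "\<forall>\<^sub>F \<epsilon> in at_right 0. d \<epsilon> * right.phi (L \<epsilon>) 0 = c \<epsilon> * left.phi (L \<epsilon>) 0"
      using pos_eps by eventually_elim (simp add: bc(2))
    then have "((\<lambda>\<epsilon>. c \<epsilon> * left.phi (L \<epsilon>) 0) \<longlongrightarrow> d0 * right.phi \<mu> 0) (at_right 0)"
      by (rule Lim_transform_eventually[OF tendsto_mult[OF d lim(3)]])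
    then show "t0 * d0 * left.phi \<mu> 0 = d0 * right.phi \<mu> 0"
      using tendsto_unique[OF trivial_limit_at_right_real tendsto_mult[OF c lim(1)]] by blast
  qed
qed

text \<open>
  The limit pair satisfies the transmission conditions in the limit, which are the boundary conditions
  of the limit operator.  Values and derivatives converge uniformly on both halves, hence in \<open>H\<^sup>1\<close>.
\<close>

lemma eigenfunctions_converge:
  fixes l :: "real \<Rightarrow> real" and u :: "real \<Rightarrow> real \<Rightarrow> real"
  assumes u: "\<And>\<epsilon>. 0 < \<epsilon> \<Longrightarrow> normalized_eigenfunction a b k r \<kappa> \<rho> \<epsilon> (l \<epsilon>) (u \<epsilon>)"
    and L: "((\<lambda>\<epsilon>. inverse \<epsilon> * l \<epsilon>) \<longlongrightarrow> \<mu>) (at_right 0)"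
  shows "\<exists>v. A_eigenfunction a b k r \<kappa> \<rho> (of_real \<mu>) v \<and> in_H1 a b (glue v) \<and>
    (\<forall>\<epsilon>>0. in_H1 a b (\<lambda>x. of_real (u \<epsilon> x))) \<and>
    ((\<lambda>\<epsilon>. H1_norm a b (\<lambda>x. of_real (u \<epsilon> x) - glue v x)) \<longlongrightarrow> 0) (at_right 0)"
proof -
  define L where "L \<epsilon> = inverse \<epsilon> * l \<epsilon>" for \<epsilon>
  have L_lim: "(L \<longlongrightarrow> \<mu>) (at_right 0)"
    using L by (simp add: L_def[abs_def])
  have "\<forall>\<epsilon>>0. \<exists>c d. normalized_coefficients \<epsilon> (L \<epsilon>) (u \<epsilon>) c d"
    using normalized_eigenfunction_coefficients u unfolding L_def by blast
  then obtain c d where cd: "\<And>\<epsilon>. 0 < \<epsilon> \<Longrightarrow> normalized_coefficients \<epsilon> (L \<epsilon>) (u \<epsilon>) (c \<epsilon>) (d \<epsilon>)"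
    by metis
  have uL: "u \<epsilon> x = c \<epsilon> * left.phi (L \<epsilon>) x" if "0 < \<epsilon>" "x \<in> {a..0}" for \<epsilon> x
    using cd[OF that(1)] that(2) unfolding normalized_coefficients_def by blast
  have uR: "u \<epsilon> x = d \<epsilon> * right.phi (L \<epsilon>) x" if "0 < \<epsilon>" "x \<in> {0..b}" for \<epsilon> x
    using cd[OF that(1)] that(2) unfolding normalized_coefficients_def by blast
  obtain c0 d0 where c: "(c \<longlongrightarrow> c0) (at_right 0)" and d: "(d \<longlongrightarrow> d0) (at_right 0)"
    and bc0: "c0 * left.flux \<mu> 0 = 0" "c0 * left.phi \<mu> 0 = d0 * right.phi \<mu> 0" and "d0 \<noteq> 0"
    by (rule coefficients_converge[OF L_lim cd]) (assumption, rule that)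
  define v where "v = multiples \<mu> (of_real c0) (of_real d0)"
  have vL: "glue v x = of_real (c0 * left.phi \<mu> x)" if "x \<in> {a..0}" for x
    using that bc0(2) by (auto simp: glue_def v_def multiples_def scaleR_conv_of_real mult.commute simp flip: of_real_mult)
  have vR: "glue v x = of_real (d0 * right.phi \<mu> x)" if "x \<in> {0..b}" for x
    using that by (simp add: glue_def v_def multiples_def scaleR_conv_of_real)
  have eigen: "A_eigenfunction a b k r \<kappa> \<rho> (of_real \<mu>) v"
    unfolding v_def
  proof (rule A_eigenfunction_multiples)
    show "left.flux \<mu> 0 *\<^sub>R complex_of_real c0 = 0"
      using bc0(1) by auto
    show "left.phi \<mu> 0 *\<^sub>R complex_of_real c0 = right.phi \<mu> 0 *\<^sub>R complex_of_real d0"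
      using bc0(2) by (simp add: scaleR_conv_of_real mult.commute flip: of_real_mult)
  qed (use \<open>d0 \<noteq> 0\<close> in simp)
  have left_deriv: "((\<lambda>x. z * left.phi m x) has_real_derivative inverse (k x) * (z * left.flux m x)) (at x within {a..0})"
    if "x \<in> {a..0}" for z m x
    using DERIV_cmult[OF left.phi_deriv[OF that], of z m] by (simp add: mult.left_commute)
  have right_deriv: "((\<lambda>x. z * right.phi m x) has_real_derivative inverse (\<kappa> x) * (z * right.flux m x)) (at x within {0..b})"
    if "x \<in> {0..b}" for z m x
    using DERIV_cmult[OF right.phi_deriv[OF that], of z m] by (simp add: mult.left_commute)
  have left_cont: "continuous_on {a..0} (\<lambda>x. inverse (k x) * (z * left.flux m x))" for z m
    by (intro continuous_intros left.inverse_k_cont left.flux_cont)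
  have right_cont: "continuous_on {0..b} (\<lambda>x. inverse (\<kappa> x) * (z * right.flux m x))" for z m
    by (intro continuous_intros right.inverse_k_cont right.flux_cont)
  have "in_H1 a b (glue v)"
    unfolding in_H1_def
    by (rule exI, rule has_weak_deriv_pieces[OF vL left_deriv left_cont vR right_deriv right_cont])
  moreover have "in_H1 a b (\<lambda>x. of_real (u \<epsilon> x))" if "0 < \<epsilon>" for \<epsilon>
    unfolding in_H1_def
  proof (rule exI, rule has_weak_deriv_pieces[OF _ left_deriv left_cont _ right_deriv right_cont])
    show "complex_of_real (u \<epsilon> x) = of_real (c \<epsilon> * left.phi (L \<epsilon>) x)" if "x \<in> {a..0}" for x
      using uL[OF \<open>0 < \<epsilon>\<close> that] by simp
    show "complex_of_real (u \<epsilon> x) = of_real (d \<epsilon> * right.phi (L \<epsilon>) x)" if "x \<in> {0..b}" for x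
      using uR[OF \<open>0 < \<epsilon>\<close> that] by simp
  qed
  moreover have "((\<lambda>\<epsilon>. H1_norm a b (\<lambda>x. of_real (u \<epsilon> x) - glue v x)) \<longlongrightarrow> 0) (at_right 0)"
  proof (rule tendstoI)
    fix \<eta> :: real assume "0 < \<eta>"
    define S where "S = sqrt (2 * (b - a))"
    have "0 \<le> S"
      using a_neg b_pos by (simp add: S_def)
    \<comment> \<open>the summand 1 gives the strict inequality \<open>S * \<eta>' < \<eta>\<close> also for \<open>S = 0\<close>\<close>
    define \<eta>' where "\<eta>' = \<eta> / (S + 1)"
    have "0 < \<eta>'"
      using \<open>0 < \<eta>\<close> \<open>0 \<le> S\<close> by (simp add: \<eta>'_def)
    have "S * \<eta>' < \<eta>"
      using \<open>0 < \<eta>\<close> \<open>0 \<le> S\<close> by (simp add: \<eta>'_def field_simps)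
    show "\<forall>\<^sub>F \<epsilon> in at_right 0. dist (H1_norm a b (\<lambda>x. of_real (u \<epsilon> x) - glue v x)) 0 < \<eta>"
      using uniform_limitD[OF left.scaled_phi_uniform(1)[OF L_lim c] \<open>0 < \<eta>'\<close>]
        uniform_limitD[OF left.scaled_phi_uniform(2)[OF L_lim c] \<open>0 < \<eta>'\<close>]
        uniform_limitD[OF right.scaled_phi_uniform(1)[OF L_lim d] \<open>0 < \<eta>'\<close>]
        uniform_limitD[OF right.scaled_phi_uniform(2)[OF L_lim d] \<open>0 < \<eta>'\<close>]
        eventually_at_right_less[of 0]
    proof eventually_elim
      case (elim \<epsilon>)
      define w where "w x = complex_of_real (u \<epsilon> x) - glue v x" for x
      define y where "y x = c \<epsilon> * left.phi (L \<epsilon>) x - c0 * left.phi \<mu> x" for x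
      define y' where "y' x = inverse (k x) * (c \<epsilon> * left.flux (L \<epsilon>) x) - inverse (k x) * (c0 * left.flux \<mu> x)" for x
      define z where "z x = d \<epsilon> * right.phi (L \<epsilon>) x - d0 * right.phi \<mu> x" for x
      define z' where "z' x = inverse (\<kappa> x) * (d \<epsilon> * right.flux (L \<epsilon>) x) - inverse (\<kappa> x) * (d0 * right.flux \<mu> x)" for x
      have wL: "w x = of_real (y x)" if "x \<in> {a..0}" for x
        using uL[OF elim(5) that] vL[OF that] by (simp add: w_def y_def)
      have wR: "w x = of_real (z x)" if "x \<in> {0..b}" for x
        using uR[OF elim(5) that] vR[OF that] by (simp add: w_def z_def)
      have small: "\<bar>y x\<bar> < \<eta>'" "\<bar>y' x\<bar> < \<eta>'" if "x \<in> {a..0}" for x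
        using elim(1,2) that unfolding y_def y'_def dist_real_def by blast+
      have small': "\<bar>z x\<bar> < \<eta>'" "\<bar>z' x\<bar> < \<eta>'" if "x \<in> {0..b}" for x
        using elim(3,4) that unfolding z_def z'_def dist_real_def by blast+
      have "has_weak_deriv a b w (\<lambda>x. if x < 0 then of_real (y' x) else of_real (z' x))"
        by (rule has_weak_deriv_pieces[OF wL _ _ wR])
          (auto simp only: y_def y'_def z_def z'_def
            intro!: DERIV_diff left_deriv right_deriv continuous_on_diff left_cont right_cont)
      then have "H1_norm a b w \<le> S * \<eta>'"
        unfolding S_def
      proof (rule H1_norm_le)
        fix x assume x: "x \<in> {a..b}"
        show "cmod (w x) \<le> \<eta>'" "cmod (if x < 0 then complex_of_real (y' x) else of_real (z' x)) \<le> \<eta>'"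
          using x wL[of x] wR[of x] small[of x] small'[of x]
          by (cases "x < 0"; force simp: less_imp_le)+
      qed (use a_neg b_pos in auto)
      then show ?case
        using H1_norm_nonneg[of a b w] \<open>S * \<eta>' < \<eta>\<close> unfolding w_def by simp
    qed
  qed
  ultimately show ?thesis
    using eigen by blast
qed

end

theorem theorem2:
  fixes a b :: real
    and k r \<kappa> \<rho> :: "real \<Rightarrow> real"
    and lam :: "real \<Rightarrow> nat \<Rightarrow> real"
    and u :: "real \<Rightarrow> nat \<Rightarrow> real \<Rightarrow> real"
    and mu :: "nat \<Rightarrow> real"
  assumes "a < 0" and "0 < b"
    and "smooth_on_interval a 0 k" and "\<And>x. x \<in> {a..0} \<Longrightarrow> 0 < k x"
    and "smooth_on_interval a 0 r" and "\<And>x. x \<in> {a..0} \<Longrightarrow> 0 < r x"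
    and "smooth_on_interval 0 b \<kappa>" and "\<And>x. x \<in> {0..b} \<Longrightarrow> 0 < \<kappa> x"
    and "smooth_on_interval 0 b \<rho>" and "\<And>x. x \<in> {0..b} \<Longrightarrow> 0 < \<rho> x"
    and "\<And>\<epsilon>. 0 < \<epsilon> \<Longrightarrow> enumerates_perturbed a b k r \<kappa> \<rho> \<epsilon> (lam \<epsilon>)"
    and "\<And>\<epsilon> j. 0 < \<epsilon> \<Longrightarrow> normalized_eigenfunction a b k r \<kappa> \<rho> \<epsilon> (lam \<epsilon> j) (u \<epsilon> j)"
    and "enumerates_A_spectrum a b k r \<kappa> \<rho> mu"
  shows "(\<forall>j. ((\<lambda>\<epsilon>. inverse \<epsilon> * lam \<epsilon> j) \<longlongrightarrow> mu j) (at_right 0)) \<and>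
    (\<forall>j. \<exists>v. A_eigenfunction a b k r \<kappa> \<rho> (of_real (mu j)) v \<and>
       in_H1 a b (glue v) \<and>
       (\<forall>\<epsilon>>0. in_H1 a b (\<lambda>x. of_real (u \<epsilon> j x))) \<and>
       ((\<lambda>\<epsilon>. H1_norm a b (\<lambda>x. of_real (u \<epsilon> j x) - glue v x)) \<longlongrightarrow> 0) (at_right 0))"
proof -
  interpret string_pair a b k r \<kappa> \<rho>
    by (intro string_pair.intro string.intro) (use assms in auto)
  have lim: "((\<lambda>\<epsilon>. inverse \<epsilon> * lam \<epsilon> j) \<longlongrightarrow> mu j) (at_right 0)" for j
    by (rule eigenvalues_converge[OF assms(11,13)])
  show ?thesis
  proof (intro conjI allI lim)
    fix j
    show "\<exists>v. A_eigenfunction a b k r \<kappa> \<rho> (of_real (mu j)) v \<and> in_H1 a b (glue v) \<and>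
       (\<forall>\<epsilon>>0. in_H1 a b (\<lambda>x. of_real (u \<epsilon> j x))) \<and>
       ((\<lambda>\<epsilon>. H1_norm a b (\<lambda>x. of_real (u \<epsilon> j x) - glue v x)) \<longlongrightarrow> 0) (at_right 0)"
      by (rule eigenfunctions_converge[OF assms(12) lim])
  qed
qed

end
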